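(* Let $r\ge 2$ be an integer. Let $\Pi_0^r:C^\infty(T)\to S_r^0(T^{\rm ps})$, $\Pi_1^{r-1}:[C^\infty(T)]^2\to L_{r-1}^1(T^{\rm ps})$ and $\Pi_2^{r-2}:C^\infty(T)\to V_{r-2}^2(T^{\rm ps})$ be the projections induced by the degrees of freedom (A), (B), (C) listed in the context, respectively. Then $$\operatorname{div}\Pi_1^{r-1}v=\Pi_2^{r-2}\operatorname{div}v\quad\forall v\in[C^\infty(T)]^2,\qquad \operatorname{rot}\Pi_0^r p=\Pi_1^{r-1}\operatorname{rot}p\quad\forall p\in C^\infty(T).$$
   Context: Let $T\subset\mathbb R^2$ be a (closed, nondegenerate) triangle with vertices $z_1,z_2,z_3$, labelled counter-clockwise, and let $z_0$ be a point in the interior of $T$. Let $e_i=[z_{i+1},z_{i+2}]$ (indices $1,2,3$ modulo $3$) be the edge opposite $z_i$, with outward unit normal $n_i$ and unit tangent $t_i$, and let $z_{3+i}$ be a point in the relative interior of $e_i$, $i=1,2,3$. The Powell--Sabin split $T^{\rm ps}=\{T_1,\dots,T_6\}$ is the triangulation of $T$ obtained by connecting $z_0$ to each of $z_1,\dots,z_6$. $\mathcal E^b(T^{\rm ps})$ is the set of the six boundary edges of $T^{\rm ps}$ (each $e_i$ is divided in two by $z_{3+i}$). $\partial_t,\partial_n$ denote tangential and normal derivatives along the boundary edges of $T$ (with $t=t_i,n=n_i$ on $e_i$). For scalar $q$, $\operatorname{rot}q=(\partial q/\partial x_2,-\partial q/\partial x_1)^\top$. $\mathcal P_k(S)$ is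 the space of polynomials of degree $\le k$ on $S$, with $\mathcal P_k(S)=\{0\}$ for $k<0$, and $V_k^2(T^{\rm ps})=\mathcal P_k(T^{\rm ps})=\{q\in L^2(T): q|_S\in\mathcal P_k(S)\ \forall S\in T^{\rm ps}\}$. Further: - $L_k^0(T^{\rm ps})=\mathcal P_k(T^{\rm ps})\cap C(T)$, $L_k^1(T^{\rm ps})=[L_k^0(T^{\rm ps})]^2$; - $S_k^0(T^{\rm ps})=\{v\in L_k^0(T^{\rm ps}):\operatorname{rot}v\in[C(T)]^2\}$, $\mathring S_k^0(T^{\rm ps})=\{v\in S_k^0(T^{\rm ps}): v=0,\operatorname{rot}v=0\text{ on }\partial T\}$; - $\mathring{\mathcal V}_k^2(T^{\rm ps})=\{q\in V_k^2(T^{\rm ps}): q\text{ is continuous at }z_4,z_5,z_6,\ \int_Tq=0\}$. Jump: if $K_1,K_2\in T^{\rm ps}$ are the two triangles having $z_{3+i}$ as a vertex, with common edge $e$, and $m_j$ is the unit normal to $e$ pointing out of $K_j$, then $[\![p]\!](z_{3+i})=p|_{K_1}(z_{3+i})m_1+p|_{K_2}(z_{3+i})m_2$. (A) Degrees of freedom for $q\in S_r^0(T^{\rm ps})$ ($r\ge2$): $q(z_i),\nabla q(z_i)$, $1\le i\le3$; $q(z_{3+i}),\partial_tq(z_{3+i})$, $1\le i\le 3$, if $r\ge3$; $\int_e\partial_nq\,p$ for all $p\in\mathcal P_{r-3}(e)$, $e\in\mathcal E^b(T^{\rm ps})$; $\int_e q\,p$ for all $p\in\mathcal P_{r-4}(e)$,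 $e\in\mathcal E^b(T^{\rm ps})$; $\int_T\operatorname{rot}q\cdot\operatorname{rot}p$ for all $p\in\mathring S_r^0(T^{\rm ps})$. (B) Degrees of freedom for $v\in L_k^1(T^{\rm ps})$ ($k\ge1$; used with $k=r-1$): $v(z_i)$, $1\le i\le3$; $\int_{e_i}v\cdot n_i$, $1\le i\le3$, if $k=1$; $[\![\operatorname{div}v]\!](z_{3+i})$, $1\le i\le3$; $v(z_{3+i})\cdot n_i$, $1\le i\le3$, if $k\ge2$; $\int_ev\cdot w$ for all $w\in[\mathcal P_{k-2}(e)]^2$, $e\in\mathcal E^b(T^{\rm ps})$; $\int_Tv\cdot\operatorname{rot}w$ for all $w\in\mathring S_{k+1}^0(T^{\rm ps})$; $\int_T(\operatorname{div}v)\,w$ for all $w\in\mathring{\mathcal V}_{k-1}^2(T^{\rm ps})$. (C) Degrees of freedom for $q\in V_k^2(T^{\rm ps})$ ($k\ge0$; used with $k=r-2$): $[\![q]\!](z_{3+i})$, $1\le i\le3$; $\int_Tq$; $\int_Tq\,p$ for all $p\in\mathring{\mathcal V}_k^2(T^{\rm ps})$. Each of these families is unisolvent on the corresponding space. The projection $\Pi$ induced by a family of degrees of freedom maps a smooth function $f$ to the unique element $\Pi f$ of the discrete space with $\phi(\Pi f)=\phi(f)$ for every degree of freedom $\phi$ in the family. *)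

theory Defs
  imports "HOL-Analysis.Analysis"
begin

section \<open>Calculus on a closed region of the plane\<close>

text \<open>Derivatives are taken within the closed region \<open>D\<close>: at interior points they are the
  classical ones, at boundary points the one-sided ones, so that only the values on \<open>D\<close> matter.\<close>

definition pd :: "(real^2) set \<Rightarrow> (real^2 \<Rightarrow> real) \<Rightarrow> 2 \<Rightarrow> real^2 \<Rightarrow> real" where
  "pd D f j x = frechet_derivative f (at x within D) (axis j 1)"

definition grad :: "(real^2) set \<Rightarrow> (real^2 \<Rightarrow> real) \<Rightarrow> real^2 \<Rightarrow> real^2" where
  "grad D f x = (\<chi> j. pd D f j x)"

definition rot :: "(real^2) set \<Rightarrow> (real^2 \<Rightarrow> real) \<Rightarrow> real^2 \<Rightarrow> real^2" where
  "rot D f x = vector [pd D f 2 x, - pd D f 1 x]"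

definition divg :: "(real^2) set \<Rightarrow> (real^2 \<Rightarrow> real^2) \<Rightarrow> real^2 \<Rightarrow> real" where
  "divg D v x = (\<Sum>j\<in>UNIV. pd D (\<lambda>y. v y $ j) j x)"

fun C_on :: "nat \<Rightarrow> (real^2) set \<Rightarrow> (real^2 \<Rightarrow> real) \<Rightarrow> bool" where
  "C_on 0 U f = continuous_on U f"
| "C_on (Suc m) U f = (f differentiable_on U \<and> (\<forall>j. C_on m U (pd U f j)))"

text \<open>\<open>f\<close> is smooth on the closed set \<open>D\<close> if its restriction to \<open>D\<close> is the restriction of a
  function that is smooth on an open neighbourhood of \<open>D\<close>.\<close>

definition Cinf :: "(real^2) set \<Rightarrow> (real^2 \<Rightarrow> real) set" where
  "Cinf D = {f. \<exists>U g. open U \<and> D \<subseteq> U \<and> (\<forall>m. C_on m U g) \<and> (\<forall>x\<in>D. f x = g x)}"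

definition Cinf_vec :: "(real^2) set \<Rightarrow> (real^2 \<Rightarrow> real^2) set" where
  "Cinf_vec D = {v. \<forall>j. (\<lambda>x. v x $ j) \<in> Cinf D}"

text \<open>The integral along the segment from \<open>a\<close> to \<open>b\<close> with respect to arc length.\<close>

definition edge_integral :: "real^2 \<Rightarrow> real^2 \<Rightarrow> (real^2 \<Rightarrow> real) \<Rightarrow> real" where
  "edge_integral a b f = norm (b - a) * integral {0..1} (\<lambda>s. f (linepath a b s))"

text \<open>The unit normal to the line through \<open>a\<close> and \<open>b\<close> that points away from \<open>c\<close>.\<close>

definition outer_normal :: "real^2 \<Rightarrow> real^2 \<Rightarrow> real^2 \<Rightarrow> real^2" where
  "outer_normal a b c = (THE n. norm n = 1 \<and> n \<bullet> (b - a) = 0 \<and> n \<bullet> (c - a) < 0)"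

section \<open>The Powell--Sabin split\<close>

text \<open>The points \<open>z\<^sub>0, \<dots>, z\<^sub>6\<close> are \<open>z 0, \<dots>, z 6\<close>. For \<open>i \<in> {1,2,3}\<close>, \<open>nxt i\<close> and \<open>prv i\<close> are
  \<open>i + 1\<close> and \<open>i + 2\<close> modulo 3, so that \<open>z (nxt i)\<close>, \<open>z (prv i)\<close> are the ends of the
  edge \<open>e\<^sub>i\<close> opposite \<open>z i\<close>.\<close>

definition nxt :: "nat \<Rightarrow> nat" where "nxt i = i mod 3 + 1"

definition prv :: "nat \<Rightarrow> nat" where "prv i = (i + 1) mod 3 + 1"

definition tri :: "(nat \<Rightarrow> real^2) \<Rightarrow> (real^2) set" where
  "tri z = convex hull {z 1, z 2, z 3}"

text \<open>The determinant condition says that \<open>z 1, z 2, z 3\<close> are labelled counter-clockwise; in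
  particular they are affinely independent.\<close>

definition powell_sabin :: "(nat \<Rightarrow> real^2) \<Rightarrow> bool" where
  "powell_sabin z \<longleftrightarrow>
     (z 2 - z 1) $ 1 * (z 3 - z 1) $ 2 - (z 2 - z 1) $ 2 * (z 3 - z 1) $ 1 > 0 \<and>
     z 0 \<in> interior (tri z) \<and>
     (\<forall>i\<in>{1,2,3}. z (3 + i) \<in> open_segment (z (nxt i)) (z (prv i)))"

text \<open>The two subtriangles having \<open>z (3 + i)\<close> as a vertex.\<close>

definition subtri1 :: "(nat \<Rightarrow> real^2) \<Rightarrow> nat \<Rightarrow> (real^2) set" where
  "subtri1 z i = convex hull {z 0, z (nxt i), z (3 + i)}"

definition subtri2 :: "(nat \<Rightarrow> real^2) \<Rightarrow> nat \<Rightarrow> (real^2) set" where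
  "subtri2 z i = convex hull {z 0, z (3 + i), z (prv i)}"

definition ps_split :: "(nat \<Rightarrow> real^2) \<Rightarrow> (real^2) set set" where
  "ps_split z = subtri1 z ` {1,2,3} \<union> subtri2 z ` {1,2,3}"

text \<open>The ends of the two edges of the split into which \<open>e\<^sub>i\<close> is divided; for \<open>i = 1, 2, 3\<close> these
  are the six boundary edges.\<close>

definition half_edges :: "(nat \<Rightarrow> real^2) \<Rightarrow> nat \<Rightarrow> ((real^2) \<times> (real^2)) set" where
  "half_edges z i = {(z (nxt i), z (3 + i)), (z (3 + i), z (prv i))}"

definition nrm :: "(nat \<Rightarrow> real^2) \<Rightarrow> nat \<Rightarrow> real^2" where
  "nrm z i = outer_normal (z (nxt i)) (z (prv i)) (z i)"

definition tng :: "(nat \<Rightarrow> real^2) \<Rightarrow> nat \<Rightarrow> real^2" where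
  "tng z i = sgn (z (prv i) - z (nxt i))"

text \<open>The value at \<open>x\<close> of \<open>q\<close> restricted to the triangle \<open>K\<close>, where \<open>q\<close> matters only in the interior of \<open>K\<close>.\<close>

definition trace_on :: "(real^2) set \<Rightarrow> (real^2 \<Rightarrow> real) \<Rightarrow> real^2 \<Rightarrow> real" where
  "trace_on K q x = Lim (at x within interior K) q"

definition jump :: "(nat \<Rightarrow> real^2) \<Rightarrow> (real^2 \<Rightarrow> real) \<Rightarrow> nat \<Rightarrow> real^2" where
  "jump z q i =
     trace_on (subtri1 z i) q (z (3 + i)) *\<^sub>R outer_normal (z 0) (z (3 + i)) (z (nxt i)) +
     trace_on (subtri2 z i) q (z (3 + i)) *\<^sub>R outer_normal (z 0) (z (3 + i)) (z (prv i))"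

section \<open>The discrete spaces\<close>

text \<open>Polynomial degrees are integers; for \<open>k < 0\<close> the sum is empty and only the zero polynomial
  is left. The space of polynomials on a triangle or an edge consists of the restrictions of
  these functions.\<close>

definition polys :: "int \<Rightarrow> (real^2 \<Rightarrow> real) set" where
  "polys k = {p. \<exists>c :: nat \<Rightarrow> nat \<Rightarrow> real. \<forall>x.
      p x = (\<Sum>(a,b)\<in>{(a,b). int (a + b) \<le> k}. c a b * (x $ 1) ^ a * (x $ 2) ^ b)}"

definition polys_vec :: "int \<Rightarrow> (real^2 \<Rightarrow> real^2) set" where
  "polys_vec k = {w. \<forall>j. (\<lambda>x. w x $ j) \<in> polys k}"

text \<open>A member of \<open>V2\<close> stands for its class in \<open>L\<^sup>2\<close>: it is a polynomial on the interior of each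
  subtriangle, and its values on the edges of the split (a null set) are irrelevant.\<close>

definition V2 :: "(nat \<Rightarrow> real^2) \<Rightarrow> int \<Rightarrow> (real^2 \<Rightarrow> real) set" where
  "V2 z k = {q. \<forall>K\<in>ps_split z. \<exists>p\<in>polys k. \<forall>x\<in>interior K. q x = p x}"

definition L0 :: "(nat \<Rightarrow> real^2) \<Rightarrow> int \<Rightarrow> (real^2 \<Rightarrow> real) set" where
  "L0 z k = {q \<in> V2 z k. continuous_on (tri z) q}"

definition L1 :: "(nat \<Rightarrow> real^2) \<Rightarrow> int \<Rightarrow> (real^2 \<Rightarrow> real^2) set" where
  "L1 z k = {v. \<forall>j. (\<lambda>x. v x $ j) \<in> L0 z k}"

text \<open>For \<open>q \<in> L0\<close> the weak \<open>rot\<close> is the piecewise one, which exists almost everywhere.\<close>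

definition S0 :: "(nat \<Rightarrow> real^2) \<Rightarrow> int \<Rightarrow> (real^2 \<Rightarrow> real) set" where
  "S0 z k = {q \<in> L0 z k. \<exists>g. continuous_on (tri z) g \<and>
      (AE x in lebesgue_on (tri z). rot (tri z) q x = g x)}"

definition S0_bdry :: "(nat \<Rightarrow> real^2) \<Rightarrow> int \<Rightarrow> (real^2 \<Rightarrow> real) set" where
  "S0_bdry z k = {q \<in> S0 z k. \<forall>x\<in>frontier (tri z). q x = 0 \<and> rot (tri z) q x = 0}"

text \<open>As the values of \<open>q \<in> V2\<close> on the edges of the split are irrelevant, continuity at a vertex
  means having a limit there from the union of the open subtriangles.\<close>

definition V2_ring :: "(nat \<Rightarrow> real^2) \<Rightarrow> int \<Rightarrow> (real^2 \<Rightarrow> real) set" where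
  "V2_ring z k = {q \<in> V2 z k.
      (\<forall>i\<in>{1,2,3}. \<exists>l. (q \<longlongrightarrow> l) (at (z (3 + i)) within (\<Union>K\<in>ps_split z. interior K))) \<and>
      integral (tri z) q = 0}"

section \<open>Degrees of freedom and induced projections\<close>

text \<open>Vector-valued degrees of freedom are listed componentwise.\<close>

definition dofs_S :: "(nat \<Rightarrow> real^2) \<Rightarrow> int \<Rightarrow> ((real^2 \<Rightarrow> real) \<Rightarrow> real) set" where
  "dofs_S z r =
     {\<lambda>q. q (z i) | i. i \<in> {1,2,3}} \<union>
     {\<lambda>q. grad (tri z) q (z i) $ j | i j. i \<in> {1,2,3}} \<union>
     (if r \<ge> 3 then
       {\<lambda>q. q (z (3 + i)) | i. i \<in> {1,2,3}} \<union>
       {\<lambda>q. grad (tri z) q (z (3 + i)) \<bullet> tng z i | i. i \<in> {1,2,3}}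
      else {}) \<union>
     {\<lambda>q. edge_integral a b (\<lambda>x. (grad (tri z) q x \<bullet> nrm z i) * p x) | i a b p.
        i \<in> {1,2,3} \<and> (a,b) \<in> half_edges z i \<and> p \<in> polys (r - 3)} \<union>
     {\<lambda>q. edge_integral a b (\<lambda>x. q x * p x) | i a b p.
        i \<in> {1,2,3} \<and> (a,b) \<in> half_edges z i \<and> p \<in> polys (r - 4)} \<union>
     {\<lambda>q. integral (tri z) (\<lambda>x. rot (tri z) q x \<bullet> rot (tri z) p x) | p. p \<in> S0_bdry z r}"

definition dofs_L :: "(nat \<Rightarrow> real^2) \<Rightarrow> int \<Rightarrow> ((real^2 \<Rightarrow> real^2) \<Rightarrow> real) set" where
  "dofs_L z k =
     {\<lambda>v. v (z i) $ j | i j. i \<in> {1,2,3}} \<union>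
     (if k = 1 then
       {\<lambda>v. edge_integral (z (nxt i)) (z (prv i)) (\<lambda>x. v x \<bullet> nrm z i) | i. i \<in> {1,2,3}}
      else {}) \<union>
     {\<lambda>v. jump z (divg (tri z) v) i $ j | i j. i \<in> {1,2,3}} \<union>
     (if k \<ge> 2 then {\<lambda>v. v (z (3 + i)) \<bullet> nrm z i | i. i \<in> {1,2,3}} else {}) \<union>
     {\<lambda>v. edge_integral a b (\<lambda>x. v x \<bullet> w x) | i a b w.
        i \<in> {1,2,3} \<and> (a,b) \<in> half_edges z i \<and> w \<in> polys_vec (k - 2)} \<union>
     {\<lambda>v. integral (tri z) (\<lambda>x. v x \<bullet> rot (tri z) w x) | w. w \<in> S0_bdry z (k + 1)} \<union>
     {\<lambda>v. integral (tri z) (\<lambda>x. divg (tri z) v x * w x) | w. w \<in> V2_ring z (k - 1)}"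

definition dofs_V :: "(nat \<Rightarrow> real^2) \<Rightarrow> int \<Rightarrow> ((real^2 \<Rightarrow> real) \<Rightarrow> real) set" where
  "dofs_V z k =
     {\<lambda>q. jump z q i $ j | i j. i \<in> {1,2,3}} \<union>
     {\<lambda>q. integral (tri z) q} \<union>
     {\<lambda>q. integral (tri z) (\<lambda>x. q x * p x) | p. p \<in> V2_ring z k}"

text \<open>\<open>P\<close> maps each \<open>f \<in> F\<close> to an element of \<open>X\<close> with the same degrees of freedom \<open>\<Phi>\<close>. Unisolvence
  of \<open>\<Phi>\<close> on \<open>X\<close> makes this element exist and be unique (as a function on the triangle, or as a
  class in \<open>L\<^sup>2\<close>); uniqueness is deliberately not made part of the definition, so that it
  is never a hypothesis.\<close>

definition induced_projection ::
    "('f \<Rightarrow> real) set \<Rightarrow> 'f set \<Rightarrow> 'f set \<Rightarrow> ('f \<Rightarrow> 'f) \<Rightarrow> bool" where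
  "induced_projection \<Phi> F X P \<longleftrightarrow> (\<forall>f\<in>F. P f \<in> X \<and> (\<forall>\<phi>\<in>\<Phi>. \<phi> (P f) = \<phi> f))"

end

theory Submission
  imports Defs
begin

text \<open>For an element of the target space all of whose degrees of freedom vanish we show that it is
  zero; both identities then follow by comparing degrees of freedom, using integration by parts on
  \<open>T\<close> and along the edges.

  For (C), an element with vanishing jumps and mean is itself an admissible test function.

  For (B), take \<open>e\<close> in \<open>L1 z k\<close> with vanishing degrees of freedom. On half an edge each component
  \<open>p\<close> of \<open>e\<close> is orthogonal to \<open>p''\<close>, so \<open>\<integral> (p')\<^sup>2\<close> equals the boundary term \<open>[p p']\<close>. The normal component
  vanishes at the ends of both halves, hence identically. The jump condition on the divergence then
  makes the tangential derivative of \<open>e\<close> continuous at \<open>z (3 + i)\<close>, so for the tangential component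
  the two boundary terms are opposite; both being non-negative, they are zero. Thus \<open>e = 0\<close> on the
  boundary, \<open>divg e\<close> is a test function of mean zero and hence \<open>0\<close>, and \<open>e\<close> is the \<open>rot\<close> of a stream
  function in \<open>S0_bdry z (k + 1)\<close>, to which \<open>e\<close> is orthogonal.\<close>

section \<open>Calculus on triangles\<close>

text \<open>As \<open>induced_projection\<close> already supplies an element with the right degrees
  of freedom, only the injectivity half of unisolvence has to be shown.

  The obstacle is that \<open>pd\<close> carries no information at interface points where a
  piecewise polynomial is not differentiable, and that \<open>jump\<close> and
  \<open>integral\<close> are additive only where limits and integrals exist. Computations are
  therefore done with polynomials on closed triangles and transferred through the open ones, so the
  divergence identity holds almost everywhere. For \<open>rot\<close>, the continuous representative
  in \<open>S0\<close> forces the gradients of neighbouring polynomials to agree on common edges;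
  the identity then holds at every point of \<open>T\<close>.

  Two facts drive the comparison. The total divergence is determined by the normal fluxes over the
  six boundary edges. On an edge, the normal component of \<open>rot q\<close> is the tangential
  derivative of \<open>q\<close>, and its tangential component is minus the normal derivative;
  integrating the former by parts lowers the degree of the weight from \<open>r - 3\<close> to
  \<open>r - 4\<close>, the two degrees that occur in (A).\<close>

lemma has_derivative_within_convex_unique:
  fixes f :: "'a::real_normed_vector \<Rightarrow> 'b::real_normed_vector"
  assumes S: "convex S" "interior S \<noteq> {}" "x \<in> S"
    and f: "(f has_derivative D1) (at x within S)" "(f has_derivative D2) (at x within S)"
  shows "D1 = D2"
proof -
  define D where "D = (\<lambda>h. D1 h - D2 h)"
  have D: "((\<lambda>_. 0) has_derivative D) (at x within S)"
    using has_derivative_diff[OF f] by (simp add: D_def)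
  interpret D: bounded_linear D using D by (rule has_derivative_bounded_linear)
  \<comment> \<open>Along the segment from \<open>x\<close> to \<open>y\<close> the zero function
    has the one-sided derivative \<open>D (y - x)\<close> at \<open>0\<close>, and one-sided
    derivatives in one variable are unique.\<close>
  have *: "D (y - x) = 0" if "y \<in> S" for y
  proof -
    define l where "l = (\<lambda>t::real. x + t *\<^sub>R (y - x))"
    have l: "l ` {0..1} \<subseteq> S"
    proof
      fix w assume "w \<in> l ` {0..1}"
      then obtain t where "t \<in> {0..1}" "w = (1 - t) *\<^sub>R x + t *\<^sub>R y"
        by (auto simp: l_def algebra_simps)
      then show "w \<in> S" using S(1,3) that by (simp add: convex_alt)
    qed
    have dl: "(l has_derivative (\<lambda>t. t *\<^sub>R (y - x))) (at 0 within {0..1})"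
      unfolding l_def by (auto intro!: derivative_eq_intros)
    have "((\<lambda>_. 0) has_derivative D) (at (l 0) within l ` {0..1})"
      using has_derivative_subset[OF D l] by (simp add: l_def)
    from has_derivative_in_compose[OF dl this]
    have "((\<lambda>_. 0) has_vector_derivative D (y - x)) (at 0 within {0..1})"
      by (simp add: has_vector_derivative_def D.scaleR)
    moreover have "((\<lambda>_. 0::'b) has_vector_derivative 0) (at (0::real) within {0..1})"
      by (rule has_vector_derivative_const)
    ultimately show ?thesis
      using vector_derivative_unique_within_closed_interval[of 0 1 0 "\<lambda>_. 0" "D (y - x)" 0] by simp
  qed
  obtain y e where e: "e > 0" "ball y e \<subseteq> S"
    using S(2) by (meson equals0I mem_interior)
  \<comment> \<open>The interior point \<open>y\<close> leaves room in every direction, so each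
    \<open>h\<close> is a multiple of a difference of two vectors on which \<open>D\<close>
    vanishes.\<close>
  have "D h = 0" for h
  proof (cases "h = 0")
    case False
    define c where "c = e / 2 / norm h"
    have c: "c \<noteq> 0" "y + c *\<^sub>R h \<in> ball y e" using False e by (auto simp: c_def dist_norm)
    have "y \<in> S" "y + c *\<^sub>R h \<in> S" using e c by auto
    then have "D (y + c *\<^sub>R h - x) - D (y - x) = 0" using * by simp
    moreover have "y + c *\<^sub>R h - x = (y - x) + c *\<^sub>R h" by simp
    ultimately show ?thesis using c by (metis D.add D.scaleR add_diff_cancel_left' scaleR_eq_0_iff)
  qed simp
  then show ?thesis by (auto simp: D_def)
qed

section \<open>Fubini on the reference triangle\<close>

lemma vector2_axis: "(vector [a, b] :: real^2) = a *\<^sub>R axis 1 1 + b *\<^sub>R axis 2 1"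
  by (simp add: vec_eq_iff forall_2 axis_def)

lemma continuous_on_vector2 [continuous_intros]:
  fixes f g :: "'a::topological_space \<Rightarrow> real"
  assumes "continuous_on S f" "continuous_on S g"
  shows "continuous_on S (\<lambda>x. vector [f x, g x] :: real^2)"
  unfolding vector2_axis using assms by (intro continuous_intros)

text \<open>Makes Fubini on pairs of reals available for \<open>real^2\<close>. Lebesgue measure is
  determined by its values on boxes, and pairing the coordinates preserves boxes and their
  areas.\<close>

lemma lborel_vec2: "distr lborel lborel (\<lambda>(s, t). vector [s, t] :: real^2) = lborel"
proof (rule sym, rule lborel_eqI)
  fix l u :: "real^2"
  assume "\<And>b. b \<in> Basis \<Longrightarrow> l \<bullet> b \<le> u \<bullet> b"
  then have lu: "l $ 1 \<le> u $ 1" "l $ 2 \<le> u $ 2"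
    by (simp_all add: cart_eq_inner_axis)
  have m: "(\<lambda>(s, t). vector [s, t] :: real^2) \<in> borel_measurable borel"
  proof (rule borel_measurable_continuous_onI)
    show "continuous_on UNIV (\<lambda>(s, t). vector [s, t] :: real^2)"
      by (simp add: case_prod_unfold) (intro continuous_intros)
  qed
  have "(\<lambda>(s, t). vector [s, t] :: real^2) -` box l u = box (l $ 1, l $ 2) (u $ 1, u $ 2)"
    by (auto simp: mem_box Basis_vec_def inner_axis Basis_prod_def forall_2)
  moreover have "emeasure lborel (box (l $ 1, l $ 2) (u $ 1, u $ 2)) = ennreal ((u$1 - l$1) * (u$2 - l$2))"
  proof (subst emeasure_lborel_box)
    show "\<And>b. b \<in> Basis \<Longrightarrow> (l $ 1, l $ 2) \<bullet> b \<le> (u $ 1, u $ 2) \<bullet> b"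
      using lu by (auto simp: Basis_prod_def)
    have "(\<Prod>b\<in>(Basis::(real\<times>real) set). ((u $ 1, u $ 2) - (l $ 1, l $ 2)) \<bullet> b) = (u$1 - l$1) * (u$2 - l$2)"
      by (simp add: Basis_prod_def)
    then show "ennreal (\<Prod>b\<in>Basis. ((u $ 1, u $ 2) - (l $ 1, l $ 2)) \<bullet> b) = ennreal ((u$1 - l$1) * (u$2 - l$2))"
      by simp
  qed
  moreover have "(\<Prod>b\<in>(Basis::(real^2) set). (u - l) \<bullet> b) = (u$1 - l$1) * (u$2 - l$2)"
  proof -
    have B: "(Basis :: (real^2) set) = {axis 1 1, axis 2 1}"
      by (auto simp: Basis_vec_def UNIV_2)
    show ?thesis unfolding B by (subst prod.insert) (auto simp: inner_axis axis_eq_axis)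
  qed
  ultimately show "emeasure (distr lborel lborel (\<lambda>(s, t). vector [s, t] :: real^2)) (box l u)
      = ennreal (\<Prod>b\<in>Basis. (u - l) \<bullet> b)"
    using m by (subst emeasure_distr) auto
qed simp

definition ref_tri :: "(real^2) set" where
  "ref_tri = {y. 0 \<le> y $ 1 \<and> 0 \<le> y $ 2 \<and> y $ 1 + y $ 2 \<le> 1}"

lemma compact_ref_tri: "compact ref_tri"
proof -
  have "closed ref_tri" unfolding ref_tri_def
    by (intro closed_Collect_conj closed_Collect_le continuous_intros)
  moreover have "ref_tri \<subseteq> cbox 0 1"
    by (auto simp: ref_tri_def mem_box Basis_vec_def inner_axis forall_2)
  ultimately show ?thesis
    using bounded_subset[OF bounded_cbox] compact_eq_bounded_closed by blast
qed

text \<open>Fubini for the extension of \<open>g\<close> by zero. The first coordinate is innermost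
  because the affine maps below send it to the direction \<open>b - a\<close> along which a
  derivative is integrated.\<close>

lemma integral_ref_tri:
  fixes g :: "real^2 \<Rightarrow> real"
  assumes g: "continuous_on ref_tri g"
  shows "integral ref_tri g = integral {0..1} (\<lambda>t. integral {0..1 - t} (\<lambda>s. g (vector [s, t])))"
proof -
  let ?p = "\<lambda>(s, t). vector [s, t] :: real^2"
  let ?G = "\<lambda>x. indicator ref_tri x *\<^sub>R g x"
  have int: "integrable lborel ?G"
    using borel_integrable_compact[OF compact_ref_tri g] .
  have pm: "?p \<in> lborel \<rightarrow>\<^sub>M lborel"
  proof -
    have "continuous_on UNIV ?p"
      by (simp add: case_prod_unfold) (intro continuous_intros)
    then show ?thesis using borel_measurable_continuous_onI by simp
  qed
  have "integral ref_tri g = integral\<^sup>L lborel ?G"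
    using set_borel_integral_eq_integral(2)[of ref_tri g] int
    by (simp add: set_integrable_def set_lebesgue_integral_def)
  also have "\<dots> = integral\<^sup>L (distr lborel lborel ?p) ?G"
    by (simp add: lborel_vec2)
  also have "\<dots> = integral\<^sup>L lborel (\<lambda>x. ?G (?p x))"
    using int by (subst integral_distr[OF pm]) (auto dest: borel_measurable_integrable)
  finally have 1: "integral ref_tri g = integral\<^sup>L (lborel \<Otimes>\<^sub>M lborel) (\<lambda>(s, t). ?G (?p (s, t)))"
    by (simp add: lborel_prod case_prod_unfold)
  have int2: "integrable (lborel \<Otimes>\<^sub>M lborel) (\<lambda>(s, t). ?G (?p (s, t)))"
  proof -
    have "integrable (distr lborel lborel ?p) ?G" using int by (simp add: lborel_vec2)
    then show ?thesis
      using int by (subst (asm) integrable_distr_eq[OF pm])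
        (auto simp: lborel_prod case_prod_unfold dest: borel_measurable_integrable)
  qed
  have in1: "(\<integral>s. ?G (?p (s, t)) \<partial>lborel) = indicator {0..1} t *\<^sub>R integral {0..1 - t} (\<lambda>s. g (vector [s, t]))" for t
  proof (cases "t \<in> {0..1}")
    case True
    have "continuous_on {0..1-t} (\<lambda>s. vector [s, t] :: real^2)"
      by (intro continuous_intros)
    then have c: "continuous_on {0..1-t} (\<lambda>s. g (vector [s, t]))"
      by (rule continuous_on_compose2[OF g]) (use True in \<open>auto simp: ref_tri_def\<close>)
    have "set_integrable lborel {0..1-t} (\<lambda>s. g (vector [s, t]))"
      unfolding set_integrable_def by (rule borel_integrable_compact[OF compact_Icc c])
    from set_borel_integral_eq_integral(2)[OF this]
    have "integral {0..1-t} (\<lambda>s. g (vector [s, t])) = (\<integral>s. indicator {0..1-t} s *\<^sub>R g (vector [s, t]) \<partial>lborel)"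
      by (simp add: set_lebesgue_integral_def)
    moreover have *: "indicator {0..1-t} s *\<^sub>R g (vector [s, t]) = ?G (?p (s, t))" for s
      using True by (auto simp: ref_tri_def indicator_def)
    ultimately have "integral {0..1-t} (\<lambda>s. g (vector [s, t])) = (\<integral>s. ?G (?p (s, t)) \<partial>lborel)"
      by (simp only: *)
    then show ?thesis using True by simp
  next
    case False
    then have "?G (?p (s, t)) = 0" for s by (auto simp: ref_tri_def indicator_def)
    then have "(\<lambda>s. ?G (?p (s, t))) = (\<lambda>s. 0)" by blast
    then show ?thesis using False by (simp del: scaleR_conv_of_real real_scaleR_def)
  qed
  have "integral ref_tri g = (\<integral>t. (\<integral>s. ?G (?p (s, t)) \<partial>lborel) \<partial>lborel)"
    unfolding 1 using lborel_pair.integral_snd[OF int2] by simp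
  also have "\<dots> = (\<integral>t. indicator {0..1} t *\<^sub>R integral {0..1 - t} (\<lambda>s. g (vector [s, t])) \<partial>lborel)"
    by (simp only: in1)
  also have "\<dots> = integral {0..1} (\<lambda>t. integral {0..1 - t} (\<lambda>s. g (vector [s, t])))"
  proof -
    have "integrable lborel (\<lambda>t. \<integral>s. ?G (?p (s, t)) \<partial>lborel)"
      using lborel_pair.integrable_snd[OF int2] by simp
    then have "set_integrable lborel {0..1} (\<lambda>t. integral {0..1 - t} (\<lambda>s. g (vector [s, t])))"
      unfolding set_integrable_def by (simp only: in1)
    from set_borel_integral_eq_integral(2)[OF this] show ?thesis
      by (simp add: set_lebesgue_integral_def)
  qed
  finally show ?thesis .
qed

section \<open>Continuously differentiable functions within a set\<close>

lemma absolutely_integrable_continuous_compact: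
  fixes f :: "'a::euclidean_space \<Rightarrow> 'b::euclidean_space"
  assumes "compact S" "continuous_on S f"
  shows "f absolutely_integrable_on S"
  using borel_integrable_compact[OF assms] borel_measurable_integrable
  unfolding set_integrable_def by (subst integrable_completion) auto

lemmas integrable_continuous_compact =
  set_lebesgue_integral_eq_integral(1)[OF absolutely_integrable_continuous_compact]

text \<open>The gradient is an explicit argument so that the gradient of a polynomial piece can be
  named and used on edges. Derivatives are taken within \<open>K\<close>, so that closed triangles
  and open sets are treated alike.\<close>

definition C1_on :: "'a::real_inner set \<Rightarrow> ('a \<Rightarrow> real) \<Rightarrow> ('a \<Rightarrow> 'a) \<Rightarrow> bool" where
  "C1_on K f G \<longleftrightarrow> continuous_on K G \<and> (\<forall>x\<in>K. (f has_derivative (\<lambda>h. G x \<bullet> h)) (at x within K))"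

lemma C1_on_continuous: "C1_on K f G \<Longrightarrow> continuous_on K f"
  unfolding C1_on_def by (meson has_derivative_continuous_on)

lemma C1_on_subset: "C1_on K f G \<Longrightarrow> L \<subseteq> K \<Longrightarrow> C1_on L f G"
  unfolding C1_on_def by (meson continuous_on_subset has_derivative_subset subsetD)

lemma C1_on_cong: "C1_on K f G \<Longrightarrow> (\<And>x. x \<in> K \<Longrightarrow> f x = g x) \<Longrightarrow> C1_on K g G"
  unfolding C1_on_def by (metis has_derivative_transform)

lemma C1_on_linepath:
  assumes "C1_on K f G" "closed_segment a b \<subseteq> K"
  shows "continuous_on {0..1} (\<lambda>s. f (linepath a b s))"
    and "continuous_on {0..1} (\<lambda>s. G (linepath a b s))"
    and "s \<in> {0..1} \<Longrightarrow>
      ((\<lambda>s. f (linepath a b s)) has_vector_derivative G (linepath a b s) \<bullet> (b - a)) (at s within {0..1})"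
proof -
  have l: "linepath a b ` {0..1} \<subseteq> K" using assms(2) by (auto simp: linepath_in_path)
  show "continuous_on {0..1} (\<lambda>s. f (linepath a b s))"
    by (rule continuous_on_compose2[OF C1_on_continuous[OF assms(1)] _ l]) (rule continuous_on_linepath)
  show "continuous_on {0..1} (\<lambda>s. G (linepath a b s))"
    using assms(1) by (intro continuous_on_compose2[OF _ continuous_on_linepath l]) (simp add: C1_on_def)
  assume s: "s \<in> {0..1}"
  have "(f has_derivative (\<lambda>h. G (linepath a b s) \<bullet> h)) (at (linepath a b s) within linepath a b ` {0..1})"
    using assms(1) l s by (intro has_derivative_subset[OF _ l]) (simp add: C1_on_def image_subset_iff)
  moreover have "(linepath a b has_derivative (\<lambda>t. t *\<^sub>R (b - a))) (at s within {0..1})"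
    using has_vector_derivative_linepath_within by (auto simp: has_vector_derivative_def)
  ultimately show "((\<lambda>s. f (linepath a b s)) has_vector_derivative G (linepath a b s) \<bullet> (b - a)) (at s within {0..1})"
    by (auto dest: has_derivative_in_compose simp: has_vector_derivative_def)
qed

text \<open>The fundamental theorem of calculus in the parameter of the segment. Path independence,
  constancy along edges and integration by parts on edges all rest on it.\<close>

lemma integral_linepath_C1:
  assumes "C1_on K f G" "closed_segment a b \<subseteq> K"
  shows "((\<lambda>s. G (linepath a b s) \<bullet> (b - a)) has_integral f b - f a) {0..1}"
  using fundamental_theorem_of_calculus[of 0 1, OF _ C1_on_linepath(3)[OF assms]]
  by (simp add: linepath_0' linepath_1')

section \<open>Integrals over a triangle and the divergence theorem\<close>

definition cross2 :: "real^2 \<Rightarrow> real^2 \<Rightarrow> real" where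
  "cross2 x y = x $ 1 * y $ 2 - x $ 2 * y $ 1"

lemma convex_hull_3_ref_tri:
  fixes a b c :: "real^2"
  shows "convex hull {a, b, c} = (\<lambda>y. a + y $ 1 *\<^sub>R (b - a) + y $ 2 *\<^sub>R (c - a)) ` ref_tri"
proof (intro equalityI subsetI)
  fix x assume "x \<in> convex hull {a, b, c}"
  then obtain u v where "x = a + u *\<^sub>R (b - a) + v *\<^sub>R (c - a)" "0 \<le> u" "0 \<le> v" "u + v \<le> 1"
    by (auto simp: convex_hull_3_alt)
  then show "x \<in> (\<lambda>y. a + y $ 1 *\<^sub>R (b - a) + y $ 2 *\<^sub>R (c - a)) ` ref_tri"
    by (intro image_eqI[of _ _ "vector [u, v]"]) (auto simp: ref_tri_def)
qed (auto simp: convex_hull_3_alt ref_tri_def)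

lemma integral_triangle_affine:
  fixes f :: "real^2 \<Rightarrow> real"
  assumes D: "cross2 (b - a) (c - a) \<noteq> 0" and f: "continuous_on (convex hull {a, b, c}) f"
  shows "integral (convex hull {a, b, c}) f =
    \<bar>cross2 (b - a) (c - a)\<bar> * integral ref_tri (\<lambda>y. f (a + y $ 1 *\<^sub>R (b - a) + y $ 2 *\<^sub>R (c - a)))"
proof -
  let ?g = "\<lambda>y::real^2. a + y $ 1 *\<^sub>R (b - a) + y $ 2 *\<^sub>R (c - a)"
  let ?g' = "\<lambda>y::real^2. y $ 1 *\<^sub>R (b - a) + y $ 2 *\<^sub>R (c - a)"
  \<comment> \<open>The change of variables formula is stated for functions into
    \<open>real^n\<close>, so \<open>f\<close> is given values in \<open>real^1\<close> and read
    back componentwise.\<close>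
  let ?f = "\<lambda>x. vec (f x) :: real^1"
  have vc: "continuous_on S h \<Longrightarrow> continuous_on S (\<lambda>x. vec (h x) :: real^1)" for S and h :: "real^2 \<Rightarrow> real"
    by (simp add: vec_def continuous_on_vec_lambda)
  have cf: "continuous_on ref_tri (\<lambda>y. f (?g y))"
    by (rule continuous_on_compose2[OF f]) (auto intro!: continuous_intros simp: convex_hull_3_ref_tri)
  have det: "det (matrix ?g') = cross2 (b - a) (c - a)"
    by (simp add: det_2 matrix_def cross2_def axis_def algebra_simps)
  have inj: "inj_on ?g ref_tri"
  proof (rule inj_onI)
    fix x y assume "?g x = ?g y"
    then have e: "(x$1 - y$1) *\<^sub>R (b - a) + (x$2 - y$2) *\<^sub>R (c - a) = 0" by (simp add: algebra_simps)
    \<comment> \<open>Crossing a combination of the two edge vectors with one of them isolates the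
      coefficient of the other.\<close>
    have "(x$1 - y$1) * cross2 (b - a) (c - a) = cross2 ((x$1 - y$1) *\<^sub>R (b - a) + (x$2 - y$2) *\<^sub>R (c - a)) (c - a)"
      by (simp add: cross2_def algebra_simps)
    moreover have "(x$2 - y$2) * cross2 (b - a) (c - a) = cross2 (b - a) ((x$1 - y$1) *\<^sub>R (b - a) + (x$2 - y$2) *\<^sub>R (c - a))"
      by (simp add: cross2_def algebra_simps)
    ultimately show "x = y" using D unfolding e by (simp add: cross2_def vec_eq_iff forall_2)
  qed
  have der: "(?g has_derivative ?g') (at x within ref_tri)" for x
    by (auto intro!: derivative_eq_intros bounded_linear_imp_has_derivative[OF bounded_linear_vec_nth])
  have "?f absolutely_integrable_on (?g ` ref_tri) \<and> integral (?g ` ref_tri) ?f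
      = integral ref_tri (\<lambda>x. \<bar>det (matrix ?g')\<bar> *\<^sub>R ?f (?g x))"
  proof (subst has_absolute_integral_change_of_variables[OF _ der inj, symmetric])
    show "ref_tri \<in> sets lebesgue"
      using compact_ref_tri by (simp add: lmeasurable_compact fmeasurableD)
    have "continuous_on ref_tri (\<lambda>x. \<bar>det (matrix ?g')\<bar> *\<^sub>R ?f (?g x))"
      by (rule continuous_on_scaleR[OF continuous_on_const vc[OF cf]])
    then show "(\<lambda>x. \<bar>det (matrix ?g')\<bar> *\<^sub>R ?f (?g x)) absolutely_integrable_on ref_tri \<and>
      integral ref_tri (\<lambda>x. \<bar>det (matrix ?g')\<bar> *\<^sub>R ?f (?g x)) =
      integral ref_tri (\<lambda>x. \<bar>det (matrix ?g')\<bar> *\<^sub>R ?f (?g x))"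
      using absolutely_integrable_continuous_compact[OF compact_ref_tri] by blast
  qed
  then have i: "integral (convex hull {a, b, c}) ?f
      = \<bar>cross2 (b - a) (c - a)\<bar> *\<^sub>R integral ref_tri (\<lambda>x. ?f (?g x))"
    by (simp add: det convex_hull_3_ref_tri)
  have "compact (convex hull {a, b, c})" by (simp add: finite_imp_compact_convex_hull)
  then have "?f integrable_on (convex hull {a, b, c})"
    by (intro integrable_continuous_compact vc f)
  then have "integral (convex hull {a, b, c}) ?f $ 1 = integral (convex hull {a, b, c}) f"
    by (simp add: integral_component_eq_cart[symmetric])
  moreover have "integral ref_tri (\<lambda>x. ?f (?g x)) $ 1 = integral ref_tri (\<lambda>x. f (?g x))"
    using integrable_continuous_compact[OF compact_ref_tri vc[OF cf]]
    by (simp add: integral_component_eq_cart[symmetric])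
  moreover have "integral (convex hull {a, b, c}) ?f $ 1
      = \<bar>cross2 (b - a) (c - a)\<bar> * integral ref_tri (\<lambda>x. ?f (?g x)) $ 1"
    unfolding i by simp
  ultimately show ?thesis by simp
qed


text \<open>On each segment parallel to \<open>b - a\<close> the derivative integrates to the
  difference of \<open>f\<close> at its ends, which lie on the edges from \<open>b\<close> to
  \<open>c\<close> and from \<open>a\<close> to \<open>c\<close>. Fubini collects these differences;
  the determinant comes from the affine map.\<close>

lemma integral_triangle_deriv_edge:
  fixes a b c :: "real^2"
  assumes D: "cross2 (b - a) (c - a) \<noteq> 0" and C: "C1_on (convex hull {a, b, c}) f G"
  shows "integral (convex hull {a, b, c}) (\<lambda>x. G x \<bullet> (b - a)) = \<bar>cross2 (b - a) (c - a)\<bar> *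
    (integral {0..1} (\<lambda>s. f (linepath b c s)) - integral {0..1} (\<lambda>s. f (linepath a c s)))"
proof -
  let ?K = "convex hull {a, b, c}"
  let ?g = "\<lambda>y::real^2. a + y $ 1 *\<^sub>R (b - a) + y $ 2 *\<^sub>R (c - a)"
  have cG: "continuous_on ?K (\<lambda>x. G x \<bullet> (b - a))"
    using C by (auto simp: C1_on_def intro!: continuous_intros)
  have cg: "continuous_on ref_tri (\<lambda>y. G (?g y) \<bullet> (b - a))"
    by (rule continuous_on_compose2[OF cG]) (auto intro!: continuous_intros simp: convex_hull_3_ref_tri)
  have seg: "closed_segment u w \<subseteq> ?K" if "u \<in> ?K" "w \<in> ?K" for u w
    using that by (meson closed_segment_subset convex_convex_hull)
  have v: "a \<in> ?K" "b \<in> ?K" "c \<in> ?K" by (auto intro: hull_inc)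
  have inner: "integral {0..1 - t} (\<lambda>s. G (?g (vector [s, t])) \<bullet> (b - a))
      = f (linepath b c t) - f (linepath a c t)" if t: "t \<in> {0..1}" for t
  proof -
    let ?h = "\<lambda>s. f (?g (vector [s, t]))"
    have sub: "(\<lambda>s. ?g (vector [s, t])) ` {0..1 - t} \<subseteq> ?K"
    proof (intro image_subsetI)
      fix s assume "s \<in> {0..1 - t}"
      then have "vector [s, t] \<in> ref_tri" using t by (simp add: ref_tri_def)
      then show "?g (vector [s, t]) \<in> ?K" unfolding convex_hull_3_ref_tri by (rule imageI)
    qed
    have "(?h has_vector_derivative G (?g (vector [s, t])) \<bullet> (b - a)) (at s within {0..1 - t})"
      if s: "s \<in> {0..1 - t}" for s
    proof -
      have "(f has_derivative (\<lambda>h. G (?g (vector [s, t])) \<bullet> h))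
          (at (?g (vector [s, t])) within (\<lambda>s. ?g (vector [s, t])) ` {0..1 - t})"
        using C sub s by (intro has_derivative_subset[OF _ sub]) (simp add: C1_on_def image_subset_iff)
      moreover have "((\<lambda>s. ?g (vector [s, t])) has_derivative (\<lambda>r. r *\<^sub>R (b - a))) (at s within {0..1 - t})"
        by (auto intro!: derivative_eq_intros)
      ultimately show ?thesis
        by (auto dest: has_derivative_in_compose simp: has_vector_derivative_def)
    qed
    then have "((\<lambda>s. G (?g (vector [s, t])) \<bullet> (b - a)) has_integral ?h (1 - t) - ?h 0) {0..1 - t}"
      using t by (intro fundamental_theorem_of_calculus) auto
    moreover have "?g (vector [1 - t, t]) = linepath b c t" "?g (vector [0, t]) = linepath a c t"
      by (simp_all add: linepath_def algebra_simps)
    ultimately show ?thesis by (simp add: integral_unique)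
  qed
  have "integral {0..1} (\<lambda>t. integral {0..1 - t} (\<lambda>s. G (?g (vector [s, t])) \<bullet> (b - a)))
      = integral {0..1} (\<lambda>t. f (linepath b c t) - f (linepath a c t))"
    by (rule Henstock_Kurzweil_Integration.integral_cong) (rule inner)
  then have "integral ?K (\<lambda>x. G x \<bullet> (b - a)) =
      \<bar>cross2 (b - a) (c - a)\<bar> * integral {0..1} (\<lambda>t. f (linepath b c t) - f (linepath a c t))"
    by (simp only: integral_triangle_affine[OF D cG] integral_ref_tri[OF cg])
  also have "integral {0..1} (\<lambda>t. f (linepath b c t) - f (linepath a c t)) =
      integral {0..1} (\<lambda>s. f (linepath b c s)) - integral {0..1} (\<lambda>s. f (linepath a c s))"
    by (intro integral_diff integrable_continuous_real C1_on_linepath(1)[OF C] seg v)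
  finally show ?thesis .
qed

lemma integral_linepath_sym:
  fixes f :: "'a::real_normed_vector \<Rightarrow> real"
  shows "integral {0..1} (\<lambda>s. f (linepath a b s)) = integral {0..1} (\<lambda>s. f (linepath b a s))"
proof -
  have "integral {0..1} (\<lambda>s. f (linepath b a (1 - s))) = integral {0..1} (\<lambda>s. f (linepath b a s))"
    using Henstock_Kurzweil_Integration.integral_reflect_real[of 0 "-1" "\<lambda>s. f (linepath b a (1 + s))"]
      integral_shift_real_ivl[of 0 1 1 "\<lambda>s. f (linepath b a s)"] by (simp add: add.commute)
  moreover have "linepath b a (1 - s) = linepath a b s" for s
    by (simp add: linepath_def algebra_simps)
  ultimately show ?thesis by simp
qed

text \<open>\<open>cross2 v (b - a)\<close> is the component of \<open>v\<close>, scaled by \<open>\<bar>b - a\<bar>\<close>, along the unit normal on the right of \<open>b - a\<close>, which is the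
  outward one when the boundary is traversed counter-clockwise.\<close>

definition flux :: "(real^2 \<Rightarrow> real^2) \<Rightarrow> real^2 \<Rightarrow> real^2 \<Rightarrow> real" where
  "flux v a b = integral {0..1} (\<lambda>s. cross2 (v (linepath a b s)) (b - a))"

text \<open>Two triangles sharing an interior edge traverse it in opposite directions, so their
  contributions cancel.\<close>

lemma flux_reverse: "flux v b a = - flux v a b"
proof -
  have "flux v b a = integral {0..1} (\<lambda>s. cross2 (v (linepath a b s)) (a - b))"
    unfolding flux_def by (subst integral_linepath_sym) simp
  also have "\<dots> = - flux v a b"
    unfolding flux_def integral_neg[symmetric] by (simp add: cross2_def algebra_simps)
  finally show ?thesis .
qed

text \<open>Cramer's rule for \<open>w\<close> in the basis \<open>u\<close>, \<open>v\<close>,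
  multiplied through by the determinant.\<close>

lemma cross2_expand: "cross2 u v *\<^sub>R w = cross2 w v *\<^sub>R u + cross2 u w *\<^sub>R v"
  by (simp add: vec_eq_iff forall_2 cross2_def algebra_simps)

text \<open>The edge directions \<open>b - a\<close> and \<open>c - a\<close> are covered by the
  preceding formula, and a general \<open>w\<close> is a combination of them. The result is Gauss'
  theorem for a constant direction: \<open>cross2 w (b - a)\<close> is the component of
  \<open>w\<close> along the outward normal, scaled by the length of the edge.\<close>

lemma integral_triangle_deriv:
  fixes a b c :: "real^2"
  assumes D: "cross2 (b - a) (c - a) > 0" and C: "C1_on (convex hull {a, b, c}) f G"
  defines "I \<equiv> \<lambda>p q. integral {0..1} (\<lambda>s. f (linepath p q s))"
  shows "integral (convex hull {a, b, c}) (\<lambda>x. G x \<bullet> w) =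
    cross2 w (b - a) * I a b + cross2 w (c - b) * I b c + cross2 w (a - c) * I c a"
proof -
  let ?K = "convex hull {a, b, c}"
  let ?D = "cross2 (b - a) (c - a)"
  have Gi: "(\<lambda>x. G x \<bullet> u) integrable_on ?K" for u
    using C by (intro integrable_continuous_compact)
      (auto simp: C1_on_def finite_imp_compact_convex_hull intro!: continuous_intros)
  have 1: "integral ?K (\<lambda>x. G x \<bullet> (b - a)) = ?D * (I b c - I c a)"
    using integral_triangle_deriv_edge[OF _ C] D integral_linepath_sym[of f a c] by (simp add: I_def)
  have 2: "integral ?K (\<lambda>x. G x \<bullet> (c - a)) = ?D * (I b c - I a b)"
    using integral_triangle_deriv_edge[of c a b f G] C D integral_linepath_sym[of f c b]
    by (simp add: I_def insert_commute cross2_def algebra_simps)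
  have "?D * integral ?K (\<lambda>x. G x \<bullet> w) = integral ?K (\<lambda>x. G x \<bullet> (?D *\<^sub>R w))"
    by simp
  also have "\<dots> = integral ?K (\<lambda>x. cross2 w (c - a) * (G x \<bullet> (b - a)) + cross2 (b - a) w * (G x \<bullet> (c - a)))"
    unfolding cross2_expand[of "b - a" "c - a" w] by (simp add: inner_add_right)
  also have "\<dots> = cross2 w (c - a) * (?D * (I b c - I c a)) + cross2 (b - a) w * (?D * (I b c - I a b))"
    using Gi by (subst integral_add) (auto simp: 1 2 intro: integrable_on_mult_right)
  also have "\<dots> = ?D * (cross2 w (b - a) * I a b + cross2 w (c - b) * I b c + cross2 w (a - c) * I c a)"
    by (simp add: cross2_def algebra_simps)
  finally show ?thesis using D by simp
qed

text \<open>Gauss' formula with \<open>w\<close> the \<open>j\<close>-th coordinate vector handles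
  the \<open>j\<close>-th component of \<open>v\<close>; the two edge sums recombine to
  fluxes.\<close>

lemma divergence_triangle:
  fixes a b c :: "real^2"
  assumes D: "cross2 (b - a) (c - a) > 0"
    and C: "\<And>j. C1_on (convex hull {a, b, c}) (\<lambda>x. v x $ j) (G j)"
  shows "integral (convex hull {a, b, c}) (\<lambda>x. G 1 x $ 1 + G 2 x $ 2) = flux v a b + flux v b c + flux v c a"
proof -
  let ?K = "convex hull {a, b, c}"
  have Gi: "(\<lambda>x. G j x \<bullet> u) integrable_on ?K" for j u
    using C[of j] by (intro integrable_continuous_compact)
      (auto simp: C1_on_def finite_imp_compact_convex_hull intro!: continuous_intros)
  have seg: "closed_segment p q \<subseteq> ?K" if "p \<in> ?K" "q \<in> ?K" for p q
    using that by (meson closed_segment_subset convex_convex_hull)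
  have V: "a \<in> ?K" "b \<in> ?K" "c \<in> ?K" by (auto intro: hull_inc)
  have fl: "flux v p q = cross2 (axis 1 1) (q - p) * integral {0..1} (\<lambda>s. v (linepath p q s) $ 1)
      + cross2 (axis 2 1) (q - p) * integral {0..1} (\<lambda>s. v (linepath p q s) $ 2)"
    if "p \<in> ?K" "q \<in> ?K" for p q
  proof -
    have i: "(\<lambda>s. v (linepath p q s) $ j) integrable_on {0..1}" for j
      by (intro integrable_continuous_real C1_on_linepath(1)[OF C] seg that)
    have "flux v p q = integral {0..1} (\<lambda>s. cross2 (axis 1 1) (q - p) * v (linepath p q s) $ 1
       + cross2 (axis 2 1) (q - p) * v (linepath p q s) $ 2)"
      unfolding flux_def by (simp add: cross2_def axis_def algebra_simps)
    also have "\<dots> = cross2 (axis 1 1) (q - p) * integral {0..1} (\<lambda>s. v (linepath p q s) $ 1)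
      + cross2 (axis 2 1) (q - p) * integral {0..1} (\<lambda>s. v (linepath p q s) $ 2)"
      using i by (subst integral_add) (auto intro: integrable_on_mult_right)
    finally show ?thesis .
  qed
  have "integral ?K (\<lambda>x. G 1 x $ 1 + G 2 x $ 2) =
      integral ?K (\<lambda>x. G 1 x \<bullet> axis 1 1) + integral ?K (\<lambda>x. G 2 x \<bullet> axis 2 1)"
    using Gi[of 1 "axis 1 1"] Gi[of 2 "axis 2 1"]
    by (subst integral_add[symmetric]) (auto simp: inner_axis)
  then show ?thesis
    unfolding integral_triangle_deriv[OF D C] fl[OF V(1,2)] fl[OF V(2,3)] fl[OF V(3,1)] by simp
qed

section \<open>Null sets and symmetry of second derivatives\<close>

lemma AE_lebesgue_on_iff_negligible:
  assumes "T \<in> sets lebesgue"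
  shows "(AE x in lebesgue_on T. P x) \<longleftrightarrow> negligible {x \<in> T. \<not> P x}"
proof -
  have "(AE x in lebesgue_on T. P x) \<longleftrightarrow> (AE x in lebesgue. x \<in> T \<longrightarrow> P x)"
    using assms by (simp add: AE_restrict_space_iff)
  also have "\<dots> \<longleftrightarrow> negligible {x \<in> T. \<not> P x}"
  proof
    assume "AE x in lebesgue. x \<in> T \<longrightarrow> P x"
    from AE_E3[OF this] obtain N
      where N: "\<And>x. x \<in> space lebesgue - N \<Longrightarrow> x \<in> T \<longrightarrow> P x" "N \<in> null_sets lebesgue"
      by metis
    then have "{x \<in> T. \<not> P x} \<subseteq> N" by auto
    with N(2) show "negligible {x \<in> T. \<not> P x}"
      using negligible_iff_null_sets negligible_subset by metis
  next
    assume "negligible {x \<in> T. \<not> P x}"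
    then have "{x \<in> T. \<not> P x} \<in> null_sets lebesgue" by (simp only: negligible_iff_null_sets)
    then show "AE x in lebesgue. x \<in> T \<longrightarrow> P x" by (rule AE_I') auto
  qed
  finally show ?thesis .
qed

text \<open>The set where two continuous functions differ is open, and a nonempty open set is not
  negligible. This upgrades almost everywhere statements to pointwise ones.\<close>

lemma continuous_eq_if_negligible:
  fixes f g :: "'a::euclidean_space \<Rightarrow> 'b::real_normed_vector"
  assumes "open S" "continuous_on S f" "continuous_on S g"
    and "negligible {x \<in> S. f x \<noteq> g x}" "x \<in> S"
  shows "f x = g x"
proof -
  have "open (S \<inter> (\<lambda>x. f x - g x) -` (- {0}))"
    using assms by (intro continuous_open_preimage continuous_on_diff) auto
  moreover have "S \<inter> (\<lambda>x. f x - g x) -` (- {0}) = {x \<in> S. f x \<noteq> g x}" by auto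
  ultimately have "{x \<in> S. f x \<noteq> g x} = {}"
    using assms(4) by (metis open_not_negligible)
  with assms(5) show ?thesis by blast
qed

text \<open>Applied to squares, it turns orthogonality of a function to itself into vanishing almost
  everywhere.\<close>

lemma negligible_if_integral_nonneg_eq_0:
  fixes f :: "'a::euclidean_space \<Rightarrow> real"
  assumes "S \<in> sets lebesgue" "f integrable_on S" "\<And>x. x \<in> S \<Longrightarrow> 0 \<le> f x" "integral S f = 0"
  shows "negligible {x \<in> S. f x \<noteq> 0}"
proof -
  have ab: "f absolutely_integrable_on S"
    using assms(2,3) by (rule nonnegative_absolutely_integrable_1)
  then have i: "integrable (lebesgue_on S) f"
    using assms(1) by (simp only: set_integrable_def integrable_restrict_space sets.Int_space_eq2)
  have "integral\<^sup>L (lebesgue_on S) f = 0"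
    using lebesgue_integral_eq_integral[OF i assms(1)] assms(4) by (simp only:)
  moreover have "AE x in lebesgue_on S. 0 \<le> f x" using assms(3) by (intro AE_I2) simp
  ultimately have "AE x in lebesgue_on S. f x = 0"
    by (simp only: integral_nonneg_eq_0_iff_AE[OF i])
  then show ?thesis by (simp only: AE_lebesgue_on_iff_negligible[OF assms(1)])
qed

lemma not_collinear_cross2:
  fixes a b c :: "real^2"
  assumes "cross2 (b - a) (c - a) \<noteq> 0"
  shows "\<not> collinear {a, b, c}"
proof
  assume "collinear {a, b, c}"
  then consider "a = c" | u where "b = u *\<^sub>R a + (1 - u) *\<^sub>R c"
    unfolding collinear_3_expand by blast
  then have "cross2 (b - a) (c - a) = 0"
  proof cases
    case 2
    show ?thesis unfolding 2 by (simp add: cross2_def algebra_simps)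
  qed (simp add: cross2_def)
  with assms show False by simp
qed

lemma interior_triangle_nonempty:
  fixes a b c :: "real^2"
  assumes "cross2 (b - a) (c - a) \<noteq> 0"
  shows "interior (convex hull {a, b, c}) \<noteq> {}"
proof -
  have "(1/3) *\<^sub>R a + (1/3) *\<^sub>R b + (1/3) *\<^sub>R c \<in> interior (convex hull {a, b, c})"
    using not_collinear_cross2[OF assms]
    by (subst interior_convex_hull_3_minimal) (auto intro!: exI[of _ "1/3"])
  then show ?thesis by blast
qed

text \<open>If the mixed derivatives differed at \<open>x\<close>, their difference would keep its
  sign on a small triangle. But its integral there is the boundary flux of a rotated gradient, which
  is zero.\<close>

lemma mixed_partials_eq:
  fixes p :: "real^2 \<Rightarrow> real"
  assumes "open U" "x \<in> U" "C1_on U p G" "\<And>j. C1_on U (\<lambda>x. G x $ j) (H j)"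
  shows "H 1 x $ 2 = H 2 x $ 1"
proof (rule ccontr)
  assume ne: "H 1 x $ 2 \<noteq> H 2 x $ 1"
  define h where "h = (\<lambda>x. H 2 x $ 1 - H 1 x $ 2)"
  define \<sigma> where "\<sigma> = sgn (h x)"
  have cH: "continuous_on U (H j)" for j using assms(4) by (simp add: C1_on_def)
  have hx: "\<sigma> * h x > 0" using ne by (simp add: h_def \<sigma>_def sgn_if)
  have "continuous_on U (\<lambda>x. \<sigma> * h x)"
    unfolding h_def by (intro continuous_intros cH)
  then have "open {x \<in> U. \<sigma> * h x > 0}"
    using continuous_open_preimage[OF _ assms(1) open_greaterThan[of 0]]
    by (simp add: Int_def vimage_def)
  then obtain e where e: "e > 0" "cball x e \<subseteq> {x \<in> U. \<sigma> * h x > 0}"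
    using hx assms(2) open_contains_cball by blast
  define b c where "b = x + e *\<^sub>R axis 1 1" and "c = x + e *\<^sub>R axis 2 1"
  define K where "K = convex hull {x, b, c}"
  have K: "K \<subseteq> cball x e"
    unfolding K_def using e(1) by (intro hull_minimal convex_cball) (auto simp: b_def c_def dist_norm)
  have D: "cross2 (b - x) (c - x) > 0" using e by (simp add: cross2_def b_def c_def axis_def)
  \<comment> \<open>The divergence of this field is \<open>h\<close>, and its flux across a segment
    is the difference of the values of \<open>p\<close> at the ends, so the flux around the triangle
    telescopes.\<close>
  define v where "v = (\<lambda>y. vector [G y $ 2, - G y $ 1] :: real^2)"
  define W where "W = (\<lambda>j. if j = (1::2) then H 2 else (\<lambda>y. - H 1 y))"
  have KU: "K \<subseteq> U" using K e by blast
  have Cv: "C1_on K (\<lambda>y. v y $ j) (W j)" for j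
  proof (rule C1_on_subset[OF _ KU])
    have "(\<lambda>y. v y $ 2) = (\<lambda>y. - G y $ 1)" "(\<lambda>y. v y $ 1) = (\<lambda>y. G y $ 2)" by (auto simp: v_def)
    moreover have "C1_on U (\<lambda>y. - G y $ 1) (\<lambda>y. - H 1 y)"
      using assms(4)[of 1] unfolding C1_on_def by (auto intro!: continuous_intros derivative_eq_intros)
    ultimately show "C1_on U (\<lambda>y. v y $ j) (W j)"
      using assms(4)[of 2] exhaust_2[of j] by (auto simp: W_def)
  qed
  have fl: "flux v s t = p t - p s" if "s \<in> K" "t \<in> K" for s t
  proof -
    have "closed_segment s t \<subseteq> K" using that by (simp add: K_def closed_segment_subset)
    from integral_unique[OF integral_linepath_C1[OF C1_on_subset[OF assms(3) KU] this]]
    show ?thesis by (simp add: flux_def v_def cross2_def inner_vec_def sum_2 add.commute)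
  qed
  have "integral K (\<lambda>y. W 1 y $ 1 + W 2 y $ 2) = 0"
    using divergence_triangle[OF D Cv[unfolded K_def]] fl
    by (simp add: K_def hull_inc)
  then have "integral K h = 0" by (simp add: W_def h_def)
  then have i0: "integral K (\<lambda>y. \<sigma> * h y) = 0" by simp
  have cK: "compact K" by (simp add: K_def finite_imp_compact_convex_hull)
  have "negligible {y \<in> K. \<sigma> * h y \<noteq> 0}"
  proof (rule negligible_if_integral_nonneg_eq_0[OF _ _ _ i0])
    show "K \<in> sets lebesgue" using cK by (simp add: lmeasurable_compact fmeasurableD)
    show "(\<lambda>y. \<sigma> * h y) integrable_on K"
      unfolding h_def by (intro integrable_continuous_compact cK continuous_intros continuous_on_subset[OF cH KU])
  qed (use K e in force)
  moreover have "{y \<in> K. \<sigma> * h y \<noteq> 0} = K" using K e by force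
  ultimately have "negligible (interior K)" using interior_subset negligible_subset by metis
  then show False
    using interior_triangle_nonempty[of b x c] D open_not_negligible[OF open_interior] by (auto simp: K_def)
qed

section \<open>Bivariate polynomials\<close>

lemma finite_degree_le: "finite {(a, b). int (a + b) \<le> k}"
  by (rule finite_subset[of _ "{..nat k} \<times> {..nat k}"]) auto

lemma polys_monom:
  assumes "int (a + b) \<le> k"
  shows "(\<lambda>x. c * (x $ 1) ^ a * (x $ 2) ^ b) \<in> polys k"
  unfolding polys_def mem_Collect_eq
proof (intro exI allI)
  fix x :: "real^2"
  have "(\<Sum>(i, j)\<in>{(a, b). int (a + b) \<le> k}. (if (i, j) = (a, b) then c else 0) * (x $ 1) ^ i * (x $ 2) ^ j)
      = (\<Sum>ij\<in>{(a, b). int (a + b) \<le> k}. if (a, b) = ij then c * (x $ 1) ^ a * (x $ 2) ^ b else 0)"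
    by (rule sum.cong) (auto split: if_splits)
  then show "c * (x $ 1) ^ a * (x $ 2) ^ b =
    (\<Sum>(i, j)\<in>{(a, b). int (a + b) \<le> k}. (\<lambda>i j. if (i, j) = (a, b) then c else 0) i j * (x $ 1) ^ i * (x $ 2) ^ j)"
    using assms by (simp add: sum.delta'[OF finite_degree_le[simplified]])
qed

lemma polys_add:
  assumes "p \<in> polys k" "q \<in> polys k"
  shows "(\<lambda>x. p x + q x) \<in> polys k"
proof -
  obtain c d where
    "\<forall>x. p x = (\<Sum>(a,b)\<in>{(a,b). int (a + b) \<le> k}. c a b * (x $ 1) ^ a * (x $ 2) ^ b)"
    "\<forall>x. q x = (\<Sum>(a,b)\<in>{(a,b). int (a + b) \<le> k}. d a b * (x $ 1) ^ a * (x $ 2) ^ b)"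
    using assms by (auto simp: polys_def)
  then show ?thesis
    by (auto simp: polys_def sum.distrib[symmetric] case_prod_unfold distrib_right
        intro!: exI[of _ "\<lambda>a b. c a b + d a b"])
qed

lemma polys_cmult:
  assumes "p \<in> polys k"
  shows "(\<lambda>x. s * p x) \<in> polys k"
proof -
  obtain c where
    "\<forall>x. p x = (\<Sum>(a,b)\<in>{(a,b). int (a + b) \<le> k}. c a b * (x $ 1) ^ a * (x $ 2) ^ b)"
    using assms by (auto simp: polys_def)
  then show ?thesis
    by (auto simp: polys_def sum_distrib_left case_prod_unfold mult.assoc
        intro!: exI[of _ "\<lambda>a b. s * c a b"])
qed

lemma polys_zero: "(\<lambda>_. 0) \<in> polys k"
  by (auto simp: polys_def intro!: exI[of _ "\<lambda>_ _. 0"])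

lemma polys_const: "k \<ge> 0 \<Longrightarrow> (\<lambda>_. c) \<in> polys k"
  using polys_monom[of 0 0 k c] by simp

lemma polys_diff: "p \<in> polys k \<Longrightarrow> q \<in> polys k \<Longrightarrow> (\<lambda>x. p x - q x) \<in> polys k"
  using polys_add[of p k "\<lambda>x. -1 * q x"] polys_cmult[of q k "-1"] by simp

lemma polys_uminus: "p \<in> polys k \<Longrightarrow> (\<lambda>x. - p x) \<in> polys k"
  using polys_cmult[of p k "-1"] by simp

lemma polys_neg_degree: "p \<in> polys k \<Longrightarrow> k < 0 \<Longrightarrow> p x = 0"
  by (force simp: polys_def intro!: sum.neutral)

text \<open>The facts needed about polynomials (gradients, restrictions to lines, antiderivatives)
  are additive, so it is enough to check monomials.\<close>

lemma polys_induct [consumes 1, case_names zero monom add]: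
  assumes "p \<in> polys k"
    and zero: "P (\<lambda>_. 0)"
    and monom: "\<And>c a b. int (a + b) \<le> k \<Longrightarrow> P (\<lambda>x. c * (x $ 1) ^ a * (x $ 2) ^ b)"
    and add: "\<And>p q. P p \<Longrightarrow> P q \<Longrightarrow> P (\<lambda>x. p x + q x)"
  shows "P p"
proof -
  obtain c where
    "\<forall>x. p x = (\<Sum>(a,b)\<in>{(a,b). int (a + b) \<le> k}. c a b * (x $ 1) ^ a * (x $ 2) ^ b)"
    using assms by (auto simp: polys_def)
  then have p: "p = (\<lambda>x. \<Sum>(a,b)\<in>{(a,b). int (a + b) \<le> k}. c a b * (x $ 1) ^ a * (x $ 2) ^ b)" by blast
  have "P (\<lambda>x. \<Sum>(a,b)\<in>F. c a b * (x $ 1) ^ a * (x $ 2) ^ b)"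
    if "finite F" "F \<subseteq> {(a,b). int (a + b) \<le> k}" for F
    using that
  proof (induction F)
    case empty
    then show ?case using zero by simp
  next
    case (insert ab F)
    then show ?case
      using add[OF monom[of "fst ab" "snd ab" "c (fst ab) (snd ab)"], of "\<lambda>x. \<Sum>(a,b)\<in>F. c a b * (x $ 1) ^ a * (x $ 2) ^ b"]
      by (auto simp: case_prod_unfold)
  qed
  from this[OF finite_degree_le order_refl] show ?thesis by (simp only: p)
qed

lemma polys_vec_pair:
  assumes "p \<in> polys k" "q \<in> polys k"
  shows "(\<lambda>x. vector [p x, q x]) \<in> polys_vec k"
proof -
  have "(\<lambda>x. (vector [p x, q x] :: real^2) $ j) \<in> polys k" for j
    using assms exhaust_2[of j] by auto
  then show ?thesis by (simp add: polys_vec_def)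
qed

lemma polys_vec_inner:
  assumes "G \<in> polys_vec k"
  shows "(\<lambda>x. G x \<bullet> u) \<in> polys k"
proof -
  have "(\<lambda>x. u $ 1 * G x $ 1 + u $ 2 * G x $ 2) \<in> polys k"
    using assms by (intro polys_add polys_cmult) (auto simp: polys_vec_def)
  then show ?thesis by (simp add: inner_vec_def sum_2 mult.commute)
qed

section \<open>Gradients, zeros and antiderivatives of polynomials\<close>

lemma has_derivative_nth [derivative_intros]:
  "((\<lambda>x::real^'n. x $ i) has_derivative (\<lambda>h. h $ i)) F"
  by (rule bounded_linear_imp_has_derivative[OF bounded_linear_vec_nth])

lemma polys_gradient:
  assumes "p \<in> polys k"
  shows "\<exists>G\<in>polys_vec (k - 1). \<forall>x. (p has_derivative (\<lambda>h. G x \<bullet> h)) (at x)"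
  using assms
proof (induction rule: polys_induct)
  case zero
  show ?case by (rule bexI[of _ "\<lambda>_. 0"]) (auto simp: polys_vec_def polys_zero)
next
  case (monom c a b)
  define p1 where "p1 = (\<lambda>x::real^2. c * of_nat a * (x $ 1) ^ (a - 1) * (x $ 2) ^ b)"
  define p2 where "p2 = (\<lambda>x::real^2. c * of_nat b * (x $ 1) ^ a * (x $ 2) ^ (b - 1))"
  \<comment> \<open>For \<open>a = 0\<close> the truncated exponent \<open>a - 1\<close> is
    \<open>0\<close> and the degree bound may fail, but the factor \<open>of_nat a\<close> makes
    \<open>p1\<close> the zero polynomial, which has every degree bound.\<close>
  have "p1 \<in> polys (k - 1)"
  proof (cases "a = 0")
    case False
    then show ?thesis unfolding p1_def using monom by (intro polys_monom) simp
  qed (simp add: p1_def polys_zero)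
  moreover have "p2 \<in> polys (k - 1)"
  proof (cases "b = 0")
    case False
    then show ?thesis unfolding p2_def using monom by (intro polys_monom) simp
  qed (simp add: p2_def polys_zero)
  moreover have "((\<lambda>x. c * x $ 1 ^ a * x $ 2 ^ b) has_derivative (\<lambda>h. vector [p1 x, p2 x] \<bullet> h)) (at x)" for x
    by (rule derivative_eq_intros refl)+ (simp add: p1_def p2_def inner_vec_def sum_2 algebra_simps fun_eq_iff)
  ultimately show ?case
    by (intro bexI[of _ "\<lambda>x. vector [p1 x, p2 x]"] polys_vec_pair allI)
next
  case (add p q)
  then obtain G H where "G \<in> polys_vec (k - 1)" "H \<in> polys_vec (k - 1)"
    "\<forall>x. (p has_derivative (\<lambda>h. G x \<bullet> h)) (at x)" "\<forall>x. (q has_derivative (\<lambda>h. H x \<bullet> h)) (at x)" by blast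
  then show ?case
    by (intro bexI[of _ "\<lambda>x. G x + H x"])
       (auto simp: polys_vec_def polys_add inner_add_left intro!: has_derivative_add)
qed

lemma polys_continuous: "p \<in> polys k \<Longrightarrow> continuous_on S p"
  by (meson polys_gradient has_derivative_continuous_on has_derivative_at_withinI)

lemma continuous_on_vec2:
  fixes G :: "'a::topological_space \<Rightarrow> real^2"
  assumes "\<And>j. continuous_on S (\<lambda>x. G x $ j)"
  shows "continuous_on S G"
proof -
  have "continuous_on S (\<lambda>x. \<chi> j. G x $ j)" using assms by (intro continuous_on_vec_lambda) auto
  then show ?thesis by simp
qed

lemma polys_vec_continuous: "G \<in> polys_vec k \<Longrightarrow> continuous_on S G"
  by (intro continuous_on_vec2) (auto simp: polys_vec_def intro: polys_continuous)

lemma polys_C1: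
  assumes "p \<in> polys k"
  obtains G where "G \<in> polys_vec (k - 1)" "\<And>S. C1_on S p G"
  using polys_gradient[OF assms] unfolding C1_on_def
  by (meson polys_vec_continuous has_derivative_at_withinI)

lemma polys_on_line:
  assumes "p \<in> polys k"
  shows "\<exists>q. \<forall>t. p (x + t *\<^sub>R d) = poly q t"
  using assms
proof (induction rule: polys_induct)
  case zero
  show ?case by (rule exI[of _ 0]) simp
next
  case (monom c a b)
  show ?case
    by (rule exI[of _ "[:c:] * [:x $ 1, d $ 1:] ^ a * [:x $ 2, d $ 2:] ^ b"]) simp
next
  case (add p q)
  then obtain u v where "\<forall>t. p (x + t *\<^sub>R d) = poly u t" "\<forall>t. q (x + t *\<^sub>R d) = poly v t" by blast
  then show ?case by (intro exI[of _ "u + v"]) simp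
qed

text \<open>On the line through \<open>y\<close> and a point of \<open>S\<close> the restriction is
  a polynomial in one variable with infinitely many roots.\<close>

lemma polys_eq_0_if_open:
  assumes p: "p \<in> polys k" and S: "open S" "S \<noteq> {}" "\<And>x. x \<in> S \<Longrightarrow> p x = 0"
  shows "p y = 0"
proof -
  obtain x e where e: "e > 0" "ball x e \<subseteq> S" using S by (meson equals0I openE)
  obtain q where q: "\<And>t. p (x + t *\<^sub>R (y - x)) = poly q t" using polys_on_line[OF p] by blast
  have "q = 0"
  proof (rule ccontr)
    assume "q \<noteq> 0"
    then have fin: "finite {t. poly q t = 0}" by (rule poly_roots_finite)
    \<comment> \<open>The summand \<open>1\<close> keeps the quotient meaningful when
      \<open>y = x\<close>.\<close>
    define \<delta> where "\<delta> = e / (norm (y - x) + 1)"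
    have \<delta>: "\<delta> > 0" using e by (simp add: \<delta>_def add_nonneg_pos)
    have "{0<..<\<delta>} \<subseteq> {t. poly q t = 0}"
    proof
      fix t assume t: "t \<in> {0<..<\<delta>}"
      then have "t * norm (y - x) \<le> t * (norm (y - x) + 1)" "t * (norm (y - x) + 1) < e"
        by (auto simp: \<delta>_def pos_less_divide_eq add_nonneg_pos)
      then have "t * norm (y - x) < e" by (rule le_less_trans)
      then have "x + t *\<^sub>R (y - x) \<in> ball x e" using t by (simp add: dist_norm)
      then have "p (x + t *\<^sub>R (y - x)) = 0" using e S by blast
      then show "t \<in> {t. poly q t = 0}" using q by simp
    qed
    with fin have "finite {0<..<\<delta>}" by (rule rev_finite_subset)
    then show False using \<delta> by (simp add: infinite_Ioo)
  qed
  then show ?thesis using q[of 1] by simp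
qed

text \<open>Antiderivative in the second variable. The other partial derivative \<open>P1\<close> is
  recorded with its degree because it enters the correction that produces a stream function.\<close>

lemma polys_antiderivative2:
  assumes "p \<in> polys k"
  shows "\<exists>P\<in>polys (k + 1). \<exists>P1\<in>polys k. \<forall>x. (P has_derivative (\<lambda>h. vector [P1 x, p x] \<bullet> h)) (at x)"
  using assms
proof (induction rule: polys_induct)
  case zero
  show ?case by (rule bexI[of _ "\<lambda>_. 0"], rule bexI[of _ "\<lambda>_. 0"]) (auto simp: polys_zero inner_vec_def sum_2)
next
  case (monom c a b)
  define P where "P = (\<lambda>x::real^2. c / of_nat (Suc b) * (x $ 1) ^ a * (x $ 2) ^ Suc b)"
  define P1 where "P1 = (\<lambda>x::real^2. c / of_nat (Suc b) * of_nat a * (x $ 1) ^ (a - 1) * (x $ 2) ^ Suc b)"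
  have "P \<in> polys (k + 1)" using monom polys_monom[of a "Suc b" "k + 1" "c / of_nat (Suc b)"]
    by (simp add: P_def del: power_Suc of_nat_Suc)
  moreover have "P1 \<in> polys k"
    using monom polys_monom[of "a - 1" "Suc b" k "c / of_nat (Suc b) * of_nat a"]
    by (cases "a = 0") (auto simp: P1_def polys_zero simp del: power_Suc)
  moreover have "(P has_derivative (\<lambda>h. vector [P1 x, c * (x $ 1) ^ a * (x $ 2) ^ b] \<bullet> h)) (at x)" for x
    unfolding P_def P1_def
    by (rule derivative_eq_intros refl)+ (auto simp: inner_vec_def sum_2 algebra_simps fun_eq_iff divide_simps simp del: of_nat_Suc)
  ultimately show ?case by blast
next
  case (add p q)
  then obtain P Q P1 Q1 where "P \<in> polys (k + 1)" "Q \<in> polys (k + 1)" "P1 \<in> polys k" "Q1 \<in> polys k"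
    "\<forall>x. (P has_derivative (\<lambda>h. vector [P1 x, p x] \<bullet> h)) (at x)"
    "\<forall>x. (Q has_derivative (\<lambda>h. vector [Q1 x, q x] \<bullet> h)) (at x)" by blast
  moreover have "vector [P1 x + Q1 x, p x + q x] \<bullet> h = vector [P1 x, p x] \<bullet> h + vector [Q1 x, q x] \<bullet> h" for x and h :: "real^2"
    by (simp add: inner_vec_def sum_2 algebra_simps)
  ultimately show ?case
    by (intro bexI[of _ "\<lambda>x. P x + Q x"] bexI[of _ "\<lambda>x. P1 x + Q1 x"])
       (auto simp: polys_add intro!: has_derivative_add)
qed

text \<open>Only the values of \<open>p\<close> on the first axis enter, so \<open>P\<close> depends
  on the first variable alone; adding it to another function leaves the second partial derivative of
  that function unchanged.\<close>

lemma polys_antiderivative1: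
  assumes "p \<in> polys k"
  shows "\<exists>P\<in>polys (k + 1). \<forall>x. (P has_derivative (\<lambda>h. vector [p (vector [x $ 1, 0]), 0] \<bullet> h)) (at x)"
  using assms
proof (induction rule: polys_induct)
  case zero
  show ?case by (rule bexI[of _ "\<lambda>_. 0"]) (auto simp: polys_zero inner_vec_def sum_2)
next
  case (monom c a b)
  show ?case
  proof (cases "b = 0")
    case True
    have "((\<lambda>x::real^2. c / of_nat (Suc a) * (x $ 1) ^ Suc a * (x $ 2) ^ 0) has_derivative
      (\<lambda>h. vector [c * (x $ 1) ^ a, 0] \<bullet> h)) (at x)" for x
      by (rule derivative_eq_intros refl)+ (auto simp: inner_vec_def sum_2 algebra_simps fun_eq_iff divide_simps simp del: of_nat_Suc)
    moreover have "(\<lambda>x. c / of_nat (Suc a) * (x $ 1) ^ Suc a * (x $ 2) ^ 0) \<in> polys (k + 1)"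
      using monom True by (intro polys_monom) simp
    ultimately show ?thesis using True by (intro bexI) auto
  next
    case False
    then show ?thesis
      by (intro bexI[of _ "\<lambda>_. 0"]) (auto simp: polys_zero inner_vec_def sum_2 power_0_left)
  qed
next
  case (add p q)
  then obtain P Q where "P \<in> polys (k + 1)" "Q \<in> polys (k + 1)"
    "\<forall>x. (P has_derivative (\<lambda>h. vector [p (vector [x $ 1, 0]), 0] \<bullet> h)) (at x)"
    "\<forall>x. (Q has_derivative (\<lambda>h. vector [q (vector [x $ 1, 0]), 0] \<bullet> h)) (at x)" by blast
  moreover have "vector [a + b, 0] \<bullet> h = vector [a, 0] \<bullet> h + vector [b, 0] \<bullet> h" for a b and h :: "real^2"
    by (simp add: inner_vec_def sum_2 algebra_simps)
  ultimately show ?case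
    by (intro bexI[of _ "\<lambda>x. P x + Q x"])
       (auto simp: polys_add intro!: has_derivative_add)
qed

text \<open>A polynomial Poincare lemma. An antiderivative \<open>P\<close> of the first component
  in the second variable has the required second partial derivative; the defect \<open>q\<close> in
  the first one depends on the first variable alone and is repaired by a one-variable
  antiderivative.\<close>

lemma polys_stream_function:
  assumes e: "e \<in> polys_vec k" and G: "\<And>j. C1_on UNIV (\<lambda>x. e x $ j) (G j)"
    and div: "\<And>x. G 1 x $ 1 + G 2 x $ 2 = 0"
  obtains \<psi> where "\<psi> \<in> polys (k + 1)" "\<And>S. C1_on S \<psi> (\<lambda>x. vector [- e x $ 2, e x $ 1])"
proof -
  have ej: "(\<lambda>x. e x $ j) \<in> polys k" for j using e by (simp add: polys_vec_def)
  obtain P P1 where P: "P \<in> polys (k + 1)" "P1 \<in> polys k"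
    "\<And>x. (P has_derivative (\<lambda>h. vector [P1 x, e x $ 1] \<bullet> h)) (at x)"
    using polys_antiderivative2[OF ej[of 1]] by blast
  obtain H where H: "H \<in> polys_vec (k - 1)" "C1_on UNIV P1 H" using polys_C1[OF P(2)] by metis
  have CP: "C1_on UNIV P (\<lambda>x. vector [P1 x, e x $ 1])"
    using P(3) by (auto simp: C1_on_def intro!: continuous_intros polys_continuous[OF P(2)] polys_continuous[OF ej])
  have mixed: "H x $ 2 = G 1 x $ 1" for x
  proof -
    have "C1_on UNIV (\<lambda>x. (vector [P1 x, e x $ 1] :: real^2) $ j) ((\<lambda>j. if j = 1 then H else G 1) j)" for j
      using exhaust_2[of j] G[of 1] H(2) by auto
    from mixed_partials_eq[OF open_UNIV UNIV_I CP this] show ?thesis by simp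
  qed
  define q where "q = (\<lambda>x. - P1 x - e x $ 2)"
  have q: "q \<in> polys k" unfolding q_def by (intro polys_diff polys_uminus P ej)
  have Cq: "C1_on UNIV q (\<lambda>x. - H x - G 2 x)"
    using H(2) G[of 2] unfolding q_def C1_on_def
    by (auto intro!: continuous_intros derivative_eq_intros simp: inner_diff_left)
  \<comment> \<open>By symmetry of the mixed derivatives of \<open>P\<close>, the second partial
    derivative of \<open>q\<close> is minus the divergence of \<open>e\<close>. Hence
    \<open>q\<close> is constant along vertical segments.\<close>
  have qx: "q x = q (vector [x $ 1, 0])" for x
  proof -
    let ?a = "vector [x $ 1, 0] :: real^2"
    have "- H y $ 2 - G 2 y $ 2 = 0" for y using div[of y] mixed[of y] by simp
    then have "(- H y - G 2 y) \<bullet> (x - ?a) = 0" for y by (simp add: inner_vec_def sum_2)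
    with integral_linepath_C1[OF Cq, of ?a x] have "((\<lambda>s. 0) has_integral q x - q ?a) {0..1::real}" by simp
    then show ?thesis using has_integral_0 has_integral_unique by fastforce
  qed
  obtain Q where Q: "Q \<in> polys (k + 1)" "\<And>x. (Q has_derivative (\<lambda>h. vector [q x, 0] \<bullet> h)) (at x)"
    using polys_antiderivative1[OF q] qx by metis
  show thesis
  proof
    show "(\<lambda>x. P x + Q x) \<in> polys (k + 1)" using P Q by (intro polys_add)
    have eq: "vector [- e x $ 2, e x $ 1] \<bullet> h = vector [P1 x, e x $ 1] \<bullet> h + vector [q x, 0] \<bullet> h" for x and h :: "real^2"
      by (simp add: inner_vec_def sum_2 q_def algebra_simps)
    have "((\<lambda>x. P x + Q x) has_derivative (\<lambda>h. vector [- e x $ 2, e x $ 1] \<bullet> h)) (at x)" for x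
      unfolding eq by (rule has_derivative_add[OF P(3) Q(2)])
    then have "((\<lambda>x. P x + Q x) has_derivative (\<lambda>h. vector [- e x $ 2, e x $ 1] \<bullet> h)) (at x within S)" for x S
      by (rule has_derivative_at_withinI)
    moreover have "continuous_on S (\<lambda>x. vector [- e x $ 2, e x $ 1] :: real^2)" for S
      by (rule continuous_on_vector2[OF continuous_on_minus[OF polys_continuous[OF ej]] polys_continuous[OF ej]])
    ultimately show "C1_on S (\<lambda>x. P x + Q x) (\<lambda>x. vector [- e x $ 2, e x $ 1])" for S
      by (simp add: C1_on_def)
  qed
qed

section \<open>Geometry of the split\<close>

text \<open>The clockwise quarter turn. It takes a gradient to the corresponding \<open>rot\<close>
  and an edge direction to the normal on its right.\<close>

definition rot90 :: "real^2 \<Rightarrow> real^2" where "rot90 u = vector [u $ 2, - u $ 1]"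

lemma inner2: "(x::real^2) \<bullet> y = x $ 1 * y $ 1 + x $ 2 * y $ 2"
  by (simp add: inner_vec_def sum_2)

lemma inner_rot90: "v \<bullet> rot90 u = cross2 v u"
  by (simp add: rot90_def inner2 cross2_def)

lemma norm_rot90: "norm (rot90 u) = norm u"
  by (simp add: norm_eq_sqrt_inner rot90_def inner2)

text \<open>The sign \<open>\<sigma>\<close> records on which side of the line the point
  \<open>c\<close> lies. The unit vectors orthogonal to \<open>b - a\<close> are the two multiples
  of \<open>rot90 (b - a)\<close> of norm one, and \<open>c\<close> decides between them.\<close>

lemma outer_normal_eq:
  assumes \<sigma>: "\<bar>\<sigma>\<bar> = 1" and c: "\<sigma> * cross2 (b - a) (c - a) > 0"
  shows "outer_normal a b c = (\<sigma> / norm (b - a)) *\<^sub>R rot90 (b - a)"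
proof -
  define u where "u = b - a"
  have u0: "u \<noteq> 0" using c by (auto simp: u_def cross2_def)
  have r: "rot90 u \<bullet> (c - a) = - cross2 u (c - a)"
    by (simp add: rot90_def cross2_def inner2)
  have neg: "\<sigma> * (rot90 u \<bullet> (c - a)) < 0"
    unfolding r using c by (simp add: u_def)
  have main: "n = (\<sigma> / norm u) *\<^sub>R rot90 u"
    if n: "norm n = 1" "n \<bullet> u = 0" "n \<bullet> (c - a) < 0" for n :: "real^2"
  proof -
    define s where "s = (n \<bullet> rot90 u) / (norm u)\<^sup>2"
    have uu: "(norm u)\<^sup>2 = u $ 1 * u $ 1 + u $ 2 * u $ 2"
      by (simp add: power2_norm_eq_inner inner2)
    have "(norm u)\<^sup>2 *\<^sub>R n = (n \<bullet> rot90 u) *\<^sub>R rot90 u + (n \<bullet> u) *\<^sub>R u"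
      unfolding uu by (simp add: vec_eq_iff forall_2 rot90_def inner2 algebra_simps)
    then have "(norm u)\<^sup>2 *\<^sub>R n = (n \<bullet> rot90 u) *\<^sub>R rot90 u" using n(2) by simp
    moreover have "n = ((norm u)\<^sup>2 *\<^sub>R n) /\<^sub>R (norm u)\<^sup>2" using u0 by simp
    ultimately have ns: "n = s *\<^sub>R rot90 u" by (simp add: s_def divide_inverse mult.commute)
    have "s * (rot90 u \<bullet> (c - a)) < 0" using n(3) ns by simp
    from this neg have "(s * (rot90 u \<bullet> (c - a))) * (\<sigma> * (rot90 u \<bullet> (c - a))) > 0"
      by (rule mult_neg_neg)
    then have "(s * \<sigma>) * (rot90 u \<bullet> (c - a))\<^sup>2 > 0" by (simp add: power2_eq_square mult.commute mult.left_commute)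
    then have pos: "s * \<sigma> > 0" by (simp add: zero_less_mult_iff)
    have "\<bar>s\<bar> * norm u = 1" using n(1) ns norm_rot90[of u] by simp
    then have "\<bar>s\<bar> = 1 / norm u" using u0 by (simp add: field_simps)
    moreover have "s = \<sigma> * \<bar>s\<bar>"
      using pos \<sigma> by (auto simp: abs_if zero_less_mult_iff split: if_splits)
    ultimately show ?thesis using ns by (simp only:) simp
  qed
  have ex: "norm ((\<sigma> / norm u) *\<^sub>R rot90 u) = 1 \<and> ((\<sigma> / norm u) *\<^sub>R rot90 u) \<bullet> u = 0 \<and>
      ((\<sigma> / norm u) *\<^sub>R rot90 u) \<bullet> (c - a) < 0"
  proof -
    have "rot90 u \<bullet> u = 0" by (simp add: rot90_def inner2)
    moreover have "\<sigma> * (rot90 u \<bullet> (c - a)) / norm u < 0"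
      using neg u0 by (simp add: divide_less_0_iff)
    ultimately show ?thesis using u0 \<sigma> by (simp add: norm_rot90)
  qed
  show ?thesis unfolding outer_normal_def u_def[symmetric]
    by (rule the_equality) (use ex main in blast)+
qed

text \<open>Replacing one vertex at a time by \<open>m\<close> covers the triangle. The piece
  without \<open>a\<close> degenerates to the edge from \<open>b\<close> to \<open>c\<close>, which
  the other two pieces cover; these meet in the segment from \<open>a\<close> to
  \<open>m\<close>.\<close>

lemma hull3_edge_split:
  fixes a b c m :: "real^2"
  assumes "cross2 (b - a) (c - a) \<noteq> 0" and m: "m \<in> closed_segment b c"
  shows "convex hull {a, b, c} = convex hull {a, b, m} \<union> convex hull {a, m, c}"
    and "negligible (convex hull {a, b, m} \<inter> convex hull {a, m, c})"
proof -
  have nc: "\<not> collinear {a, b, c}" using assms(1) by (rule not_collinear_cross2)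
  then have ne: "a \<noteq> b" "a \<noteq> c" "b \<noteq> c" "\<not> affine_dependent {a, b, c}"
    by (auto simp: collinear_3_eq_affine_dependent)
  have mh: "m \<in> convex hull {a, b, c}"
    using m by (metis hull_mono insertI2 segment_convex_hull subsetD subset_insertI)
  have "convex hull {a, b, c} = (\<Union>x\<in>{a, b, c}. convex hull (insert m ({a, b, c} - {x})))"
    by (rule convex_hull_exchange_Union[OF mh])
  also have "\<dots> = convex hull {m, b, c} \<union> convex hull {m, a, c} \<union> convex hull {m, a, b}"
  proof -
    have "{a, b, c} - {a} = {b, c}" "{a, b, c} - {b} = {a, c}" "{a, b, c} - {c} = {a, b}"
      using ne by auto
    then show ?thesis by auto
  qed
  also have "convex hull {m, b, c} \<subseteq> convex hull {m, a, c} \<union> convex hull {m, a, b}"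
  proof -
    have "convex hull {m, b, c} = closed_segment b c"
      using m by (metis hull_insert insert_absorb segment_convex_hull hull_redundant)
    also have "\<dots> = closed_segment b m \<union> closed_segment m c"
      using m Un_closed_segment by blast
    also have "closed_segment b m \<subseteq> convex hull {m, a, b}"
      unfolding segment_convex_hull by (rule hull_mono) auto
    also have "closed_segment m c \<subseteq> convex hull {m, a, c}"
      unfolding segment_convex_hull by (rule hull_mono) auto
    finally show ?thesis by blast
  qed
  then have "convex hull {m, b, c} \<union> convex hull {m, a, c} \<union> convex hull {m, a, b}
      = convex hull {a, b, m} \<union> convex hull {a, m, c}"
    by (auto simp: insert_commute)
  finally show "convex hull {a, b, c} = convex hull {a, b, m} \<union> convex hull {a, m, c}" .
  have "convex hull (insert m {a, b}) \<inter> convex hull (insert m {a, c}) = convex hull (insert m ({a, b} \<inter> {a, c}))"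
    using ne mh by (intro convex_hull_exchange_Int) auto
  moreover have "insert m {a, b} = {a, b, m}" "insert m {a, c} = {a, m, c}" "{a, b} \<inter> {a, c} = {a}"
    using ne by auto
  ultimately have "convex hull {a, b, m} \<inter> convex hull {a, m, c} = convex hull {m, a}"
    by (simp only:)
  moreover have "negligible (convex hull {m, a})"
    by (simp add: negligible_convex_interior empty_interior_convex_hull card_insert_le_m1)
  ultimately show "negligible (convex hull {a, b, m} \<inter> convex hull {a, m, c})" by simp
qed

text \<open>The intersections are recorded as segments, not merely as null sets, because they later
  locate the points \<open>z (3 + i)\<close> relative to the pieces.\<close>

lemma hull3_point_split:
  fixes a b c p :: "real^2"
  assumes "cross2 (b - a) (c - a) \<noteq> 0" and p: "p \<in> convex hull {a, b, c}"
  shows "convex hull {a, b, c} = convex hull {p, b, c} \<union> convex hull {p, c, a} \<union> convex hull {p, a, b}"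
    and "convex hull {p, b, c} \<inter> convex hull {p, c, a} = closed_segment p c"
    and "convex hull {p, c, a} \<inter> convex hull {p, a, b} = closed_segment p a"
    and "convex hull {p, a, b} \<inter> convex hull {p, b, c} = closed_segment p b"
proof -
  have nc: "\<not> collinear {a, b, c}" using assms(1) by (rule not_collinear_cross2)
  then have ne: "a \<noteq> b" "a \<noteq> c" "b \<noteq> c" "\<not> affine_dependent {a, b, c}"
    by (auto simp: collinear_3_eq_affine_dependent)
  have "convex hull {a, b, c} = (\<Union>x\<in>{a, b, c}. convex hull (insert p ({a, b, c} - {x})))"
    by (rule convex_hull_exchange_Union[OF p])
  also have "\<dots> = convex hull {p, b, c} \<union> convex hull {p, c, a} \<union> convex hull {p, a, b}"
  proof -
    have "{a, b, c} - {a} = {b, c}" "{a, b, c} - {b} = {c, a}" "{a, b, c} - {c} = {a, b}"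
      using ne by auto
    then show ?thesis by auto
  qed
  finally show "convex hull {a, b, c} = convex hull {p, b, c} \<union> convex hull {p, c, a} \<union> convex hull {p, a, b}" .
  have I: "convex hull (insert p T) \<inter> convex hull (insert p T') = closed_segment p x"
    if "T \<subseteq> {a, b, c}" "T' \<subseteq> {a, b, c}" "T \<inter> T' = {x}" for T T' x
    using convex_hull_exchange_Int[OF ne(4) p that(1,2)] that(3)
    by (simp add: segment_convex_hull)
  show "convex hull {p, b, c} \<inter> convex hull {p, c, a} = closed_segment p c"
    "convex hull {p, c, a} \<inter> convex hull {p, a, b} = closed_segment p a"
    "convex hull {p, a, b} \<inter> convex hull {p, b, c} = closed_segment p b"
    using ne I[of "{b, c}" "{c, a}" c] I[of "{c, a}" "{a, b}" a] I[of "{a, b}" "{b, c}" b] by auto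
qed

lemma negligible_segment: "negligible (closed_segment a (b::real^2))"
  by (simp add: segment_convex_hull negligible_convex_interior empty_interior_convex_hull card_insert_le_m1)

section \<open>Orientation and incidence of the six subtriangles\<close>

locale powell_sabin_split =
  fixes z :: "nat \<Rightarrow> real^2"
  assumes ps: "powell_sabin z"
begin

abbreviation T where "T \<equiv> tri z"
abbreviation I where "I \<equiv> {1, 2, 3 :: nat}"
abbreviation m where "m i \<equiv> z (3 + i)"

lemma nxt_prv_simps [simp]:
  "nxt 1 = 2" "nxt (Suc 0) = 2" "nxt 2 = 3" "nxt 3 = 1" "prv 1 = 3" "prv (Suc 0) = 3" "prv 2 = 1" "prv 3 = 2"
  by (simp_all add: nxt_def prv_def)

lemma m_segment: "i \<in> I \<Longrightarrow> m i \<in> open_segment (z (nxt i)) (z (prv i))"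
  using ps unfolding powell_sabin_def by blast

lemma cross_T: "cross2 (z 2 - z 1) (z 3 - z 1) > 0"
  using ps unfolding powell_sabin_def cross2_def by blast

lemma z0_interior: "z 0 \<in> interior T"
  using ps unfolding powell_sabin_def by blast

lemma tri_rotate: "i \<in> I \<Longrightarrow> T = convex hull {z i, z (nxt i), z (prv i)}"
  unfolding tri_def by (auto simp: insert_commute)

lemma cross_rotate: "i \<in> I \<Longrightarrow> cross2 (z (nxt i) - z i) (z (prv i) - z i) > 0"
  using cross_T by (auto simp: cross2_def algebra_simps)

text \<open>The barycentric coordinate of \<open>z 0\<close> at \<open>z i\<close> is the ratio of
  the area of this cone to that of \<open>T\<close>, and it is positive because \<open>z 0\<close>
  is an interior point.\<close>

lemma cross_cone:
  assumes "i \<in> I"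
  shows "cross2 (z (nxt i) - z 0) (z (prv i) - z 0) > 0"
proof -
  obtain x y w where w: "0 < x" "0 < y" "0 < w" "x + y + w = 1"
    and z0: "z 0 = x *\<^sub>R z i + y *\<^sub>R z (nxt i) + w *\<^sub>R z (prv i)"
    using z0_interior not_collinear_cross2[of "z (nxt i)" "z i" "z (prv i)"] cross_rotate[OF assms]
    unfolding tri_rotate[OF assms] by (subst (asm) interior_convex_hull_3_minimal) auto
  have y: "y = 1 - x - w" using w by simp
  have "cross2 (z (nxt i) - z 0) (z (prv i) - z 0) = x * cross2 (z (nxt i) - z i) (z (prv i) - z i)"
    unfolding z0 y by (simp add: cross2_def algebra_simps)
  then show ?thesis using w cross_rotate[OF assms] by simp
qed

lemma m_param:
  assumes "i \<in> I"
  obtains u where "0 < u" "u < 1" "m i - z (nxt i) = u *\<^sub>R (z (prv i) - z (nxt i))"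
    "z (prv i) - m i = (1 - u) *\<^sub>R (z (prv i) - z (nxt i))"
proof -
  obtain u where u: "0 < u" "u < 1" "m i = (1 - u) *\<^sub>R z (nxt i) + u *\<^sub>R z (prv i)"
    using m_segment[OF assms] by (auto simp: in_segment)
  show thesis by (rule that[OF u(1,2)]; unfold u(3)) (simp_all add: algebra_simps)
qed

lemma cross_sub:
  assumes "i \<in> I"
  shows "cross2 (z (nxt i) - z 0) (m i - z 0) > 0" "cross2 (m i - z 0) (z (prv i) - z 0) > 0"
proof -
  obtain u where u: "0 < u" "u < 1" "m i = (1 - u) *\<^sub>R z (nxt i) + u *\<^sub>R z (prv i)"
    using m_segment[OF assms] by (auto simp: in_segment)
  have "cross2 (z (nxt i) - z 0) (m i - z 0) = u * cross2 (z (nxt i) - z 0) (z (prv i) - z 0)"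
    "cross2 (m i - z 0) (z (prv i) - z 0) = (1 - u) * cross2 (z (nxt i) - z 0) (z (prv i) - z 0)"
    unfolding u(3) by (simp_all add: cross2_def algebra_simps)
  then show "cross2 (z (nxt i) - z 0) (m i - z 0) > 0" "cross2 (m i - z 0) (z (prv i) - z 0) > 0"
    using u cross_cone[OF assms] by simp_all
qed

text \<open>A common form for all six triangles, with \<open>z 0\<close> as first vertex and
  counter-clockwise orientation, which avoids treating the two halves of a cone separately.\<close>

lemma ps_splitE:
  assumes "K \<in> ps_split z"
  obtains b c where "K = convex hull {z 0, b, c}" "cross2 (b - z 0) (c - z 0) > 0"
    "b \<in> T" "c \<in> T"
proof -
  have zT: "z i \<in> T" if "i \<in> I" for i using that by (auto simp: tri_def intro: hull_inc)
  have np: "nxt i \<in> I" "prv i \<in> I" if "i \<in> I" for i using that by auto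
  have mT: "m i \<in> T" if "i \<in> I" for i
  proof -
    have "closed_segment (z (nxt i)) (z (prv i)) \<subseteq> T"
      using zT np that by (simp add: closed_segment_subset tri_def)
    then show ?thesis using m_segment[OF that] open_closed_segment by blast
  qed
  from assms consider i where "i \<in> I" "K = subtri1 z i" | i where "i \<in> I" "K = subtri2 z i"
    by (auto simp: ps_split_def)
  then show thesis
  proof cases
    case 1
    then show ?thesis using that[of "z (nxt i)" "m i"] cross_sub zT[OF np(1)] mT by (simp add: subtri1_def)
  next
    case 2
    then show ?thesis using that[of "m i" "z (prv i)"] cross_sub zT[OF np(2)] mT by (simp add: subtri2_def)
  qed
qed

lemma compact_T: "compact T" and convex_T: "convex T"
  by (simp_all add: tri_def finite_imp_compact_convex_hull)

lemma interior_T: "interior T \<noteq> {}" using z0_interior by blast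

lemma z0_T: "z 0 \<in> T" using z0_interior interior_subset by blast

lemma ps_split_facts:
  assumes "K \<in> ps_split z"
  shows "compact K" "convex K" "interior K \<noteq> {}" "z 0 \<in> K" "K \<subseteq> T" "closure (interior K) = K"
proof -
  obtain b c where K: "K = convex hull {z 0, b, c}" "cross2 (b - z 0) (c - z 0) > 0" "b \<in> T" "c \<in> T"
    using ps_splitE[OF assms] .
  show "compact K" "convex K" by (simp_all add: K(1) finite_imp_compact_convex_hull)
  show ne: "interior K \<noteq> {}" unfolding K(1) using K(2) by (intro interior_triangle_nonempty) simp
  show "z 0 \<in> K" by (simp add: K(1) hull_inc)
  show "K \<subseteq> T" unfolding K(1) using K(3,4) z0_T by (intro hull_minimal convex_T) auto
  show "closure (interior K) = K"
    using convex_closure_interior[OF \<open>convex K\<close> ne] \<open>compact K\<close> by (simp add: compact_imp_closed)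
qed

lemma finite_ps_split: "finite (ps_split z)" by (simp add: ps_split_def)

lemma subtri_mem: "i \<in> I \<Longrightarrow> subtri1 z i \<in> ps_split z" "i \<in> I \<Longrightarrow> subtri2 z i \<in> ps_split z"
  by (auto simp: ps_split_def)

text \<open>Intermediate stage of the subdivision: \<open>z 0\<close> is joined to the vertices of
  \<open>T\<close>, but the edges are not yet cut at the points \<open>z (3 + i)\<close>.\<close>

definition cone where "cone i = convex hull {z 0, z (nxt i), z (prv i)}"

lemma cone_split:
  assumes "i \<in> I"
  shows "cone i = subtri1 z i \<union> subtri2 z i" "negligible (subtri1 z i \<inter> subtri2 z i)"
  using hull3_edge_split[of "z (nxt i)" "z 0" "z (prv i)" "m i"] cross_cone[OF assms]
    open_closed_segment[OF m_segment[OF assms]]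
  by (simp_all add: cone_def subtri1_def subtri2_def)

lemma T_cones:
  "T = cone 1 \<union> cone 2 \<union> cone 3"
  "cone 1 \<inter> cone 2 = closed_segment (z 0) (z 3)"
  "cone 2 \<inter> cone 3 = closed_segment (z 0) (z 1)"
  "cone 3 \<inter> cone 1 = closed_segment (z 0) (z 2)"
  using hull3_point_split[of "z 2" "z 1" "z 3" "z 0"] cross_T z0_T
  by (simp_all add: cone_def tri_def)

lemma T_Union: "T = \<Union>(ps_split z)"
  unfolding T_cones(1) using cone_split(1) by (auto simp: ps_split_def)

text \<open>Different cones meet only in segments from \<open>z 0\<close> to a vertex of
  \<open>T\<close>. If \<open>m i\<close> lay on such a segment, one of its two subtriangles would
  be degenerate.\<close>

lemma m_not_mem:
  assumes "i \<in> I" "j \<in> I" "i \<noteq> j"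
  shows "m i \<notin> cone j"
proof
  assume "m i \<in> cone j"
  moreover have "m i \<in> cone i"
    unfolding cone_split(1)[OF assms(1)] by (simp add: subtri1_def hull_inc)
  ultimately have "m i \<in> cone i \<inter> cone j" by blast
  also have "cone i \<inter> cone j \<subseteq> closed_segment (z 0) (z (nxt i)) \<union> closed_segment (z 0) (z (prv i))"
    using assms T_cones(2-4) by (auto simp: Int_commute)
  finally consider "m i \<in> closed_segment (z 0) (z (nxt i))" | "m i \<in> closed_segment (z 0) (z (prv i))" by blast
  then show False
  proof cases
    case 1
    then obtain t where "m i - z 0 = t *\<^sub>R (z (nxt i) - z 0)" by (auto simp: in_segment algebra_simps)
    then show False using cross_sub(1)[OF assms(1)] by (simp add: cross2_def)
  next
    case 2
    then obtain t where "m i - z 0 = t *\<^sub>R (z (prv i) - z 0)" by (auto simp: in_segment algebra_simps)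
    then show False using cross_sub(2)[OF assms(1)] by (simp add: cross2_def)
  qed
qed

lemma m_mem_iff:
  assumes "i \<in> I" "K \<in> ps_split z" "m i \<in> K"
  shows "K = subtri1 z i \<or> K = subtri2 z i"
proof -
  obtain j where "j \<in> I" "K = subtri1 z j \<or> K = subtri2 z j" using assms(2) by (auto simp: ps_split_def)
  moreover from this have "m i \<in> cone j" using assms(3) cone_split(1)[of j] by blast
  ultimately show ?thesis using m_not_mem[OF assms(1), of j] by blast
qed

lemma frontier_T: "frontier T = (\<Union>i\<in>I. closed_segment (z (nxt i)) (z (prv i)))"
proof -
  have "frontier T = closed_segment (z 1) (z 2) \<union> closed_segment (z 2) (z 3) \<union> closed_segment (z 3) (z 1)"
    unfolding tri_def by (rule frontier_of_triangle) simp
  then show ?thesis by auto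
qed

lemma edge_halves:
  "i \<in> I \<Longrightarrow> closed_segment (z (nxt i)) (z (prv i))
     = closed_segment (z (nxt i)) (m i) \<union> closed_segment (m i) (z (prv i))"
  using Un_closed_segment[of "m i"] open_closed_segment[OF m_segment] by blast

section \<open>Piecewise continuous functions, jumps and the piecewise divergence\<close>

lemma negligible_interfaces: "negligible (T - (\<Union>K\<in>ps_split z. interior K))"
proof (rule negligible_subset)
  show "negligible (\<Union>K\<in>ps_split z. frontier K)"
    using finite_ps_split ps_split_facts(2)
    by (intro negligible_Union) (auto intro: negligible_convex_frontier)
  show "T - (\<Union>K\<in>ps_split z. interior K) \<subseteq> (\<Union>K\<in>ps_split z. frontier K)"
    unfolding T_Union frontier_def using closure_subset by fastforce
qed

lemma interior_subset_T: "K \<in> ps_split z \<Longrightarrow> interior K \<subseteq> interior T"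
  using ps_split_facts(5) interior_mono by blast

text \<open>Cones overlap in segments and the halves of a cone in a null set. The sum is indexed by
  edges of \<open>T\<close> because the boundary fluxes will be summed in that way.\<close>

lemma integral_split:
  fixes f :: "real^2 \<Rightarrow> real"
  assumes "\<And>K. K \<in> ps_split z \<Longrightarrow> f integrable_on K"
  shows "f integrable_on T"
    "integral T f = (\<Sum>i\<in>I. integral (subtri1 z i) f + integral (subtri2 z i) f)"
proof -
  have c: "(f has_integral integral (subtri1 z i) f + integral (subtri2 z i) f) (cone i)" if "i \<in> I" for i
    unfolding cone_split(1)[OF that] using assms subtri_mem that
    by (intro has_integral_Un cone_split(2) integrable_integral) auto
  have n: "negligible ((cone 1 \<union> cone 2) \<inter> cone 3)"
  proof -
    have "cone 1 \<inter> cone 3 = closed_segment (z 0) (z 2)" using T_cones(4) by blast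
    then have "(cone 1 \<union> cone 2) \<inter> cone 3 = closed_segment (z 0) (z 2) \<union> closed_segment (z 0) (z 1)"
      by (simp only: Int_Un_distrib2 T_cones(3))
    then show ?thesis by (simp only: negligible_Un negligible_segment)
  qed
  have "(f has_integral (\<Sum>i\<in>I. integral (subtri1 z i) f + integral (subtri2 z i) f)) T"
  proof -
    have "negligible (cone 1 \<inter> cone 2)" unfolding T_cones(2) by (rule negligible_segment)
    from has_integral_Un[OF has_integral_Un[OF c[of 1] c[of 2] this] c[of 3] n] show ?thesis
      by (simp add: T_cones(1) add.assoc)
  qed
  then show "f integrable_on T"
    "integral T f = (\<Sum>i\<in>I. integral (subtri1 z i) f + integral (subtri2 z i) f)"
    by (blast, rule integral_unique)
qed


text \<open>Values on the interfaces are left free: the divergence of a piecewise smooth field has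
  no meaningful value there.\<close>

definition pw_cont where
  "pw_cont f \<longleftrightarrow> (\<forall>K\<in>ps_split z. \<exists>g::real^2 \<Rightarrow> real. continuous_on K g \<and> (\<forall>x\<in>interior K. f x = g x))"

lemma pw_cont_binop:
  assumes "pw_cont f" "pw_cont g"
    and op: "\<And>(K :: (real^2) set) u v. continuous_on K u \<Longrightarrow> continuous_on K v \<Longrightarrow> continuous_on K (\<lambda>x. h (u x) (v x) :: real)"
  shows "pw_cont (\<lambda>x. h (f x) (g x))"
  unfolding pw_cont_def
proof
  fix K assume K: "K \<in> ps_split z"
  obtain u v where "continuous_on K u" "continuous_on K v"
    "\<forall>x\<in>interior K. f x = u x" "\<forall>x\<in>interior K. g x = v x"
    using assms(1,2) K unfolding pw_cont_def by metis
  then show "\<exists>w. continuous_on K w \<and> (\<forall>x\<in>interior K. h (f x) (g x) = w x)"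
    using op[of K u v] by (intro exI[of _ "\<lambda>x. h (u x) (v x)"]) simp
qed

lemma pw_cont_add: "pw_cont f \<Longrightarrow> pw_cont g \<Longrightarrow> pw_cont (\<lambda>x. f x + g x)"
  by (rule pw_cont_binop) (auto intro: continuous_on_add)

lemma pw_cont_mult: "pw_cont f \<Longrightarrow> pw_cont g \<Longrightarrow> pw_cont (\<lambda>x. f x * g x)"
  by (rule pw_cont_binop) (auto intro: continuous_on_mult)

lemma integrable_on_spike_interior:
  fixes f g :: "real^2 \<Rightarrow> real"
  assumes "K \<in> ps_split z" "continuous_on K g" "\<And>x. x \<in> interior K \<Longrightarrow> f x = g x"
  shows "f integrable_on K" "integral K f = integral K g"
proof -
  have n: "negligible (frontier K)" using ps_split_facts(2)[OF assms(1)] by (rule negligible_convex_frontier)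
  have eq: "f x = g x" if "x \<in> K - frontier K" for x
    using that assms(3) closure_subset by (auto simp: frontier_def)
  have "g integrable_on K"
    using ps_split_facts(1)[OF assms(1)] assms(2) by (rule integrable_continuous_compact)
  then show "f integrable_on K" using n eq by (rule integrable_spike)
  show "integral K f = integral K g" using n eq by (metis integral_spike)
qed

lemma pw_cont_integrable:
  assumes "pw_cont f"
  shows "K \<in> ps_split z \<Longrightarrow> f integrable_on K" "f integrable_on T"
proof -
  show *: "f integrable_on K" if "K \<in> ps_split z" for K
    using assms that integrable_on_spike_interior(1) unfolding pw_cont_def by metis
  show "f integrable_on T" by (rule integral_split(1)[OF *])
qed

lemma at_within_interior_nontrivial:
  assumes "K \<in> ps_split z" "x \<in> K"
  shows "at x within interior K \<noteq> bot"
proof -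
  have "x \<in> closure (interior K)" using ps_split_facts(6) assms by simp
  then have "x islimpt interior K"
    using interior_limit_point[of x "interior K"] by (auto simp: closure_def)
  then show ?thesis using trivial_limit_within by blast
qed

lemma trace_on_eq:
  assumes K: "K \<in> ps_split z" "x \<in> K" and g: "continuous_on K g" "\<And>y. y \<in> interior K \<Longrightarrow> q y = g y"
  shows "(q \<longlongrightarrow> g x) (at x within interior K)" "trace_on K q x = g x"
proof -
  have "(g \<longlongrightarrow> g x) (at x within interior K)"
    using g(1) K(2) interior_subset tendsto_within_subset unfolding continuous_on_def by metis
  then show *: "(q \<longlongrightarrow> g x) (at x within interior K)"
    by (rule Lim_transform_within[OF _ zero_less_one]) (simp add: g(2))
  show "trace_on K q x = g x"
    unfolding trace_on_def using at_within_interior_nontrivial[OF K] * by (rule tendsto_Lim)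
qed

text \<open>The outward normals of the two triangles along their common spoke are opposite, so the
  sum defining the jump is a difference of traces times one normal.\<close>

lemma jump_eq:
  assumes i: "i \<in> I" and g1: "continuous_on (subtri1 z i) g1" "\<And>y. y \<in> interior (subtri1 z i) \<Longrightarrow> q y = g1 y"
    and g2: "continuous_on (subtri2 z i) g2" "\<And>y. y \<in> interior (subtri2 z i) \<Longrightarrow> q y = g2 y"
  shows "jump z q i = (g1 (m i) - g2 (m i)) *\<^sub>R outer_normal (z 0) (m i) (z (nxt i))"
proof -
  have 1: "outer_normal (z 0) (m i) (z (prv i)) = (1 / norm (m i - z 0)) *\<^sub>R rot90 (m i - z 0)"
    using outer_normal_eq[of 1 "m i" "z 0" "z (prv i)"] cross_sub(2)[OF i] by simp
  have "cross2 (m i - z 0) (z (nxt i) - z 0) < 0"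
    using cross_sub(1)[OF i] by (simp add: cross2_def algebra_simps)
  then have 2: "outer_normal (z 0) (m i) (z (nxt i)) = (- 1 / norm (m i - z 0)) *\<^sub>R rot90 (m i - z 0)"
    using outer_normal_eq[of "-1" "m i" "z 0" "z (nxt i)"] by simp
  have "m i \<in> subtri1 z i" "m i \<in> subtri2 z i" by (simp_all add: subtri1_def subtri2_def hull_inc)
  then have "trace_on (subtri1 z i) q (m i) = g1 (m i)" "trace_on (subtri2 z i) q (m i) = g2 (m i)"
    using trace_on_eq(2)[OF subtri_mem(1)[OF i] _ g1] trace_on_eq(2)[OF subtri_mem(2)[OF i] _ g2] by blast+
  then show ?thesis unfolding jump_def 1 2 by (simp add: algebra_simps diff_divide_distrib)
qed

lemma jump_normal_nonzero:
  assumes "i \<in> I"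
  shows "outer_normal (z 0) (m i) (z (nxt i)) \<noteq> 0"
proof -
  have "cross2 (m i - z 0) (z (nxt i) - z 0) < 0"
    using cross_sub(1)[OF assms] by (simp add: cross2_def algebra_simps)
  then have 2: "outer_normal (z 0) (m i) (z (nxt i)) = (- 1 / norm (m i - z 0)) *\<^sub>R rot90 (m i - z 0)"
    using outer_normal_eq[of "-1" "m i" "z 0" "z (nxt i)"] by simp
  moreover have "m i - z 0 \<noteq> 0" using cross_sub(1)[OF assms] by (auto simp: cross2_def)
  ultimately show ?thesis using norm_rot90[of "m i - z 0"] by auto
qed

text \<open>\<open>pd\<close> rests on a chosen derivative. Since \<open>T\<close> is convex with
  nonempty interior, a derivative within \<open>T\<close> is unique even at boundary points, so the
  choice is forced.\<close>

lemma pd_eq: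
  assumes "x \<in> T" "(f has_derivative (\<lambda>h. G \<bullet> h)) (at x within T)"
  shows "pd T f j x = G $ j"
proof -
  have "(f has_derivative frechet_derivative f (at x within T)) (at x within T)"
    by (rule frechet_derivative_works[THEN iffD1, OF differentiableI[OF assms(2)]])
  from has_derivative_within_convex_unique[OF convex_T interior_T assms(1) this assms(2)]
  show ?thesis by (simp add: pd_def inner_axis)
qed

lemma grad_eq:
  assumes "x \<in> T" "(f has_derivative (\<lambda>h. G \<bullet> h)) (at x within T)"
  shows "grad T f x = G" "rot T f x = rot90 G"
  using pd_eq[OF assms] by (simp_all add: grad_def rot_def rot90_def vec_eq_iff)

lemma has_derivative_interior:
  assumes "K \<in> ps_split z" "x \<in> interior K" "(f has_derivative D) (at x within K)"
  shows "(f has_derivative D) (at x within T)"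
proof -
  have "x \<in> interior T" using assms(2) interior_subset_T[OF assms(1)] by (rule rev_subsetD)
  then show ?thesis using assms(3) by (simp only: at_within_interior[OF assms(2)] at_within_interior)
qed

lemma interior_mem_T: "K \<in> ps_split z \<Longrightarrow> x \<in> interior K \<Longrightarrow> x \<in> T"
  using ps_split_facts(5) interior_subset by blast

definition pw_C1 where
  "pw_C1 v \<longleftrightarrow> (\<forall>K\<in>ps_split z. \<exists>G. \<forall>j. C1_on K (\<lambda>x. (v x :: real^2) $ j) (G j))"

lemma divg_interior:
  assumes "K \<in> ps_split z" "\<And>j. C1_on K (\<lambda>x. v x $ j) (G j)" "x \<in> interior K"
  shows "divg T v x = G 1 x $ 1 + G 2 x $ 2"
proof -
  have "x \<in> K" using assms(3) interior_subset by blast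
  then have "((\<lambda>x. v x $ j) has_derivative (\<lambda>h. G j x \<bullet> h)) (at x within T)" for j
    using assms(2)[of j] by (intro has_derivative_interior[OF assms(1,3)]) (simp add: C1_on_def)
  then have "pd T (\<lambda>x. v x $ j) j x = G j x $ j" for j
    using pd_eq[OF interior_mem_T[OF assms(1,3)]] by blast
  then show ?thesis by (simp add: divg_def sum_2)
qed

lemma div_continuous:
  assumes "\<And>j. C1_on K (\<lambda>x. v x $ j) (G j)"
  shows "continuous_on K (\<lambda>x. G 1 x $ 1 + G (2::2) x $ (2::2))"
  using assms[of 1] assms[of 2] by (auto simp: C1_on_def intro!: continuous_intros)

lemma pw_C1_divg: "pw_C1 v \<Longrightarrow> pw_cont (divg T v)"
  unfolding pw_cont_def
proof
  fix K assume v: "pw_C1 v" and K: "K \<in> ps_split z"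
  obtain G where G: "\<And>j. C1_on K (\<lambda>x. v x $ j) (G j)" using v K unfolding pw_C1_def by blast
  show "\<exists>g. continuous_on K g \<and> (\<forall>x\<in>interior K. divg T v x = g x)"
    using div_continuous[OF G] divg_interior[OF K G] by (intro exI conjI ballI)
qed

text \<open>The divergence theorem holds on each subtriangle, and continuity of \<open>v\<close>
  across interfaces is implicit in its being one function: the flux through a spoke is the same from
  both sides up to sign.\<close>

lemma divergence_T:
  assumes v: "pw_C1 v"
  shows "integral T (divg T v) = (\<Sum>i\<in>I. flux v (z (nxt i)) (m i) + flux v (m i) (z (prv i)))"
proof -
  have 0: "integral (convex hull {z 0, b, c}) (divg T v) = flux v (z 0) b + flux v b c + flux v c (z 0)"
    if K: "convex hull {z 0, b, c} \<in> ps_split z" and c: "cross2 (b - z 0) (c - z 0) > 0" for b c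
  proof -
    obtain G where G: "\<And>j. C1_on (convex hull {z 0, b, c}) (\<lambda>x. v x $ j) (G j)"
      using v K unfolding pw_C1_def by blast
    have "integral (convex hull {z 0, b, c}) (divg T v) =
        integral (convex hull {z 0, b, c}) (\<lambda>x. G 1 x $ 1 + G 2 x $ 2)"
      by (rule integrable_on_spike_interior(2)[OF K div_continuous[OF G] divg_interior[OF K G]])
    then show ?thesis using divergence_triangle[OF c G] by (rule trans)
  qed
  have 1: "integral (subtri1 z i) (divg T v) = flux v (z 0) (z (nxt i)) + flux v (z (nxt i)) (m i) + flux v (m i) (z 0)"
    if "i \<in> I" for i
    using 0[of "z (nxt i)" "m i"] cross_sub(1)[OF that] subtri_mem(1)[OF that] by (simp add: subtri1_def)
  have 2: "integral (subtri2 z i) (divg T v) = flux v (z 0) (m i) + flux v (m i) (z (prv i)) + flux v (z (prv i)) (z 0)"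
    if "i \<in> I" for i
    using 0[of "m i" "z (prv i)"] cross_sub(2)[OF that] subtri_mem(2)[OF that] by (simp add: subtri2_def)
  have "integral T (divg T v) = (\<Sum>i\<in>I. integral (subtri1 z i) (divg T v) + integral (subtri2 z i) (divg T v))"
    using pw_cont_integrable(1)[OF pw_C1_divg[OF v]] by (rule integral_split(2))
  \<comment> \<open>The spoke to \<open>m i\<close> cancels within its cone; the spokes to the
    vertices cancel between neighbouring cones, as \<open>nxt\<close> and \<open>prv\<close> both
    run through all three indices.\<close>
  also have "\<dots> = (\<Sum>i\<in>I. flux v (z (nxt i)) (m i) + flux v (m i) (z (prv i))
      + (flux v (z 0) (z (nxt i)) - flux v (z 0) (z (prv i))))"
    by (rule sum.cong) (simp_all add: 1 2 flux_reverse[of v _ "z 0"])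
  also have "\<dots> = (\<Sum>i\<in>I. flux v (z (nxt i)) (m i) + flux v (m i) (z (prv i)))"
    by simp
  finally show ?thesis .
qed

end

section \<open>Integrals along edges\<close>

lemma tendsto_within_finite_Union:
  assumes "finite F" "\<And>S. S \<in> F \<Longrightarrow> (f \<longlongrightarrow> l) (at x within S)"
  shows "(f \<longlongrightarrow> l) (at x within \<Union>F)"
  using assms by (induction F) (auto simp: Lim_Un)

lemma at_within_closed_eq_bot:
  assumes "closed S" "x \<notin> S"
  shows "at x within S = bot"
  using assms by (metis closed_limpt trivial_limit_within)

lemma integral_affine_interval:
  fixes f :: "real \<Rightarrow> real"
  assumes "c > 0" "f integrable_on {d..d + c}"
  shows "integral {d..d + c} f = c * integral {0..1} (\<lambda>s. f (d + c * s))"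
proof -
  have "(f has_integral integral {d..d + c} f) (cbox d (d + c))"
    using assms(2) by (simp add: integrable_integral)
  from has_integral_affinity[OF this, of c d] assms(1)
  have "((\<lambda>x. f (c * x + d)) has_integral (1 / c) * integral {d..d + c} f)
      ((\<lambda>x. (1 / c) * x - d / c) ` {d..d + c})"
    by (simp add: divide_inverse mult.commute)
  moreover have "(\<lambda>x. (1 / c) * x - d / c) ` {d..d + c} = {0..1}"
    using image_affinity_atLeastAtMost_diff[of "1 / c" "d / c" d "d + c"] assms(1)
    by (simp add: field_simps)
  ultimately have "((\<lambda>x. f (d + c * x)) has_integral (1 / c) * integral {d..d + c} f) {0..1}"
    by (simp add: add.commute)
  then show ?thesis using assms(1) by (auto dest!: integral_unique)
qed

text \<open>Relates the degree of freedom on a whole edge, present in lowest degree, to the two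
  boundary edges of the split.\<close>

lemma edge_integral_split:
  assumes m: "m \<in> open_segment a b" and f: "continuous_on (closed_segment a b) f"
  shows "edge_integral a b f = edge_integral a m f + edge_integral m b f"
proof -
  obtain u where u: "0 < u" "u < 1" "m = (1 - u) *\<^sub>R a + u *\<^sub>R b"
    using m by (auto simp: in_segment)
  let ?g = "\<lambda>s. f (linepath a b s)"
  have c: "continuous_on {0..1} ?g"
    by (rule continuous_on_compose2[OF f continuous_on_linepath]) (auto simp: linepath_in_path)
  have i: "?g integrable_on {0..1}" using c by (rule integrable_continuous_real)
  have "integral {0..1} ?g = integral {0..u} ?g + integral {u..1} ?g"
    using Henstock_Kurzweil_Integration.integral_combine[of 0 u 1 ?g] u i by simp
  also have "integral {0..u} ?g = u * integral {0..1} (\<lambda>s. f (linepath a m s))"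
  proof -
    have "?g integrable_on {0..0 + u}" using u by (auto intro: integrable_subinterval_real[OF i])
    from integral_affine_interval[OF u(1) this]
    have "integral {0..u} ?g = u * integral {0..1} (\<lambda>s. ?g (u * s))" by simp
    moreover have "linepath a b (u * s) = linepath a m s" for s
      unfolding u(3) by (simp add: linepath_def algebra_simps)
    ultimately show ?thesis by simp
  qed
  also have "integral {u..1} ?g = (1 - u) * integral {0..1} (\<lambda>s. f (linepath m b s))"
  proof -
    have "?g integrable_on {u..u + (1 - u)}" using u by (auto intro: integrable_subinterval_real[OF i])
    then have "integral {u..1} ?g = (1 - u) * integral {0..1} (\<lambda>s. ?g (u + (1 - u) * s))"
      using integral_affine_interval[of "1 - u" ?g u] u by simp
    moreover have "linepath a b (u + (1 - u) * s) = linepath m b s" for s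
      unfolding u(3) by (simp add: linepath_def algebra_simps)
    ultimately show ?thesis by simp
  qed
  finally have "edge_integral a b f = norm (b - a) * (u * integral {0..1} (\<lambda>s. f (linepath a m s))
      + (1 - u) * integral {0..1} (\<lambda>s. f (linepath m b s)))"
    by (simp add: edge_integral_def)
  moreover have "edge_integral a m f = norm (b - a) * (u * integral {0..1} (\<lambda>s. f (linepath a m s)))"
  proof -
    have "m - a = u *\<^sub>R (b - a)" unfolding u(3) by (simp add: algebra_simps)
    then show ?thesis using u by (simp add: edge_integral_def)
  qed
  moreover have "edge_integral m b f = norm (b - a) * ((1 - u) * integral {0..1} (\<lambda>s. f (linepath m b s)))"
  proof -
    have "b - m = (1 - u) *\<^sub>R (b - a)" unfolding u(3) by (simp add: algebra_simps)
    then show ?thesis using u by (simp add: edge_integral_def)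
  qed
  ultimately show ?thesis by (simp only: distrib_left)
qed

lemma polys_1_affine:
  assumes "p \<in> polys 1"
  shows "\<exists>c d. \<forall>x. p x = c + d \<bullet> x"
  using assms
proof (induction rule: polys_induct)
  case zero
  show ?case by (intro exI[of _ 0]) simp
next
  case (monom c a b)
  then consider "a = 0" "b = 0" | "a = 1" "b = 0" | "a = 0" "b = 1" by linarith
  then show ?case
  proof cases
    case 1
    then show ?thesis by (intro exI[of _ c] exI[of _ 0]) simp
  next
    case 2
    then show ?thesis by (intro exI[of _ 0] exI[of _ "vector [c, 0]"]) (simp add: inner2)
  next
    case 3
    then show ?thesis by (intro exI[of _ 0] exI[of _ "vector [0, c]"]) (simp add: inner2)
  qed
next
  case (add p q)
  then obtain c d c' d' where "\<forall>x. p x = c + d \<bullet> x" "\<forall>x. q x = c' + d' \<bullet> x" by metis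
  then show ?case by (intro exI[of _ "c + c'"] exI[of _ "d + d'"]) (simp add: inner_add_left)
qed

text \<open>Exactness of the trapezoidal rule for affine functions. In lowest degree it recovers the
  normal component at \<open>z (3 + i)\<close> from the flux through the edge.\<close>

lemma edge_integral_polys_1:
  assumes "p \<in> polys 1"
  shows "edge_integral a b p = norm (b - a) * (p a + p b) / 2"
proof -
  obtain c d where p: "\<And>x. p x = c + d \<bullet> x" using polys_1_affine[OF assms] by blast
  have "((\<lambda>s. p a + s * (p b - p a)) has_integral (p a + p b) / 2) {0..1}"
  proof -
    have "((\<lambda>s. p a + s * (p b - p a)) has_integral
        ((\<lambda>s. p a * s + s\<^sup>2 / 2 * (p b - p a)) 1 - (\<lambda>s. p a * s + s\<^sup>2 / 2 * (p b - p a)) 0)) {0..1}"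
      by (rule fundamental_theorem_of_calculus)
        (auto intro!: derivative_eq_intros simp: has_real_derivative_iff_has_vector_derivative[symmetric])
    then show ?thesis by (simp add: field_simps)
  qed
  moreover have "p (linepath a b s) = p a + s * (p b - p a)" for s
    by (simp add: p linepath_def inner_add_right inner_diff_right algebra_simps)
  ultimately show ?thesis by (simp add: edge_integral_def integral_unique)
qed

lemma linepath_integral_nonneg_eq_0:
  fixes g :: "real^2 \<Rightarrow> real"
  assumes "continuous_on (closed_segment a b) g" "integral {0..1} (\<lambda>s. (g (linepath a b s))\<^sup>2) = 0"
    "x \<in> closed_segment a b"
  shows "g x = 0"
proof -
  have c: "continuous_on {0..1} (\<lambda>s. (g (linepath a b s))\<^sup>2)"
    by (intro continuous_on_power continuous_on_compose2[OF assms(1) continuous_on_linepath])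
      (auto simp: linepath_in_path)
  obtain s where s: "s \<in> {0..1}" "x = linepath a b s"
    using assms(3) by (metis path_image_def path_image_linepath image_iff)
  have "((\<lambda>s. (g (linepath a b s))\<^sup>2) has_integral 0) (cbox 0 1)"
    using integrable_integral[OF integrable_continuous_real[OF c]] assms(2) by simp
  then have "(g (linepath a b s))\<^sup>2 = 0"
    using c s by (intro has_integral_0_cbox_imp_0[of 0 1 "\<lambda>s. (g (linepath a b s))\<^sup>2"]) auto
  then show ?thesis using s by simp
qed

text \<open>Integration by parts along the edge: \<open>\<integral> (p')\<^sup>2 = [p p'] - \<integral> p p''\<close>, and the last integral
  vanishes because the second derivative has degree at most \<open>k - 2\<close>.\<close>

lemma edge_energy:
  assumes p: "p \<in> polys k" and G: "G \<in> polys_vec (k - 1)" "C1_on UNIV p G" and ab: "a \<noteq> b"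
    and orth: "\<And>h. h \<in> polys (k - 2) \<Longrightarrow> edge_integral a b (\<lambda>x. p x * h x) = 0"
  shows "p a * (G a \<bullet> (b - a)) \<le> p b * (G b \<bullet> (b - a))"
    and "p a * (G a \<bullet> (b - a)) = p b * (G b \<bullet> (b - a)) \<Longrightarrow> x \<in> closed_segment a b \<Longrightarrow> p x = p a"
proof -
  define u where "u = b - a"
  define g where "g = (\<lambda>x. G x \<bullet> u)"
  have g: "g \<in> polys (k - 1)" unfolding g_def using G(1) by (rule polys_vec_inner)
  obtain H where H: "H \<in> polys_vec (k - 1 - 1)" "\<And>S. C1_on S g H" using polys_C1[OF g] by blast
  \<comment> \<open>Along the edge, \<open>g\<close> and \<open>h\<close> are the first and second
    derivatives of \<open>p\<close> in the parameter of \<open>linepath a b\<close>. For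
    \<open>k \<le> 1\<close> the degree bound is negative and \<open>h\<close> is zero.\<close>
  define h where "h = (\<lambda>x. H x \<bullet> u)"
  have h: "h \<in> polys (k - 2)" using polys_vec_inner[OF H(1), of u] by (simp add: h_def)
  have cp: "continuous_on UNIV p" and cg: "continuous_on UNIV g" and ch: "continuous_on UNIV h"
    using p g h by (auto intro: polys_continuous)
  have C: "C1_on UNIV (\<lambda>x. p x * g x) (\<lambda>x. g x *\<^sub>R G x + p x *\<^sub>R H x)"
    unfolding C1_on_def
  proof (intro conjI ballI)
    show "continuous_on UNIV (\<lambda>x. g x *\<^sub>R G x + p x *\<^sub>R H x)"
      using G(2) H(2)[of UNIV] cp cg by (auto simp: C1_on_def intro!: continuous_intros)
    fix x :: "real^2"
    have "(p has_derivative (\<lambda>h. G x \<bullet> h)) (at x)" "(g has_derivative (\<lambda>h. H x \<bullet> h)) (at x)"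
      using G(2) H(2)[of UNIV] by (simp_all add: C1_on_def)
    from has_derivative_mult[OF this]
    show "((\<lambda>x. p x * g x) has_derivative (\<lambda>h. (g x *\<^sub>R G x + p x *\<^sub>R H x) \<bullet> h)) (at x within UNIV)"
      by (simp add: inner_add_left mult.commute add.commute)
  qed
  have cl: "continuous_on {0..1} (\<lambda>s. f (linepath a b s))" if "continuous_on UNIV f" for f :: "real^2 \<Rightarrow> real"
    by (rule continuous_on_compose2[OF that continuous_on_linepath]) simp
  let ?l = "linepath a b"
  have i1: "(\<lambda>s. (g (?l s))\<^sup>2) integrable_on {0..1}" and i2: "(\<lambda>s. p (?l s) * h (?l s)) integrable_on {0..1}"
    by (intro integrable_continuous_real continuous_intros cl cp cg ch)+
  have "((\<lambda>s. (g (?l s))\<^sup>2 + p (?l s) * h (?l s)) has_integral p b * g b - p a * g a) {0..1}"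
  proof -
    have "(g y *\<^sub>R G y + p y *\<^sub>R H y) \<bullet> (b - a) = (g y)\<^sup>2 + p y * h y" for y
      by (simp add: inner_add_left g_def h_def u_def power2_eq_square)
    with integral_linepath_C1[OF C, of a b] show ?thesis by simp
  qed
  then have "integral {0..1} (\<lambda>s. (g (?l s))\<^sup>2) + integral {0..1} (\<lambda>s. p (?l s) * h (?l s)) = p b * g b - p a * g a"
    using integral_add[OF i1 i2] by (simp add: integral_unique)
  moreover have "integral {0..1} (\<lambda>s. p (?l s) * h (?l s)) = 0"
    using orth[OF h] ab by (simp add: edge_integral_def)
  ultimately have E: "integral {0..1} (\<lambda>s. (g (?l s))\<^sup>2) = p b * g b - p a * g a" by simp
  have "0 \<le> integral {0..1} (\<lambda>s. (g (?l s))\<^sup>2)" using i1 by (rule integral_nonneg) simp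
  then show "p a * (G a \<bullet> (b - a)) \<le> p b * (G b \<bullet> (b - a))"
    unfolding E by (simp add: g_def u_def)
  \<comment> \<open>Equal boundary terms leave no energy, so the derivative along the edge vanishes
    and \<open>p\<close> is constant there.\<close>
  assume "p a * (G a \<bullet> (b - a)) = p b * (G b \<bullet> (b - a))" and x: "x \<in> closed_segment a b"
  then have "integral {0..1} (\<lambda>s. (g (?l s))\<^sup>2) = 0" unfolding E by (simp add: g_def u_def)
  then have g0: "g y = 0" if "y \<in> closed_segment a b" for y
    using that by (rule linepath_integral_nonneg_eq_0[OF continuous_on_subset[OF cg subset_UNIV]])
  obtain t where t: "x - a = t *\<^sub>R u" "closed_segment a x \<subseteq> closed_segment a b"
  proof -
    obtain t where "x = (1 - t) *\<^sub>R a + t *\<^sub>R b" using x by (auto simp: in_segment)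
    then have "x - a = t *\<^sub>R u" by (simp add: u_def algebra_simps)
    moreover have "closed_segment a x \<subseteq> closed_segment a b"
      using x by (simp add: subset_closed_segment)
    ultimately show thesis by (rule that)
  qed
  have "G (linepath a x s) \<bullet> (x - a) = 0" if "s \<in> {0..1}" for s
  proof -
    have "linepath a x s \<in> closed_segment a b" using t(2) that linepath_in_path by blast
    from g0[OF this] show ?thesis by (simp add: t(1) g_def)
  qed
  then have "((\<lambda>s. G (linepath a x s) \<bullet> (x - a)) has_integral 0) {0..1}" by (rule has_integral_is_0)
  from has_integral_unique[OF integral_linepath_C1[OF G(2), of a x] this] show "p x = p a" by simp
qed

section \<open>The discrete spaces\<close>

context powell_sabin_split
begin

text \<open>Both halves point in the direction of the full edge, so they share its unit tangent and
  outward normal.\<close>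

lemma half_edge_dir:
  assumes "i \<in> I" "(a, b) \<in> half_edges z i"
  obtains c where "c > 0" "b - a = c *\<^sub>R (z (prv i) - z (nxt i))"
proof -
  obtain u where "0 < u" "u < 1" "m i - z (nxt i) = u *\<^sub>R (z (prv i) - z (nxt i))"
    "z (prv i) - m i = (1 - u) *\<^sub>R (z (prv i) - z (nxt i))" using m_param[OF assms(1)] .
  then show thesis using assms(2) that[of u] that[of "1 - u"] by (auto simp: half_edges_def)
qed

lemma nrm_eq:
  assumes "i \<in> I"
  shows "nrm z i = (1 / norm (z (prv i) - z (nxt i))) *\<^sub>R rot90 (z (prv i) - z (nxt i))"
    and "z (prv i) - z (nxt i) \<noteq> 0"
proof -
  have c: "cross2 (z (prv i) - z (nxt i)) (z i - z (nxt i)) > 0"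
    using cross_rotate[OF assms] by (simp add: cross2_def algebra_simps)
  then show "nrm z i = (1 / norm (z (prv i) - z (nxt i))) *\<^sub>R rot90 (z (prv i) - z (nxt i))"
    using outer_normal_eq[of 1] by (simp add: nrm_def)
  show "z (prv i) - z (nxt i) \<noteq> 0" using c by (auto simp: cross2_def)
qed

lemma half_edge_ne:
  assumes "i \<in> I" "(a, b) \<in> half_edges z i"
  shows "a \<noteq> b"
proof -
  obtain c where "c > 0" "b - a = c *\<^sub>R (z (prv i) - z (nxt i))" using half_edge_dir[OF assms] .
  then show ?thesis using nrm_eq(2)[OF assms(1)] by auto
qed

lemma flux_half_edge:
  assumes "i \<in> I" "(a, b) \<in> half_edges z i"
  shows "flux v a b = edge_integral a b (\<lambda>x. v x \<bullet> nrm z i)"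
proof -
  define u where "u = z (prv i) - z (nxt i)"
  obtain c where c: "c > 0" "b - a = c *\<^sub>R u" using half_edge_dir[OF assms] unfolding u_def .
  have u0: "norm u \<noteq> 0" using nrm_eq(2)[OF assms(1)] by (simp add: u_def)
  have "cross2 x (b - a) = norm (b - a) * (x \<bullet> nrm z i)" for x
  proof -
    have "cross2 x (b - a) = c * (x \<bullet> rot90 u)" unfolding inner_rot90 c(2) by (simp add: cross2_def algebra_simps)
    also have "\<dots> = norm (b - a) * (x \<bullet> nrm z i)"
      unfolding nrm_eq(1)[OF assms(1)] u_def[symmetric] c(2) using c(1) u0 by simp
    finally show ?thesis .
  qed
  then show ?thesis by (simp add: flux_def edge_integral_def)
qed

lemma divergence_T_edges:
  assumes "pw_C1 v"
  shows "integral T (divg T v) = (\<Sum>i\<in>I. edge_integral (z (nxt i)) (m i) (\<lambda>x. v x \<bullet> nrm z i)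
      + edge_integral (m i) (z (prv i)) (\<lambda>x. v x \<bullet> nrm z i))"
  unfolding divergence_T[OF assms]
  by (rule sum.cong) (simp_all add: flux_half_edge half_edges_def)

lemma edge_subset_T: "i \<in> I \<Longrightarrow> closed_segment (z (nxt i)) (z (prv i)) \<subseteq> T"
  using frontier_T compact_T compact_imp_closed frontier_subset_closed by blast

section \<open>Structure of the piecewise polynomial spaces\<close>

lemma V2_pw_cont: "q \<in> V2 z k \<Longrightarrow> pw_cont q"
  unfolding V2_def pw_cont_def mem_Collect_eq by (meson polys_continuous)

lemma V2_diff:
  assumes "p \<in> V2 z k" "q \<in> V2 z k"
  shows "(\<lambda>x. p x - q x) \<in> V2 z k"
  unfolding V2_def mem_Collect_eq
proof
  fix K assume "K \<in> ps_split z"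
  then obtain P Q where "P \<in> polys k" "Q \<in> polys k"
    "\<forall>x\<in>interior K. p x = P x" "\<forall>x\<in>interior K. q x = Q x"
    using assms unfolding V2_def by blast
  then show "\<exists>R\<in>polys k. \<forall>x\<in>interior K. p x - q x = R x"
    by (intro bexI[of _ "\<lambda>x. P x - Q x"]) (auto intro: polys_diff)
qed

lemma V2_jump:
  assumes "q \<in> V2 z k" "i \<in> I"
  obtains g1 g2 where "g1 \<in> polys k" "g2 \<in> polys k"
    "\<And>x. x \<in> interior (subtri1 z i) \<Longrightarrow> q x = g1 x" "\<And>x. x \<in> interior (subtri2 z i) \<Longrightarrow> q x = g2 x"
    "jump z q i = (g1 (m i) - g2 (m i)) *\<^sub>R outer_normal (z 0) (m i) (z (nxt i))"
proof -
  obtain g1 g2 where g: "g1 \<in> polys k" "g2 \<in> polys k"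
    "\<forall>x\<in>interior (subtri1 z i). q x = g1 x" "\<forall>x\<in>interior (subtri2 z i). q x = g2 x"
    using assms(1) subtri_mem[OF assms(2)] unfolding V2_def by blast
  then have "jump z q i = (g1 (m i) - g2 (m i)) *\<^sub>R outer_normal (z 0) (m i) (z (nxt i))"
    by (intro jump_eq[OF assms(2)] polys_continuous[OF g(1)] polys_continuous[OF g(2)]) auto
  with g show thesis by (intro that) auto
qed

text \<open>A zero jump equates the two polynomial values at \<open>z (3 + i)\<close>, because the
  common normal is nonzero. The remaining triangles are closed and do not contain this point, so
  they do not affect the limit.\<close>

lemma V2_ringI:
  assumes q: "q \<in> V2 z k" and j: "\<And>i. i \<in> I \<Longrightarrow> jump z q i = 0" and int: "integral T q = 0"
  shows "q \<in> V2_ring z k"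
proof -
  have "\<exists>l. (q \<longlongrightarrow> l) (at (m i) within (\<Union>K\<in>ps_split z. interior K))" if i: "i \<in> I" for i
  proof -
    obtain g1 g2 where g: "g1 \<in> polys k" "g2 \<in> polys k"
      "\<And>x. x \<in> interior (subtri1 z i) \<Longrightarrow> q x = g1 x" "\<And>x. x \<in> interior (subtri2 z i) \<Longrightarrow> q x = g2 x"
      "jump z q i = (g1 (m i) - g2 (m i)) *\<^sub>R outer_normal (z 0) (m i) (z (nxt i))"
      using V2_jump[OF q i] by blast
    have eq: "g1 (m i) = g2 (m i)" using g(5) j[OF i] jump_normal_nonzero[OF i] by simp
    have mm: "m i \<in> subtri1 z i" "m i \<in> subtri2 z i" by (simp_all add: subtri1_def subtri2_def hull_inc)
    have "(q \<longlongrightarrow> g1 (m i)) (at (m i) within interior K)" if K: "K \<in> ps_split z" for K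
    proof (cases "m i \<in> K")
      case True
      then consider "K = subtri1 z i" | "K = subtri2 z i" using m_mem_iff[OF i K] by blast
      then show ?thesis
      proof cases
        case 1
        show ?thesis unfolding 1
          by (rule trace_on_eq(1)[OF subtri_mem(1)[OF i] mm(1) polys_continuous[OF g(1)] g(3)])
      next
        case 2
        show ?thesis unfolding 2 eq
          by (rule trace_on_eq(1)[OF subtri_mem(2)[OF i] mm(2) polys_continuous[OF g(2)] g(4)])
      qed
    next
      case False
      have "at (m i) within K = bot"
        using False ps_split_facts(1)[OF K] by (intro at_within_closed_eq_bot) (simp add: compact_imp_closed)
      then have "(q \<longlongrightarrow> g1 (m i)) (at (m i) within K)" by simp
      then show ?thesis by (rule tendsto_within_subset[OF _ interior_subset])
    qed
    then have "(q \<longlongrightarrow> g1 (m i)) (at (m i) within \<Union>(interior ` ps_split z))"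
      by (intro tendsto_within_finite_Union) (auto simp: finite_ps_split)
    then show ?thesis by blast
  qed
  then show ?thesis using q int unfolding V2_ring_def by blast
qed

lemma T_lebesgue: "T \<in> sets lebesgue"
  using compact_T by (simp add: lmeasurable_compact fmeasurableD)

text \<open>The conclusion is an almost everywhere statement because members of \<open>V2\<close>
  are unconstrained on the interfaces.\<close>

lemma V2_eq_0:
  assumes "q \<in> V2 z k" "\<And>i. i \<in> I \<Longrightarrow> jump z q i = 0" "integral T q = 0"
    and orth: "\<And>p. p \<in> V2_ring z k \<Longrightarrow> integral T (\<lambda>x. q x * p x) = 0"
  shows "negligible {x \<in> T. q x \<noteq> 0}"
proof -
  have 0: "integral T (\<lambda>x. q x * q x) = 0" by (rule orth[OF V2_ringI[OF assms(1-3)]])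
  have i: "(\<lambda>x. q x * q x) integrable_on T"
    by (intro pw_cont_integrable(2) pw_cont_mult V2_pw_cont[OF assms(1)])
  have "negligible {x \<in> T. q x * q x \<noteq> 0}"
    by (rule negligible_if_integral_nonneg_eq_0[OF T_lebesgue i _ 0]) simp
  then show ?thesis by (simp only: mult_eq_0_iff disj_absorb)
qed

text \<open>By continuity the polynomial representation extends from the open triangle to the closed
  one, which is the closure of its interior.\<close>

lemma L0_piece:
  assumes "q \<in> L0 z k" "K \<in> ps_split z"
  obtains p where "p \<in> polys k" "\<And>x. x \<in> K \<Longrightarrow> q x = p x"
proof -
  obtain p where p: "p \<in> polys k" "\<And>x. x \<in> interior K \<Longrightarrow> q x = p x"
    using assms unfolding L0_def V2_def by blast
  have "q x = p x" if x: "x \<in> K" for x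
  proof (rule tendsto_unique[OF at_within_interior_nontrivial[OF assms(2) x]])
    show "(q \<longlongrightarrow> p x) (at x within interior K)"
      by (rule trace_on_eq(1)[OF assms(2) x polys_continuous[OF p(1)] p(2)])
    have "continuous_on K q"
      using assms(1) ps_split_facts(5)[OF assms(2)] unfolding L0_def by (auto intro: continuous_on_subset)
    then show "(q \<longlongrightarrow> q x) (at x within interior K)"
      by (rule trace_on_eq(1)[OF assms(2) x]) simp
  qed
  with p(1) show thesis by (rule that)
qed

text \<open>The gradients belong to polynomials on the whole plane and can be evaluated on edges and
  at vertices, where \<open>v\<close> need not be differentiable.\<close>

lemma L1_piece:
  assumes "v \<in> L1 z k" "K \<in> ps_split z"
  obtains P G where "P \<in> polys_vec k" "\<And>x. x \<in> K \<Longrightarrow> v x = P x"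
    "\<And>j. G j \<in> polys_vec (k - 1)" "\<And>j S. C1_on S (\<lambda>x. P x $ j) (G j)"
proof -
  have "\<exists>p\<in>polys k. \<forall>x\<in>K. v x $ j = p x" for j
  proof -
    have "(\<lambda>x. v x $ j) \<in> L0 z k" using assms(1) by (simp add: L1_def)
    from L0_piece[OF this assms(2)] show ?thesis by metis
  qed
  then obtain p where "\<forall>j. p j \<in> polys k \<and> (\<forall>x\<in>K. v x $ j = p j x)" unfolding Bex_def by metis
  then have p: "\<And>j. p j \<in> polys k" "\<And>j x. x \<in> K \<Longrightarrow> v x $ j = p j x" by simp_all
  have "\<exists>G\<in>polys_vec (k - 1). \<forall>S. C1_on S (p j) G" for j
    using polys_C1[OF p(1)[of j]] by metis
  then obtain G where "\<forall>j. G j \<in> polys_vec (k - 1) \<and> (\<forall>S. C1_on S (p j) (G j))"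
    unfolding Bex_def by metis
  then have G: "\<And>j. G j \<in> polys_vec (k - 1)" "\<And>j S. C1_on S (p j) (G j)" by simp_all
  show thesis
  proof (rule that[of "\<lambda>x. \<chi> j. p j x" G])
    show "(\<lambda>x. \<chi> j. p j x) \<in> polys_vec k" using p(1) by (simp add: polys_vec_def)
    show "v x = (\<chi> j. p j x)" if "x \<in> K" for x using p(2)[OF that] by (simp add: vec_eq_iff)
  qed (use G in simp_all)
qed

lemma L1_pw_C1: 
  assumes "v \<in> L1 z k"
  shows "pw_C1 v"
  unfolding pw_C1_def
proof
  fix K assume K: "K \<in> ps_split z"
  obtain P G where P: "P \<in> polys_vec k" "\<And>x. x \<in> K \<Longrightarrow> v x = P x"
    "\<And>j. G j \<in> polys_vec (k - 1)" "\<And>j S. C1_on S (\<lambda>x. P x $ j) (G j)"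
    using L1_piece[OF assms K] by blast
  have "C1_on K (\<lambda>x. v x $ j) (G j)" for j
    by (rule C1_on_cong[OF P(4)]) (simp add: P(2))
  then show "\<exists>G. \<forall>j. C1_on K (\<lambda>x. v x $ j) (G j)" by blast
qed

lemma L1_piece_divg:
  assumes "v \<in> L1 z k" "K \<in> ps_split z" "\<And>x. x \<in> K \<Longrightarrow> v x = P x"
    "\<And>j S. C1_on S (\<lambda>x. P x $ j) (G j)" "x \<in> interior K"
  shows "divg T v x = G 1 x $ 1 + G 2 x $ 2"
  by (rule divg_interior[OF assms(2) _ assms(5)], rule C1_on_cong[OF assms(4)]) (simp add: assms(3))

lemma L1_divg_V2:
  assumes "v \<in> L1 z k"
  shows "divg T v \<in> V2 z (k - 1)"
  unfolding V2_def mem_Collect_eq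
proof
  fix K assume K: "K \<in> ps_split z"
  obtain P G where P: "P \<in> polys_vec k" "\<And>x. x \<in> K \<Longrightarrow> v x = P x"
    "\<And>j. G j \<in> polys_vec (k - 1)" "\<And>j S. C1_on S (\<lambda>x. P x $ j) (G j)"
    using L1_piece[OF assms K] by blast
  have "(\<lambda>x. G 1 x $ 1 + G 2 x $ 2) \<in> polys (k - 1)"
    using P(3) by (intro polys_add) (simp_all add: polys_vec_def)
  then show "\<exists>p\<in>polys (k - 1). \<forall>x\<in>interior K. divg T v x = p x"
    by (rule bexI[rotated]) (intro ballI, rule L1_piece_divg[OF assms K P(2,4)])
qed

lemma L1_continuous: "v \<in> L1 z k \<Longrightarrow> continuous_on T v"
  by (rule continuous_on_vec2) (simp add: L1_def L0_def)

lemma L1_diff: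
  assumes "v \<in> L1 z k" "w \<in> L1 z k"
  shows "(\<lambda>x. v x - w x) \<in> L1 z k"
proof -
  have "(\<lambda>x. v x $ j - w x $ j) \<in> L0 z k" for j
    using assms V2_diff[of "\<lambda>x. v x $ j" k "\<lambda>x. w x $ j"]
      continuous_on_diff[of T "\<lambda>x. v x $ j" "\<lambda>x. w x $ j"]
    by (simp add: L1_def L0_def)
  then show ?thesis by (simp add: L1_def)
qed

end

section \<open>Unisolvence\<close>

text \<open>The transposed Jacobian applied to \<open>d\<close>: the gradient of the scalar
  component \<open>P x \<bullet> d\<close> if \<open>G j\<close> is the gradient of the
  \<open>j\<close>-th component of \<open>P\<close>.\<close>

definition dir_grad :: "(2 \<Rightarrow> real^2 \<Rightarrow> real^2) \<Rightarrow> real^2 \<Rightarrow> real^2 \<Rightarrow> real^2" where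
  "dir_grad G d x = d $ 1 *\<^sub>R G 1 x + d $ 2 *\<^sub>R G 2 x"

lemma dir_grad_polys:
  assumes "\<And>j. G j \<in> polys_vec k"
  shows "dir_grad G d \<in> polys_vec k"
  using assms unfolding polys_vec_def dir_grad_def by (simp add: polys_add polys_cmult)

lemma dir_grad_C1:
  assumes "\<And>j. C1_on S (\<lambda>x. P x $ j) (G j)"
  shows "C1_on S (\<lambda>x. P x \<bullet> d) (dir_grad G d)"
  unfolding C1_on_def
proof (intro conjI ballI)
  have c: "continuous_on S (G j)" for j using assms[of j] by (simp add: C1_on_def)
  show "continuous_on S (dir_grad G d)"
    unfolding dir_grad_def by (intro continuous_intros c)
  fix x assume x: "x \<in> S"
  have "((\<lambda>x. P x $ j) has_derivative (\<lambda>h. G j x \<bullet> h)) (at x within S)" for j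
    using assms[of j] x by (simp add: C1_on_def)
  then have "((\<lambda>x. d $ 1 * P x $ 1 + d $ 2 * P x $ 2) has_derivative
      (\<lambda>h. d $ 1 * (G 1 x \<bullet> h) + d $ 2 * (G 2 x \<bullet> h))) (at x within S)"
    by (intro has_derivative_add has_derivative_mult_right)
  then show "((\<lambda>x. P x \<bullet> d) has_derivative (\<lambda>h. dir_grad G d x \<bullet> h)) (at x within S)"
    by (simp add: inner2[of "P _" d] dir_grad_def inner_add_left mult.commute)
qed

lemma edge_integral_cong:
  assumes "\<And>x. x \<in> closed_segment a b \<Longrightarrow> f x = g x"
  shows "edge_integral a b f = edge_integral a b g"
proof -
  have "integral {0..1} (\<lambda>s. f (linepath a b s)) = integral {0..1} (\<lambda>s. g (linepath a b s))"
    by (rule Henstock_Kurzweil_Integration.integral_cong, rule assms, rule linepath_in_path)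
  then show ?thesis by (simp add: edge_integral_def)
qed

text \<open>Values on a segment determine the derivative in its direction and nothing more. On a
  spoke this yields \<open>B s = 0\<close>; on an edge it yields the condition on
  \<open>B u\<close>.\<close>

lemma C1_eq_on_segment:
  assumes "C1_on UNIV p G" "C1_on UNIV q H" "\<And>x. x \<in> closed_segment a b \<Longrightarrow> p x = q x"
  shows "G a \<bullet> (b - a) = H a \<bullet> (b - a)"
proof -
  have 1: "((\<lambda>s. p (linepath a b s)) has_vector_derivative G a \<bullet> (b - a)) (at 0 within {0..1})"
    using C1_on_linepath(3)[OF assms(1), of a b 0] by (simp add: linepath_0')
  have 2: "((\<lambda>s. q (linepath a b s)) has_vector_derivative H a \<bullet> (b - a)) (at 0 within {0..1})"
    using C1_on_linepath(3)[OF assms(2), of a b 0] by (simp add: linepath_0')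
  have "((\<lambda>s. p (linepath a b s)) has_vector_derivative H a \<bullet> (b - a)) (at 0 within {0..1})"
    by (rule has_vector_derivative_transform[OF _ _ 2]) (auto intro!: assms(3) linepath_in_path)
  with 1 show ?thesis
    using vector_derivative_unique_within_closed_interval[of 0 1 0 "\<lambda>s. p (linepath a b s)"] by simp
qed

text \<open>\<open>B1\<close>, \<open>B2\<close> are the rows of the jump \<open>B\<close> of the Jacobian across the spoke from \<open>z (3 + i)\<close> to
  \<open>z 0\<close>: continuity across the spoke gives \<open>B s = 0\<close> for its direction \<open>s\<close>, continuity of the
  divergence gives trace zero, and a vanishing normal component on the edge makes \<open>B u\<close> a multiple of
  the edge direction \<open>u\<close>.\<close>

lemma trace_free_kills:
  fixes B1 B2 s u :: "real^2"
  assumes c: "cross2 s u \<noteq> 0" and s: "B1 \<bullet> s = 0" "B2 \<bullet> s = 0"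
    and tr: "B1 $ 1 + B2 $ 2 = 0" and n: "u $ 2 * (B1 \<bullet> u) = u $ 1 * (B2 \<bullet> u)"
  shows "B1 \<bullet> u = 0" "B2 \<bullet> u = 0"
proof -
  have 1: "cross2 s u * B1 $ 1 = u $ 2 * (B1 \<bullet> s) - s $ 2 * (B1 \<bullet> u)"
    by (simp add: cross2_def inner2 algebra_simps)
  have 2: "cross2 s u * B2 $ 2 = s $ 1 * (B2 \<bullet> u) - u $ 1 * (B2 \<bullet> s)"
    by (simp add: cross2_def inner2 algebra_simps)
  have "s $ 1 * (B2 \<bullet> u) - s $ 2 * (B1 \<bullet> u) = cross2 s u * (B1 $ 1 + B2 $ 2)"
    unfolding distrib_left 1 2 s by simp
  \<comment> \<open>Thus \<open>B u\<close> is parallel to \<open>s\<close>; by \<open>n\<close> it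
    is also parallel to \<open>u\<close>, and the two directions are independent.\<close>
  then have t: "s $ 1 * (B2 \<bullet> u) = s $ 2 * (B1 \<bullet> u)" unfolding tr by simp
  have "cross2 s u * (B1 \<bullet> u) = s $ 1 * (u $ 2 * (B1 \<bullet> u)) - u $ 1 * (s $ 2 * (B1 \<bullet> u))"
    by (simp add: cross2_def algebra_simps)
  also have "\<dots> = 0" unfolding n t[symmetric] by simp
  finally show "B1 \<bullet> u = 0" using c by simp
  have "cross2 s u * (B2 \<bullet> u) = u $ 2 * (s $ 1 * (B2 \<bullet> u)) - s $ 2 * (u $ 1 * (B2 \<bullet> u))"
    by (simp add: cross2_def algebra_simps)
  also have "\<dots> = 0" unfolding n[symmetric] t by simp
  finally show "B2 \<bullet> u = 0" using c by simp
qed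

lemma rot90_basis:
  assumes "x \<bullet> u = 0" "x \<bullet> rot90 u = 0" "u \<noteq> 0"
  shows "x = 0"
proof -
  have "(u \<bullet> u) *\<^sub>R x = (x \<bullet> u) *\<^sub>R u + (x \<bullet> rot90 u) *\<^sub>R rot90 u"
    by (simp add: vec_eq_iff forall_2 rot90_def inner2 algebra_simps)
  then show ?thesis using assms by simp
qed

context powell_sabin_split
begin

lemma L1_edge_eq_0:
  assumes e: "e \<in> L1 z k" and k: "k \<ge> 1" and i: "i \<in> I"
    and vertices: "\<And>j. j \<in> I \<Longrightarrow> e (z j) = 0"
    and edge: "k = 1 \<Longrightarrow> edge_integral (z (nxt i)) (z (prv i)) (\<lambda>x. e x \<bullet> nrm z i) = 0"
    and jump: "jump z (divg T e) i = 0"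
    and mid: "k \<ge> 2 \<Longrightarrow> e (m i) \<bullet> nrm z i = 0"
    and orth: "\<And>a b w. (a, b) \<in> half_edges z i \<Longrightarrow> w \<in> polys_vec (k - 2) \<Longrightarrow>
      edge_integral a b (\<lambda>x. e x \<bullet> w x) = 0"
    and x: "x \<in> closed_segment (z (nxt i)) (z (prv i))"
  shows "e x = 0"
proof -
  define a b M u N where "a = z (nxt i)" and "b = z (prv i)" and "M = m i" and "u = b - a" and "N = rot90 u"
  have u0: "u \<noteq> 0" using nrm_eq(2)[OF i] by (simp add: u_def a_def b_def)
  have nN: "nrm z i = (1 / norm u) *\<^sub>R N" using nrm_eq(1)[OF i] by (simp add: N_def u_def a_def b_def)
  obtain c where c: "0 < c" "c < 1" "M - a = c *\<^sub>R u" "b - M = (1 - c) *\<^sub>R u"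
    using m_param[OF i] unfolding M_def a_def b_def u_def .
  have he: "(a, M) \<in> half_edges z i" "(M, b) \<in> half_edges z i"
    by (simp_all add: half_edges_def a_def b_def M_def)
  have ne: "a \<noteq> M" "M \<noteq> b" using half_edge_ne[OF i he(1)] half_edge_ne[OF i he(2)] by simp_all
  have ea: "e a = 0" "e b = 0" using vertices i by (auto simp: a_def b_def)
  obtain P1 G1 where P1: "P1 \<in> polys_vec k" "\<And>x. x \<in> subtri1 z i \<Longrightarrow> e x = P1 x"
    "\<And>j. G1 j \<in> polys_vec (k - 1)" "\<And>j S. C1_on S (\<lambda>x. P1 x $ j) (G1 j)"
    using L1_piece[OF e subtri_mem(1)[OF i]] by blast
  obtain P2 G2 where P2: "P2 \<in> polys_vec k" "\<And>x. x \<in> subtri2 z i \<Longrightarrow> e x = P2 x"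
    "\<And>j. G2 j \<in> polys_vec (k - 1)" "\<And>j S. C1_on S (\<lambda>x. P2 x $ j) (G2 j)"
    using L1_piece[OF e subtri_mem(2)[OF i]] by blast
  have s1: "closed_segment a M \<subseteq> subtri1 z i" "closed_segment M (z 0) \<subseteq> subtri1 z i"
    unfolding subtri1_def a_def M_def segment_convex_hull by (intro hull_mono; simp)+
  have s2: "closed_segment M b \<subseteq> subtri2 z i" "closed_segment M (z 0) \<subseteq> subtri2 z i"
    unfolding subtri2_def b_def M_def segment_convex_hull by (intro hull_mono; simp)+
  have eP1: "e x = P1 x" if "x \<in> closed_segment a M" for x using P1(2) s1(1) that by blast
  have eP2: "e x = P2 x" if "x \<in> closed_segment M b" for x using P2(2) s2(1) that by blast
  have eMs: "e x = P1 x" "e x = P2 x" if "x \<in> closed_segment M (z 0)" for x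
    using P1(2) P2(2) s1(2) s2(2) that by blast+
  have PM: "P1 M = e M" "P2 M = e M" "P1 a = 0" "P2 b = 0"
    using eP1[of M] eP2[of M] eP1[of a] eP2[of b] ea by simp_all
  have test: "(\<lambda>x. h x *\<^sub>R d) \<in> polys_vec (k - 2)" if "h \<in> polys (k - 2)" for h and d :: "real^2"
  proof -
    have "(\<lambda>x. (h x *\<^sub>R d) $ j) = (\<lambda>x. d $ j * h x)" for j by auto
    then show ?thesis using polys_cmult[OF that] by (simp only: polys_vec_def mem_Collect_eq simp_thms)
  qed
  have orth1: "edge_integral a M (\<lambda>x. (P1 x \<bullet> d) * h x) = 0" if "h \<in> polys (k - 2)" for d h
  proof -
    have "edge_integral a M (\<lambda>x. (P1 x \<bullet> d) * h x) = edge_integral a M (\<lambda>x. e x \<bullet> (h x *\<^sub>R d))"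
      by (rule edge_integral_cong) (simp add: eP1)
    then show ?thesis using orth[OF he(1) test[OF that]] by simp
  qed
  have orth2: "edge_integral M b (\<lambda>x. (P2 x \<bullet> d) * h x) = 0" if "h \<in> polys (k - 2)" for d h
  proof -
    have "edge_integral M b (\<lambda>x. (P2 x \<bullet> d) * h x) = edge_integral M b (\<lambda>x. e x \<bullet> (h x *\<^sub>R d))"
      by (rule edge_integral_cong) (simp add: eP2)
    then show ?thesis using orth[OF he(2) test[OF that]] by simp
  qed
  note energy1 = edge_energy[OF polys_vec_inner[OF P1(1)] dir_grad_polys[OF P1(3)] dir_grad_C1[OF P1(4)] ne(1) orth1]
  note energy2 = edge_energy[OF polys_vec_inner[OF P2(1)] dir_grad_polys[OF P2(3)] dir_grad_C1[OF P2(4)] ne(2) orth2]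

  \<comment> \<open>For \<open>k \<ge> 2\<close> this is a degree of freedom. For
    \<open>k = 1\<close> the components are affine on each half and vanish at the vertices, so by
    the trapezoidal rule the flux through the edge is a positive multiple of the value at
    \<open>M\<close>.\<close>
  have MN: "e M \<bullet> N = 0"
  proof (cases "k = 1")
    case False
    then show ?thesis using mid k u0 unfolding nN M_def[symmetric] by simp
  next
    case True
    have p1: "(\<lambda>x. P1 x \<bullet> N) \<in> polys 1" "(\<lambda>x. P2 x \<bullet> N) \<in> polys 1"
      using polys_vec_inner[OF P1(1)] polys_vec_inner[OF P2(1)] True by simp_all
    have "continuous_on (closed_segment a b) e"
      using continuous_on_subset[OF L1_continuous[OF e] edge_subset_T[OF i]] by (simp add: a_def b_def)
    then have cN: "continuous_on (closed_segment a b) (\<lambda>x. e x \<bullet> N)" by (intro continuous_intros)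
    have "edge_integral a b (\<lambda>x. e x \<bullet> nrm z i) = (1 / norm u) * edge_integral a b (\<lambda>x. e x \<bullet> N)"
      unfolding nN by (simp add: edge_integral_def)
    then have "0 = edge_integral a b (\<lambda>x. e x \<bullet> N)"
      using edge[OF True] u0 by (simp add: a_def b_def)
    also have "\<dots> = edge_integral a M (\<lambda>x. e x \<bullet> N) + edge_integral M b (\<lambda>x. e x \<bullet> N)"
      using m_segment[OF i] cN unfolding M_def a_def b_def by (rule edge_integral_split)
    also have "edge_integral a M (\<lambda>x. e x \<bullet> N) = edge_integral a M (\<lambda>x. P1 x \<bullet> N)"
      by (rule edge_integral_cong) (simp add: eP1)
    also have "edge_integral M b (\<lambda>x. e x \<bullet> N) = edge_integral M b (\<lambda>x. P2 x \<bullet> N)"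
      by (rule edge_integral_cong) (simp add: eP2)
    finally have "(norm (M - a) + norm (b - M)) * (e M \<bullet> N) = 0"
      unfolding edge_integral_polys_1[OF p1(1)] edge_integral_polys_1[OF p1(2)] PM
      by (simp add: algebra_simps)
    moreover have "norm (M - a) + norm (b - M) > 0" using ne by (simp add: add_pos_pos)
    ultimately show ?thesis by simp
  qed
  have N1: "P1 x \<bullet> N = 0" if "x \<in> closed_segment a M" for x
    using energy1(2)[of N, OF _ _ that] by (simp add: PM MN)
  have N2: "P2 x \<bullet> N = 0" if "x \<in> closed_segment M b" for x
    using energy2(2)[of N, OF _ _ that] by (simp add: PM MN)

  have C0: "C1_on UNIV (\<lambda>_. 0) (\<lambda>_. 0 :: real^2)" by (simp add: C1_on_def)
  define B where "B = (\<lambda>j. G1 j M - G2 j M)"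
  have "G1 j M \<bullet> (z 0 - M) = G2 j M \<bullet> (z 0 - M)" for j
    by (rule C1_eq_on_segment[OF P1(4) P2(4)]) (metis eMs)
  then have Bs: "B j \<bullet> (z 0 - M) = 0" for j by (simp add: B_def inner_diff_left)
  \<comment> \<open>The normal component vanishes along both halves, hence so does its derivative
    along the edge at \<open>M\<close> from either side. With \<open>N = rot90 u\<close> the
    difference of the two relations says that \<open>B u\<close> is parallel to
    \<open>u\<close>.\<close>
  have "dir_grad G1 N M \<bullet> (a - M) = 0"
    using C1_eq_on_segment[OF dir_grad_C1[OF P1(4)] C0, of M a N] N1 by (simp add: closed_segment_commute)
  moreover have "a - M = - (c *\<^sub>R u)" using c(3) by (simp add: algebra_simps)
  ultimately have g1: "dir_grad G1 N M \<bullet> u = 0" using c(1) by simp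
  have "dir_grad G2 N M \<bullet> (b - M) = 0"
    using C1_eq_on_segment[OF dir_grad_C1[OF P2(4)] C0, of M b N] N2 by simp
  then have g2: "dir_grad G2 N M \<bullet> u = 0" using c(2,4) by simp
  have n: "u $ 2 * (B 1 \<bullet> u) = u $ 1 * (B 2 \<bullet> u)"
    using g1 g2 by (simp add: dir_grad_def N_def rot90_def B_def inner_add_left inner_diff_left algebra_simps)
  have tr: "B 1 $ 1 + B 2 $ 2 = 0"
  proof -
    have "jump z (divg T e) i = ((G1 1 (m i) $ 1 + G1 2 (m i) $ 2) - (G2 1 (m i) $ 1 + G2 2 (m i) $ 2))
       *\<^sub>R outer_normal (z 0) (m i) (z (nxt i))"
    proof (rule jump_eq[OF i])
      show "divg T e y = G1 1 y $ 1 + G1 2 y $ 2" if "y \<in> interior (subtri1 z i)" for y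
        by (rule L1_piece_divg[OF e subtri_mem(1)[OF i] P1(2,4) that])
      show "divg T e y = G2 1 y $ 1 + G2 2 y $ 2" if "y \<in> interior (subtri2 z i)" for y
        by (rule L1_piece_divg[OF e subtri_mem(2)[OF i] P2(2,4) that])
      show "continuous_on (subtri1 z i) (\<lambda>y. G1 1 y $ 1 + G1 2 y $ 2)"
        by (rule div_continuous[OF P1(4)])
      show "continuous_on (subtri2 z i) (\<lambda>y. G2 1 y $ 1 + G2 2 y $ 2)"
        by (rule div_continuous[OF P2(4)])
    qed
    then show ?thesis using jump jump_normal_nonzero[OF i] by (simp add: B_def M_def)
  qed
  \<comment> \<open>The spoke is not parallel to the edge because the subtriangle with vertices
    \<open>z 0\<close>, \<open>M\<close>, \<open>b\<close> is nondegenerate.\<close>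
  have cs: "cross2 (z 0 - M) u \<noteq> 0"
  proof -
    have "cross2 (M - z 0) (b - z 0) = cross2 (M - z 0) (b - M)"
      by (simp add: cross2_def algebra_simps)
    also have "\<dots> = - ((1 - c) * cross2 (z 0 - M) u)"
      unfolding c(4) by (simp add: cross2_def algebra_simps)
    finally show ?thesis using cross_sub(2)[OF i] by (auto simp: M_def b_def)
  qed
  have "B 1 \<bullet> u = 0" "B 2 \<bullet> u = 0"
    using trace_free_kills[OF cs Bs Bs tr n] by simp_all
  then have gg: "dir_grad G1 u M \<bullet> u = dir_grad G2 u M \<bullet> u"
    by (simp add: dir_grad_def B_def inner_add_left inner_diff_left)

  \<comment> \<open>The common derivative of the tangential component at \<open>M\<close>, taken
    along the full edge. On the two halves it is scaled by \<open>c\<close> and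
    \<open>1 - c\<close>, their shares of the edge; these are positive, so the two energy
    inequalities have opposite signs.\<close>
  define \<gamma> where "\<gamma> = dir_grad G2 u M \<bullet> u"
  have "0 \<le> (e M \<bullet> u) * (c * \<gamma>)"
    using energy1(1)[of u] unfolding c(3) PM by (simp add: gg \<gamma>_def)
  then have "0 \<le> (e M \<bullet> u) * \<gamma>"
    using mult_le_cancel_left_pos[OF c(1), of 0 "(e M \<bullet> u) * \<gamma>"] by (simp only: mult.left_commute[of _ c] mult_zero_right)
  moreover have "(e M \<bullet> u) * ((1 - c) * \<gamma>) \<le> 0"
    using energy2(1)[of u] unfolding c(4) PM by (simp add: \<gamma>_def)
  then have "(e M \<bullet> u) * \<gamma> \<le> 0"
    using mult_le_cancel_left_pos[of "1 - c" "(e M \<bullet> u) * \<gamma>" 0] c(2)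
    by (simp only: mult.left_commute[of _ "1 - c"] mult_zero_right diff_gt_0_iff_gt)
  ultimately have z: "(e M \<bullet> u) * \<gamma> = 0" by simp
  have u1: "P1 x \<bullet> u = 0" if "x \<in> closed_segment a M" for x
    using energy1(2)[of u, OF _ _ that] z unfolding c(3) PM by (auto simp: gg \<gamma>_def)
  have u2: "P2 x \<bullet> u = 0" if "x \<in> closed_segment M b" for x
  proof -
    \<comment> \<open>On the second half constancy refers to the end \<open>M\<close>, where the
      value is already known to be zero from the first half.\<close>
    have "P2 x \<bullet> u = P2 M \<bullet> u"
      using energy2(2)[of u, OF _ _ that] z unfolding c(4) PM by (auto simp: \<gamma>_def)
    also have "\<dots> = 0" using u1[of M] PM by simp
    finally show ?thesis .
  qed
  have "x \<in> closed_segment a M \<or> x \<in> closed_segment M b"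
    using x edge_halves[OF i] by (auto simp: a_def b_def M_def)
  then show ?thesis
    using rot90_basis[OF u1 _ u0] rot90_basis[OF u2 _ u0] N1 N2 eP1 eP2 unfolding N_def by metis
qed


text \<open>The limit of the difference quotient within a finite union is the common limit within
  the pieces; triangles not containing \<open>x\<close> contribute a trivial filter.\<close>

lemma has_derivative_T:
  assumes x: "x \<in> T" and D: "\<And>K. K \<in> ps_split z \<Longrightarrow> x \<in> K \<Longrightarrow> (f has_derivative D) (at x within K)"
  shows "(f has_derivative D) (at x within T)"
proof -
  obtain K where K: "K \<in> ps_split z" "x \<in> K" using x T_Union by auto
  have bl: "bounded_linear D" using D[OF K] by (rule has_derivative_bounded_linear)
  let ?r = "\<lambda>y. (f y - f x - D (y - x)) /\<^sub>R norm (y - x)"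
  have "(?r \<longlongrightarrow> 0) (at x within L)" if L: "L \<in> ps_split z" for L
  proof (cases "x \<in> L")
    case True
    then show ?thesis using D[OF L True] by (simp add: has_derivative_at_within)
  next
    case False
    then have "at x within L = bot"
      using ps_split_facts(1)[OF L] by (intro at_within_closed_eq_bot compact_imp_closed)
    then show ?thesis by simp
  qed
  then have "(?r \<longlongrightarrow> 0) (at x within T)"
    unfolding T_Union by (rule tendsto_within_finite_Union[OF finite_ps_split])
  with bl show ?thesis by (simp add: has_derivative_at_within)
qed

lemma C1_on_T:
  assumes "continuous_on T g" "\<And>K. K \<in> ps_split z \<Longrightarrow> C1_on K f g"
  shows "C1_on T f g"
  unfolding C1_on_def
proof (intro conjI ballI)
  fix x assume x: "x \<in> T"
  show "(f has_derivative (\<lambda>h. g x \<bullet> h)) (at x within T)"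
    by (rule has_derivative_T[OF x]) (use assms(2) in \<open>simp add: C1_on_def\<close>)
qed (rule assms(1))

text \<open>Every triangle of the split contains \<open>z 0\<close>, so integrating along the rays from \<open>z 0\<close> yields
  one function on \<open>T\<close> that agrees with a polynomial stream function on each triangle.\<close>

lemma L1_stream_function:
  assumes e: "e \<in> L1 z k" and k: "k \<ge> 0"
    and div: "\<forall>K\<in>ps_split z. \<forall>x\<in>interior K. divg T e x = 0"
  obtains \<psi> where "\<psi> \<in> V2 z (k + 1)" "C1_on T \<psi> (\<lambda>x. vector [- e x $ 2, e x $ 1])"
proof -
  define g where "g = (\<lambda>x. vector [- e x $ 2, e x $ 1] :: real^2)"
  define \<psi> where "\<psi> = (\<lambda>x. integral {0..1} (\<lambda>s. g (linepath (z 0) x s) \<bullet> (x - z 0)))"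
  have piece: "\<exists>p\<in>polys (k + 1). (\<forall>x\<in>K. \<psi> x = p x) \<and> C1_on K \<psi> g" if K: "K \<in> ps_split z" for K
  proof -
    obtain P G where P: "P \<in> polys_vec k" "\<And>x. x \<in> K \<Longrightarrow> e x = P x"
      "\<And>j. G j \<in> polys_vec (k - 1)" "\<And>j S. C1_on S (\<lambda>x. P x $ j) (G j)"
      using L1_piece[OF e K] by blast
    have d: "(\<lambda>x. G 1 x $ 1 + G 2 x $ 2) \<in> polys (k - 1)"
      using P(3) by (intro polys_add) (simp_all add: polys_vec_def)
    have d0: "G 1 x $ 1 + G 2 x $ 2 = 0" if "x \<in> interior K" for x
      using L1_piece_divg[OF e K P(2,4) that] div K that by simp
    \<comment> \<open>The divergence of the polynomial extension vanishes on an open set, hence in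
      the whole plane, where the Poincare lemma is applied.\<close>
    have "G 1 x $ 1 + G 2 x $ 2 = 0" for x
      by (rule polys_eq_0_if_open[OF d open_interior ps_split_facts(3)[OF K] d0])
    from polys_stream_function[OF P(1) P(4) this]
    obtain p where p: "p \<in> polys (k + 1)" "\<And>S. C1_on S p (\<lambda>x. vector [- P x $ 2, P x $ 1])" by blast
    have gP: "g x = vector [- P x $ 2, P x $ 1]" if "x \<in> K" for x
      using P(2)[OF that] by (simp add: g_def)
    have "\<psi> x = p x - p (z 0)" if x: "x \<in> K" for x
    proof -
      have seg: "closed_segment (z 0) x \<subseteq> K"
        using x ps_split_facts(2,4)[OF K] by (simp add: closed_segment_subset)
      have "\<psi> x = integral {0..1} (\<lambda>s. vector [- P (linepath (z 0) x s) $ 2, P (linepath (z 0) x s) $ 1] \<bullet> (x - z 0))"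
        unfolding \<psi>_def
      proof (rule Henstock_Kurzweil_Integration.integral_cong)
        fix s :: real assume "s \<in> {0..1}"
        then have "linepath (z 0) x s \<in> K" using seg linepath_in_path by blast
        then show "g (linepath (z 0) x s) \<bullet> (x - z 0) =
          vector [- P (linepath (z 0) x s) $ 2, P (linepath (z 0) x s) $ 1] \<bullet> (x - z 0)"
          by (simp only: gP)
      qed
      also have "\<dots> = p x - p (z 0)"
        by (rule integral_unique[OF integral_linepath_C1[OF p(2) seg]])
      finally show ?thesis .
    qed
    note \<psi>p = this
    have pp: "(\<lambda>x. p x - p (z 0)) \<in> polys (k + 1)"
      using p(1) k by (intro polys_diff polys_const) auto
    have "C1_on K (\<lambda>x. p x - p (z 0)) g"
      unfolding C1_on_def
    proof (intro conjI ballI)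
      have "continuous_on K (\<lambda>x. vector [- P x $ 2, P x $ 1] :: real^2)"
        using p(2)[of K] by (simp add: C1_on_def)
      then show "continuous_on K g" by (rule continuous_on_eq) (simp add: gP)
      fix x assume x: "x \<in> K"
      have "(p has_derivative (\<lambda>h. g x \<bullet> h)) (at x within K)"
        using p(2)[of K] x gP[OF x] by (simp add: C1_on_def)
      from has_derivative_diff[OF this has_derivative_const[of "p (z 0)"]]
      show "((\<lambda>x. p x - p (z 0)) has_derivative (\<lambda>h. g x \<bullet> h)) (at x within K)" by simp
    qed
    then have "C1_on K \<psi> g" by (rule C1_on_cong) (simp add: \<psi>p)
    with pp \<psi>p show ?thesis by (intro bexI[OF _ pp]) simp
  qed
  have "\<psi> \<in> V2 z (k + 1)"
    unfolding V2_def mem_Collect_eq using piece interior_subset by (meson subsetD)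
  moreover have "C1_on T \<psi> g"
  proof (rule C1_on_T)
    have c: "continuous_on T (\<lambda>x. e x $ j)" for j using e by (simp add: L1_def L0_def)
    show "continuous_on T g" unfolding g_def by (intro continuous_on_vector2 continuous_on_minus c)
  qed (use piece in blast)
  ultimately show thesis unfolding g_def by (rule that)
qed

section \<open>Fields that vanish on the boundary\<close>

lemma rot_C1:
  assumes "C1_on T \<psi> g" "x \<in> T"
  shows "rot T \<psi> x = rot90 (g x)"
  using assms by (intro grad_eq(2)) (simp_all add: C1_on_def)

text \<open>A vanishing gradient makes the function constant on each edge, and consecutive edges
  share a vertex.\<close>

lemma C1_constant_on_frontier:
  assumes C: "C1_on T \<psi> g" and g: "\<And>x. x \<in> frontier T \<Longrightarrow> g x = 0" and x: "x \<in> frontier T"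
  shows "\<psi> x = \<psi> (z 1)"
proof -
  have edge: "\<psi> x = \<psi> (z (nxt i))" if i: "i \<in> I" and x: "x \<in> closed_segment (z (nxt i)) (z (prv i))" for i x
  proof -
    have sub: "closed_segment (z (nxt i)) x \<subseteq> closed_segment (z (nxt i)) (z (prv i))"
      using x by (simp add: subset_closed_segment)
    then have sT: "closed_segment (z (nxt i)) x \<subseteq> T" using edge_subset_T[OF i] by blast
    have "g (linepath (z (nxt i)) x s) \<bullet> (x - z (nxt i)) = 0" if "s \<in> {0..1}" for s
    proof -
      have "linepath (z (nxt i)) x s \<in> frontier T"
        unfolding frontier_T using i sub linepath_in_path[OF that] by blast
      from g[OF this] show ?thesis by simp
    qed
    then have "((\<lambda>s. g (linepath (z (nxt i)) x s) \<bullet> (x - z (nxt i))) has_integral 0) {0..1}"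
      by (rule has_integral_is_0)
    from has_integral_unique[OF integral_linepath_C1[OF C sT] this] show ?thesis by simp
  qed
  have "\<psi> (z (prv i)) = \<psi> (z (nxt i))" if "i \<in> I" for i
    by (rule edge[OF that]) simp
  from this[of 1] this[of 2] this[of 3] have "\<psi> (z 3) = \<psi> (z 1)" "\<psi> (z 2) = \<psi> (z 1)" by simp_all
  then have nx: "\<psi> (z (nxt i)) = \<psi> (z 1)" if "i \<in> I" for i using that by auto
  obtain i where "i \<in> I" "x \<in> closed_segment (z (nxt i)) (z (prv i))"
    using x unfolding frontier_T by blast
  then show ?thesis using edge[of i x] nx[of i] by simp
qed

lemma continuous_T_eq_0:
  fixes f :: "real^2 \<Rightarrow> 'a::real_normed_vector"
  assumes f: "continuous_on T f" and n: "negligible {x \<in> T. f x \<noteq> 0}" and x: "x \<in> T"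
  shows "f x = 0"
proof -
  have int: "f y = 0" if "y \<in> interior T" for y
  proof (rule continuous_eq_if_negligible[OF open_interior _ continuous_on_const _ that])
    show "continuous_on (interior T) f" using f interior_subset by (rule continuous_on_subset)
    show "negligible {x \<in> interior T. f x \<noteq> 0}"
      using n by (rule negligible_subset) (use interior_subset in blast)
  qed
  have cl: "closure (interior T) = T"
    using convex_closure_interior[OF convex_T interior_T] compact_T by (simp add: compact_imp_closed)
  show ?thesis
    by (rule continuous_constant_on_closure[of "interior T" f 0, unfolded cl, OF f int x])
qed

lemma L1_eq_0_if_frontier:
  assumes e: "e \<in> L1 z k" and k: "k \<ge> 0"
    and bd: "\<And>x. x \<in> frontier T \<Longrightarrow> e x = 0"
    and jump: "\<And>i. i \<in> I \<Longrightarrow> jump z (divg T e) i = 0"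
    and rot: "\<And>w. w \<in> S0_bdry z (k + 1) \<Longrightarrow> integral T (\<lambda>x. e x \<bullet> rot T w x) = 0"
    and div: "\<And>w. w \<in> V2_ring z (k - 1) \<Longrightarrow> integral T (\<lambda>x. divg T e x * w x) = 0"
    and x: "x \<in> T"
  shows "e x = 0"
proof -
  have fl: "flux e a b = 0" if "closed_segment a b \<subseteq> frontier T" for a b
  proof -
    have "integral {0..1} (\<lambda>s. cross2 (e (linepath a b s)) (b - a)) = integral {0..1::real} (\<lambda>s. 0 :: real)"
    proof (rule Henstock_Kurzweil_Integration.integral_cong)
      fix s :: real assume "s \<in> {0..1}"
      then have "linepath a b s \<in> frontier T" using that linepath_in_path by blast
      from bd[OF this] show "cross2 (e (linepath a b s)) (b - a) = 0" by (simp add: cross2_def)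
    qed
    then show ?thesis by (simp add: flux_def)
  qed
  have "integral T (divg T e) = (\<Sum>i\<in>I. flux e (z (nxt i)) (m i) + flux e (m i) (z (prv i)))"
    by (rule divergence_T[OF L1_pw_C1[OF e]])
  also have "\<dots> = (\<Sum>i\<in>I. 0)"
  proof (rule sum.cong[OF refl])
    fix i assume i: "i \<in> I"
    have "closed_segment (z (nxt i)) (m i) \<union> closed_segment (m i) (z (prv i)) \<subseteq> frontier T"
      unfolding frontier_T edge_halves[OF i, symmetric] using i by (rule UN_upper)
    then show "flux e (z (nxt i)) (m i) + flux e (m i) (z (prv i)) = 0" using fl by simp
  qed
  finally have int0: "integral T (divg T e) = 0" by simp
  have n: "negligible {x \<in> T. divg T e x \<noteq> 0}"
    by (rule V2_eq_0[OF L1_divg_V2[OF e] jump int0 div])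
  \<comment> \<open>On an open triangle the divergence is a polynomial, so vanishing almost
    everywhere means vanishing at every point.\<close>
  have div0: "divg T e y = 0" if K: "K \<in> ps_split z" and y: "y \<in> interior K" for K y
  proof -
    obtain p where p: "p \<in> polys (k - 1)" "\<And>x. x \<in> interior K \<Longrightarrow> divg T e x = p x"
      using L1_divg_V2[OF e] K unfolding V2_def by blast
    have "p y = 0"
    proof (rule continuous_eq_if_negligible[OF open_interior polys_continuous[OF p(1)] continuous_on_const _ y])
      show "negligible {x \<in> interior K. p x \<noteq> 0}"
        using n
      proof (rule negligible_subset)
        show "{x \<in> interior K. p x \<noteq> 0} \<subseteq> {x \<in> T. divg T e x \<noteq> 0}"
          using p(2) interior_mem_T[OF K] by auto
      qed
    qed
    then show ?thesis using p(2)[OF y] by simp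
  qed
  obtain \<psi> where \<psi>: "\<psi> \<in> V2 z (k + 1)" "C1_on T \<psi> (\<lambda>x. vector [- e x $ 2, e x $ 1])"
    using L1_stream_function[OF e k] div0 by blast
  \<comment> \<open>Subtracting the boundary value makes the stream function vanish on the boundary
    without changing its \<open>rot\<close>.\<close>
  define w where "w = (\<lambda>x. \<psi> x - \<psi> (z 1))"
  have wC: "C1_on T w (\<lambda>x. vector [- e x $ 2, e x $ 1])"
    using \<psi>(2) has_derivative_diff[OF _ has_derivative_const[of "\<psi> (z 1)"]]
    unfolding C1_on_def w_def by fastforce
  have rw: "rot T w x = e x" if "x \<in> T" for x
    unfolding rot_C1[OF wC that] by (simp add: rot90_def vec_eq_iff forall_2)
  have cV: "(\<lambda>_. c) \<in> V2 z (k + 1)" for c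
    unfolding V2_def mem_Collect_eq using polys_const[of "k + 1" c] k by (intro ballI bexI) auto
  have "w \<in> L0 z (k + 1)"
    unfolding L0_def mem_Collect_eq
    using V2_diff[OF \<psi>(1) cV] C1_on_continuous[OF wC] by (simp add: w_def)
  moreover have "AE x in lebesgue_on T. rot T w x = e x"
    by (rule AE_I2) (simp add: rw)
  ultimately have "w \<in> S0 z (k + 1)"
    unfolding S0_def using L1_continuous[OF e] by blast
  moreover have "w x = 0 \<and> rot T w x = 0" if x: "x \<in> frontier T" for x
  proof -
    have "x \<in> T" using x compact_T compact_imp_closed frontier_subset_closed by blast
    moreover have "\<psi> x = \<psi> (z 1)"
      by (rule C1_constant_on_frontier[OF \<psi>(2) _ x]) (simp add: bd vec_eq_iff forall_2)
    ultimately show ?thesis using rw bd[OF x] by (simp add: w_def)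
  qed
  ultimately have wS: "w \<in> S0_bdry z (k + 1)" unfolding S0_bdry_def by blast
  have "integral T (\<lambda>x. e x \<bullet> e x) = integral T (\<lambda>x. e x \<bullet> rot T w x)"
    by (rule Henstock_Kurzweil_Integration.integral_cong) (simp add: rw)
  also have "\<dots> = 0" by (rule rot[OF wS])
  finally have 0: "integral T (\<lambda>x. e x \<bullet> e x) = 0" .
  have ce: "continuous_on T (\<lambda>x. e x \<bullet> e x)" by (intro continuous_on_inner L1_continuous[OF e])
  have "negligible {x \<in> T. e x \<bullet> e x \<noteq> 0}"
    by (rule negligible_if_integral_nonneg_eq_0[OF T_lebesgue integrable_continuous_compact[OF compact_T ce] _ 0]) simp
  then have "e x \<bullet> e x = 0" by (rule continuous_T_eq_0[OF ce _ x])
  then show ?thesis by simp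
qed

lemma L1_unisolvent:
  assumes e: "e \<in> L1 z k" and k: "k \<ge> 1" and dofs: "\<And>\<phi>. \<phi> \<in> dofs_L z k \<Longrightarrow> \<phi> e = 0" and x: "x \<in> T"
  shows "e x = 0"
proof -
  have vert: "e (z i) = 0" if "i \<in> I" for i
  proof -
    have "e (z i) $ j = 0" for j
      using dofs[of "\<lambda>v. v (z i) $ j"] that unfolding dofs_L_def by blast
    then show ?thesis by (simp add: vec_eq_iff)
  qed
  have jmp: "jump z (divg T e) i = 0" if "i \<in> I" for i
  proof -
    have "jump z (divg T e) i $ j = 0" for j
      using dofs[of "\<lambda>v. jump z (divg T v) i $ j"] that unfolding dofs_L_def by blast
    then show ?thesis by (simp add: vec_eq_iff)
  qed
  have bd: "e x = 0" if x: "x \<in> frontier T" for x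
  proof -
    obtain i where i: "i \<in> I" "x \<in> closed_segment (z (nxt i)) (z (prv i))"
      using x unfolding frontier_T by blast
    show ?thesis
    proof (rule L1_edge_eq_0[OF e k i(1) vert _ jmp[OF i(1)] _ _ i(2)])
      assume "k = 1"
      then have "(\<lambda>v. edge_integral (z (nxt i)) (z (prv i)) (\<lambda>x. v x \<bullet> nrm z i)) \<in> dofs_L z k"
        unfolding dofs_L_def using i(1) by auto
      from dofs[OF this] show "edge_integral (z (nxt i)) (z (prv i)) (\<lambda>x. e x \<bullet> nrm z i) = 0" .
    next
      assume "k \<ge> 2"
      then have "(\<lambda>v. v (m i) \<bullet> nrm z i) \<in> dofs_L z k"
        unfolding dofs_L_def using i(1) by auto
      from dofs[OF this] show "e (m i) \<bullet> nrm z i = 0" .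
    next
      fix a b w assume "(a, b) \<in> half_edges z i" "w \<in> polys_vec (k - 2)"
      then have "(\<lambda>v. edge_integral a b (\<lambda>x. v x \<bullet> w x)) \<in> dofs_L z k"
        unfolding dofs_L_def using i(1) by blast
      from dofs[OF this] show "edge_integral a b (\<lambda>x. e x \<bullet> w x) = 0" .
    qed
  qed
  show ?thesis
  proof (rule L1_eq_0_if_frontier[OF e _ bd jmp _ _ x])
    show "0 \<le> k" using k by simp
    fix w assume "w \<in> S0_bdry z (k + 1)"
    then have "(\<lambda>v. integral T (\<lambda>x. v x \<bullet> rot T w x)) \<in> dofs_L z k" unfolding dofs_L_def by blast
    from dofs[OF this] show "integral T (\<lambda>x. e x \<bullet> rot T w x) = 0" .
  next
    fix w assume "w \<in> V2_ring z (k - 1)"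
    then have "(\<lambda>v. integral T (\<lambda>x. divg T v x * w x)) \<in> dofs_L z k" unfolding dofs_L_def by blast
    from dofs[OF this] show "integral T (\<lambda>x. divg T e x * w x) = 0" .
  qed
qed

end

section \<open>Smooth functions\<close>

lemma has_derivative_cong_on:
  assumes "\<And>y. y \<in> U \<Longrightarrow> f y = g y" "x \<in> U"
  shows "(f has_derivative D) (at x within U) \<longleftrightarrow> (g has_derivative D) (at x within U)"
  using assms has_derivative_transform[of x U f g D] has_derivative_transform[of x U g f D] by metis

lemma pd_cong:
  assumes "\<And>y. y \<in> U \<Longrightarrow> f y = g y" "x \<in> U"
  shows "pd U f j x = pd U g j x"
proof -
  have "(f has_derivative D) (at x within U) = (g has_derivative D) (at x within U)" for D
    using assms by (rule has_derivative_cong_on)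
  then show ?thesis unfolding pd_def frechet_derivative_def by presburger
qed

lemma C_on_cong:
  assumes "\<And>y. y \<in> U \<Longrightarrow> f y = g y" "C_on m U f"
  shows "C_on m U g"
  using assms
proof (induction m arbitrary: f g)
  case 0
  then show ?case using continuous_on_cong[of U U f g] by simp
next
  case (Suc m)
  have "g differentiable_on U"
    using Suc.prems has_derivative_cong_on[of U f g] unfolding C_on.simps differentiable_on_def differentiable_def by blast
  moreover have "C_on m U (pd U g j)" for j
    using Suc.IH[of "pd U f j" "pd U g j"] Suc.prems pd_cong[of U f g] by simp
  ultimately show ?case by simp
qed

text \<open>At points of an open set the derivative within the set is the full derivative, so
  \<open>pd U\<close> and \<open>pd V\<close> agree on \<open>V\<close>.\<close>

lemma C_on_subset:
  assumes "open U" "open V" "V \<subseteq> U" "C_on m U f"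
  shows "C_on m V f"
  using assms(4)
proof (induction m arbitrary: f)
  case 0
  then show ?case using continuous_on_subset[OF _ assms(3), of f] by simp
next
  case (Suc m)
  have "pd U f j x = pd V f j x" if "x \<in> V" for x j
  proof -
    have "x \<in> U" using that assms(3) by blast
    then show ?thesis
      unfolding pd_def by (simp only: at_within_open[OF _ assms(1)] at_within_open[OF that assms(2)])
  qed
  moreover have "C_on m V (pd U f j)" for j using Suc by simp
  ultimately have "C_on m V (pd V f j)" for j by (rule C_on_cong)
  moreover have "f differentiable_on V" using Suc.prems differentiable_on_subset[OF _ assms(3), of f] by simp
  ultimately show ?case by simp
qed

lemma frechet_derivative_pd:
  assumes "open U" "x \<in> U" "f differentiable_on U"
  shows "(f has_derivative (\<lambda>h. (\<chi> j. pd U f j x) \<bullet> h)) (at x within U)"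
proof -
  let ?D = "frechet_derivative f (at x within U)"
  have D: "(f has_derivative ?D) (at x within U)"
    using assms(2,3) by (simp add: differentiable_on_def frechet_derivative_works[symmetric])
  then interpret bounded_linear ?D by (rule has_derivative_bounded_linear)
  have "?D h = (\<chi> j. pd U f j x) \<bullet> h" for h
  proof -
    have "h = h $ 1 *\<^sub>R axis 1 1 + h $ 2 *\<^sub>R axis 2 1"
      by (simp add: vec_eq_iff forall_2 axis_def)
    from arg_cong[OF this, of ?D]
    have "?D h = h $ 1 * ?D (axis 1 1) + h $ 2 * ?D (axis 2 1)" by (simp only: add scaleR real_scaleR_def)
    then show ?thesis by (simp add: inner2 pd_def mult.commute)
  qed
  then show ?thesis using has_derivative_eq_rhs[OF D ext] by blast
qed

lemma pd_open_eq:
  assumes "open U" "x \<in> U" "(f has_derivative (\<lambda>h. G \<bullet> h)) (at x within U)"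
  shows "pd U f j x = G $ j"
proof -
  have "(f has_derivative (\<lambda>h. G \<bullet> h)) (at x)"
    using assms(3) by (simp only: at_within_open[OF assms(2,1)])
  then have "frechet_derivative f (at x) = (\<lambda>h. G \<bullet> h)" by (rule frechet_derivative_at[symmetric])
  then show ?thesis by (simp add: pd_def at_within_open[OF assms(2,1)] inner_axis)
qed

text \<open>The sum of the partial derivatives equals the partial derivative of the sum on
  \<open>U\<close>; congruence on \<open>U\<close> carries the induction through this
  exchange.\<close>

lemma C_on_add:
  assumes "open U" "C_on m U f" "C_on m U g"
  shows "C_on m U (\<lambda>x. f x + g x)"
  using assms(2,3)
proof (induction m arbitrary: f g)
  case 0
  then show ?case by (simp add: continuous_on_add)
next
  case (Suc m)
  have "pd U f j x + pd U g j x = pd U (\<lambda>x. f x + g x) j x" if x: "x \<in> U" for x j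
  proof -
    have "((\<lambda>x. f x + g x) has_derivative (\<lambda>h. ((\<chi> j. pd U f j x) + (\<chi> j. pd U g j x)) \<bullet> h)) (at x within U)"
      unfolding inner_add_left using Suc.prems
      by (intro has_derivative_add frechet_derivative_pd[OF assms(1) x]) simp_all
    from pd_open_eq[OF assms(1) x this] show ?thesis by simp
  qed
  moreover have "C_on m U (\<lambda>x. pd U f j x + pd U g j x)" for j using Suc by simp
  ultimately have "C_on m U (pd U (\<lambda>x. f x + g x) j)" for j by (rule C_on_cong)
  then show ?case using Suc.prems by (simp add: differentiable_on_def)
qed

lemma C_on_uminus:
  assumes "open U" "C_on m U f"
  shows "C_on m U (\<lambda>x. - f x)"
  using assms(2)
proof (induction m arbitrary: f)
  case 0
  then show ?case by (simp add: continuous_on_minus)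
next
  case (Suc m)
  have "- pd U f j x = pd U (\<lambda>x. - f x) j x" if x: "x \<in> U" for x j
  proof -
    have "((\<lambda>x. - f x) has_derivative (\<lambda>h. (- (\<chi> j. pd U f j x)) \<bullet> h)) (at x within U)"
      unfolding inner_minus_left using Suc.prems
      by (intro has_derivative_minus frechet_derivative_pd[OF assms(1) x]) simp_all
    from pd_open_eq[OF assms(1) x this] show ?thesis by simp
  qed
  moreover have "C_on m U (\<lambda>x. - pd U f j x)" for j using Suc by simp
  ultimately have "C_on m U (pd U (\<lambda>x. - f x) j)" for j by (rule C_on_cong)
  then show ?case using Suc.prems by (simp add: differentiable_on_def)
qed

lemma C_on_C1:
  assumes "open U" "\<And>m. C_on m U f"
  shows "C1_on U f (\<lambda>x. \<chi> j. pd U f j x)" "\<And>m. C_on m U (pd U f j)"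
proof -
  show *: "C_on m U (pd U f j)" for m j using assms(2)[of "Suc m"] by simp
  have "continuous_on U (\<lambda>x. \<chi> j. pd U f j x)"
    using *[of 0] by (intro continuous_on_vec_lambda) simp
  moreover have "f differentiable_on U" using assms(2)[of 1] by simp
  ultimately show "C1_on U f (\<lambda>x. \<chi> j. pd U f j x)"
    unfolding C1_on_def using frechet_derivative_pd[OF assms(1)] by blast
qed

section \<open>Smooth functions on the triangle, their \<open>rot\<close> and their
  divergence\<close>

context powell_sabin_split
begin

text \<open>The partial derivatives within \<open>T\<close> agree on \<open>T\<close>, boundary
  included, with those of the smooth extension, so repeated differentiation can be carried out on
  the open neighbourhood.\<close>

lemma CinfE:
  assumes "f \<in> Cinf T"
  obtains U g where "open U" "T \<subseteq> U" "\<And>m. C_on m U g" "\<And>x. x \<in> T \<Longrightarrow> f x = g x"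
    "C1_on T f (\<lambda>x. \<chi> j. pd U g j x)" "\<And>j x. x \<in> T \<Longrightarrow> pd T f j x = pd U g j x"
proof -
  obtain U g where U: "open U" "T \<subseteq> U" "\<And>m. C_on m U g" "\<And>x. x \<in> T \<Longrightarrow> f x = g x"
    using assms unfolding Cinf_def by blast
  have C: "C1_on T f (\<lambda>x. \<chi> j. pd U g j x)"
    by (rule C1_on_cong[OF C1_on_subset[OF C_on_C1(1)[OF U(1,3)] U(2)]]) (simp add: U(4))
  have "pd T f j x = pd U g j x" if x: "x \<in> T" for j x
  proof -
    have "(f has_derivative (\<lambda>h. (\<chi> j. pd U g j x) \<bullet> h)) (at x within T)"
      using C x by (simp add: C1_on_def)
    from pd_eq[OF x this] show ?thesis by simp
  qed
  with U C show thesis by (rule that)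
qed

lemma CinfI: "open U \<Longrightarrow> T \<subseteq> U \<Longrightarrow> (\<And>m. C_on m U g) \<Longrightarrow> (\<And>x. x \<in> T \<Longrightarrow> f x = g x) \<Longrightarrow> f \<in> Cinf T"
  unfolding Cinf_def by blast

text \<open>Makes \<open>rot T p\<close> an admissible argument of the vector-valued
  projection.\<close>

lemma Cinf_rot:
  assumes "p \<in> Cinf T"
  shows "rot T p \<in> Cinf_vec T"
proof -
  obtain U g where U: "open U" "T \<subseteq> U" "\<And>m. C_on m U g" "\<And>x. x \<in> T \<Longrightarrow> p x = g x"
    "C1_on T p (\<lambda>x. \<chi> j. pd U g j x)" "\<And>j x. x \<in> T \<Longrightarrow> pd T p j x = pd U g j x"
    using CinfE[OF assms] by blast
  have 1: "(\<lambda>x. rot T p x $ 1) \<in> Cinf T"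
    by (rule CinfI[OF U(1,2) C_on_C1(2)[OF U(1,3), where j = 2]]) (simp add: rot_def U(6))
  have 2: "(\<lambda>x. rot T p x $ 2) \<in> Cinf T"
    by (rule CinfI[OF U(1,2) C_on_uminus[OF U(1) C_on_C1(2)[OF U(1,3), where j = 1]]]) (simp add: rot_def U(6))
  show ?thesis unfolding Cinf_vec_def using 1 2 by (simp add: forall_2)
qed

text \<open>The components of \<open>v\<close> may be extended to different neighbourhoods of
  \<open>T\<close>, hence the intersection.\<close>

lemma Cinf_divg:
  assumes "v \<in> Cinf_vec T"
  shows "divg T v \<in> Cinf T"
proof -
  have v: "(\<lambda>x. v x $ j) \<in> Cinf T" for j using assms by (simp add: Cinf_vec_def)
  obtain U f where U: "open U" "T \<subseteq> U" "\<And>m. C_on m U f" "\<And>x. x \<in> T \<Longrightarrow> v x $ 1 = f x"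
    "C1_on T (\<lambda>x. v x $ 1) (\<lambda>x. \<chi> j. pd U f j x)" "\<And>j x. x \<in> T \<Longrightarrow> pd T (\<lambda>x. v x $ 1) j x = pd U f j x"
    using CinfE[OF v] by blast
  obtain W g where W: "open W" "T \<subseteq> W" "\<And>m. C_on m W g" "\<And>x. x \<in> T \<Longrightarrow> v x $ 2 = g x"
    "C1_on T (\<lambda>x. v x $ 2) (\<lambda>x. \<chi> j. pd W g j x)" "\<And>j x. x \<in> T \<Longrightarrow> pd T (\<lambda>x. v x $ 2) j x = pd W g j x"
    using CinfE[OF v] by blast
  have o: "open (U \<inter> W)" using U(1) W(1) by blast
  have "C_on m (U \<inter> W) (\<lambda>x. pd U f 1 x + pd W g 2 x)" for m
    by (rule C_on_add[OF o C_on_subset[OF U(1) o _ C_on_C1(2)[OF U(1,3)]] C_on_subset[OF W(1) o _ C_on_C1(2)[OF W(1,3)]]]) auto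
  then show ?thesis
    using o U(2) W(2) by (intro CinfI[of "U \<inter> W"]) (auto simp: divg_def sum_2 U(6) W(6))
qed

lemma Cinf_continuous: "f \<in> Cinf T \<Longrightarrow> continuous_on T f"
  using CinfE C1_on_continuous by metis

lemma Cinf_vec_pw_C1:
  assumes "v \<in> Cinf_vec T"
  shows "pw_C1 v"
proof -
  have "\<exists>G. C1_on T (\<lambda>x. v x $ j) G" for j
  proof -
    have "(\<lambda>x. v x $ j) \<in> Cinf T" using assms by (simp add: Cinf_vec_def)
    then show ?thesis by (rule CinfE) (rule exI)
  qed
  then obtain G where "\<And>j. C1_on T (\<lambda>x. v x $ j) (G j)" by metis
  then show ?thesis unfolding pw_C1_def using C1_on_subset ps_split_facts(5) by blast
qed

text \<open>Symmetry of the mixed derivatives on the open triangle, where derivatives within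
  \<open>T\<close> are full derivatives. The form covers both smooth functions and polynomial
  pieces.\<close>

lemma divg_rot_eq_0:
  assumes K: "K \<in> ps_split z" "x \<in> interior K"
    and G: "C1_on (interior K) q G" and H: "\<And>j. C1_on (interior K) (\<lambda>x. G x $ j) (H j)"
  shows "divg T (rot T q) x = 0"
proof -
  have at: "at y within interior K = at y" "at y within T = at y" if "y \<in> interior K" for y
    using at_within_open[OF that open_interior] at_within_interior[of y T] that interior_subset_T[OF K(1)]
    by blast+
  have r: "rot T q y = rot90 (G y)" if y: "y \<in> interior K" for y
    using G y by (intro grad_eq(2)[OF interior_mem_T[OF K(1) y]]) (simp add: C1_on_def at)
  have h: "((\<lambda>y. G y $ j) has_derivative (\<lambda>h. H j x \<bullet> h)) (at x)" for j
    using H[of j] K(2) by (simp add: C1_on_def at)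
  have d1: "((\<lambda>y. rot T q y $ 1) has_derivative (\<lambda>h. H 2 x \<bullet> h)) (at x within T)"
    unfolding at(2)[OF K(2)]
    by (rule has_derivative_transform_within_open[OF h[of 2] open_interior K(2)]) (simp add: r rot90_def)
  have "((\<lambda>y. - G y $ 1) has_derivative (\<lambda>h. (- H 1 x) \<bullet> h)) (at x)"
    unfolding inner_minus_left by (rule has_derivative_minus[OF h])
  then have d2: "((\<lambda>y. rot T q y $ 2) has_derivative (\<lambda>h. (- H 1 x) \<bullet> h)) (at x within T)"
    unfolding at(2)[OF K(2)]
    by (rule has_derivative_transform_within_open[OF _ open_interior K(2)]) (simp add: r rot90_def)
  have "divg T (rot T q) x = H 2 x $ 1 - H 1 x $ 2"
    using pd_eq[OF interior_mem_T[OF K] d1] pd_eq[OF interior_mem_T[OF K] d2] by (simp add: divg_def sum_2)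
  then show ?thesis using mixed_partials_eq[OF open_interior K(2) G H] by simp
qed

lemma Cinf_divg_rot:
  assumes p: "p \<in> Cinf T" and K: "K \<in> ps_split z" "x \<in> interior K"
  shows "divg T (rot T p) x = 0"
proof -
  obtain U g where U: "open U" "T \<subseteq> U" "\<And>m. C_on m U g" "\<And>x. x \<in> T \<Longrightarrow> p x = g x"
    "C1_on T p (\<lambda>x. \<chi> j. pd U g j x)" "\<And>j x. x \<in> T \<Longrightarrow> pd T p j x = pd U g j x"
    using CinfE[OF p] by blast
  have KT: "interior K \<subseteq> T" using interior_mem_T[OF K(1)] by blast
  show ?thesis
  proof (rule divg_rot_eq_0[OF K])
    show "C1_on (interior K) p (\<lambda>x. \<chi> j. pd U g j x)" by (rule C1_on_subset[OF U(5) KT])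
    show "C1_on (interior K) (\<lambda>x. (\<chi> j. pd U g j x) $ j) (\<lambda>x. \<chi> l. pd U (pd U g j) l x)" for j
      using C1_on_subset[OF C_on_C1(1)[OF U(1) C_on_C1(2)[OF U(1,3)]], of "interior K" j] KT U(2) by simp
  qed
qed

lemma L1_cong:
  assumes "v \<in> L1 z k" "\<And>x. x \<in> T \<Longrightarrow> v x = w x"
  shows "w \<in> L1 z k"
proof -
  have "(\<lambda>x. w x $ j) \<in> L0 z k" for j
  proof -
    have v: "(\<lambda>x. v x $ j) \<in> V2 z k" "continuous_on T (\<lambda>x. v x $ j)"
      using assms(1) by (simp_all add: L1_def L0_def)
    have "(\<lambda>x. w x $ j) \<in> V2 z k"
      unfolding V2_def mem_Collect_eq
    proof
      fix K assume K: "K \<in> ps_split z"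
      then obtain p where "p \<in> polys k" "\<forall>x\<in>interior K. v x $ j = p x"
        using v(1) unfolding V2_def by blast
      then show "\<exists>p\<in>polys k. \<forall>x\<in>interior K. w x $ j = p x"
        using assms(2) interior_mem_T[OF K] by (intro bexI[of _ p]) simp_all
    qed
    moreover have "continuous_on T (\<lambda>x. w x $ j)"
      using v(2) by (rule continuous_on_eq) (simp add: assms(2))
    ultimately show ?thesis by (simp add: L0_def)
  qed
  then show ?thesis by (simp add: L1_def)
qed

text \<open>Membership in \<open>S0\<close> gives equality with a continuous field only almost
  everywhere. On each triangle the \<open>rot\<close> is polynomial, so equality holds on the open
  triangle and by continuity on the closed one; hence the pieces have a common gradient on shared
  edges and glue to a continuously differentiable function.\<close>

lemma S0_structure:
  assumes q: "q \<in> S0 z k"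
  obtains g where "C1_on T q g" "rot T q \<in> L1 z (k - 1)"
    "\<And>K x. K \<in> ps_split z \<Longrightarrow> x \<in> interior K \<Longrightarrow> divg T (rot T q) x = 0"
proof -
  obtain h where h: "continuous_on T h" "AE x in lebesgue_on T. rot T q x = h x" and q0: "q \<in> L0 z k"
    using q unfolding S0_def by blast
  have n: "negligible {x \<in> T. \<not> rot T q x = h x}"
    using h(2) by (simp only: AE_lebesgue_on_iff_negligible[OF T_lebesgue])
  \<comment> \<open>The inverse quarter turn of \<open>h\<close>, that is, the gradient that has
    \<open>h\<close> as its \<open>rot\<close>.\<close>
  define g where "g = (\<lambda>x. vector [- h x $ 2, h x $ 1] :: real^2)"
  have hg: "rot90 (g x) = h x" for x by (simp add: g_def rot90_def vec_eq_iff forall_2)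
  have piece: "\<exists>G\<in>polys_vec (k - 1). (\<forall>x\<in>K. h x = rot90 (G x)) \<and> C1_on K q G" if K: "K \<in> ps_split z" for K
  proof -
    obtain p where p: "p \<in> polys k" "\<And>x. x \<in> K \<Longrightarrow> q x = p x" using L0_piece[OF q0 K] by blast
    obtain G where G: "G \<in> polys_vec (k - 1)" "\<And>S. C1_on S p G" using polys_C1[OF p(1)] by blast
    have qG: "C1_on K q G" by (rule C1_on_cong[OF G(2)]) (simp add: p(2))
    have KT: "interior K \<subseteq> T" using interior_mem_T[OF K] by blast
    have Gj: "continuous_on S (\<lambda>x. G x $ j)" for S j
      using G(1) by (auto simp: polys_vec_def intro: polys_continuous)
    have cG: "continuous_on S (\<lambda>x. rot90 (G x))" for S
      unfolding rot90_def by (intro continuous_on_vector2 continuous_on_minus Gj)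
    have r: "rot T q x = rot90 (G x)" if x: "x \<in> interior K" for x
    proof -
      have "x \<in> K" using x interior_subset by blast
      then have "(q has_derivative (\<lambda>h. G x \<bullet> h)) (at x within K)" using qG by (simp add: C1_on_def)
      from grad_eq(2)[OF interior_mem_T[OF K x] has_derivative_interior[OF K x this]] show ?thesis .
    qed
    have int: "h x - rot90 (G x) = 0" if x: "x \<in> interior K" for x
    proof -
      have "rot90 (G x) = h x"
      proof (rule continuous_eq_if_negligible[OF open_interior cG continuous_on_subset[OF h(1) KT] _ x])
        show "negligible {x \<in> interior K. rot90 (G x) \<noteq> h x}"
          using n by (rule negligible_subset) (use r KT in auto)
      qed
      then show ?thesis by simp
    qed
    have cK: "continuous_on (closure (interior K)) (\<lambda>x. h x - rot90 (G x))"
      unfolding ps_split_facts(6)[OF K]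
      by (intro continuous_on_diff cG continuous_on_subset[OF h(1) ps_split_facts(5)[OF K]])
    have "h x = rot90 (G x)" if x: "x \<in> K" for x
    proof -
      have "h x - rot90 (G x) = 0"
        by (rule continuous_constant_on_closure[OF cK int]) (simp_all add: ps_split_facts(6)[OF K] x)
      then show ?thesis by simp
    qed
    with G(1) qG show ?thesis by blast
  qed
  have C: "C1_on T q g"
  proof (rule C1_on_T)
    have "continuous_on T (\<lambda>x. h x $ j)" for j by (intro continuous_on_component h(1))
    then show "continuous_on T g" unfolding g_def by (intro continuous_on_vector2 continuous_on_minus)
    fix K assume "K \<in> ps_split z"
    from piece[OF this] obtain G where G: "\<forall>x\<in>K. h x = rot90 (G x)" "C1_on K q G" by blast
    have "G x = g x" if "x \<in> K" for x
      using G(1) that by (simp add: g_def rot90_def vec_eq_iff forall_2)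
    then show "C1_on K q g"
      using G(2) unfolding C1_on_def by (metis continuous_on_eq)
  qed
  have rh: "rot T q x = h x" if "x \<in> T" for x using rot_C1[OF C that] hg by simp
  have "h \<in> L1 z (k - 1)"
  proof -
    have "(\<lambda>x. h x $ j) \<in> L0 z (k - 1)" for j
    proof -
      have "\<exists>p\<in>polys (k - 1). \<forall>x\<in>interior K. h x $ j = p x" if K: "K \<in> ps_split z" for K
      proof -
        obtain G where G: "G \<in> polys_vec (k - 1)" "\<forall>x\<in>K. h x = rot90 (G x)" using piece[OF K] by blast
        have "(\<lambda>x. rot90 (G x) $ j) \<in> polys (k - 1)"
          using G(1) exhaust_2[of j] polys_uminus by (auto simp: rot90_def polys_vec_def)
        moreover have "h x $ j = rot90 (G x) $ j" if "x \<in> interior K" for x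
          using G(2) that interior_subset[of K] by (simp add: subset_iff)
        ultimately show ?thesis by (intro bexI[of _ "\<lambda>x. rot90 (G x) $ j"] ballI)
      qed
      then show ?thesis unfolding L0_def V2_def using h(1) by (simp add: continuous_on_component)
    qed
    then show ?thesis by (simp add: L1_def)
  qed
  then have L: "rot T q \<in> L1 z (k - 1)" by (rule L1_cong) (simp add: rh)
  have D: "divg T (rot T q) x = 0" if K: "K \<in> ps_split z" "x \<in> interior K" for K x
  proof -
    obtain G where G: "G \<in> polys_vec (k - 1)" "C1_on K q G" using piece[OF K(1)] by blast
    have "\<exists>H. C1_on (interior K) (\<lambda>x. G x $ j) H" for j
    proof -
      have "(\<lambda>x. G x $ j) \<in> polys (k - 1)" using G(1) by (simp add: polys_vec_def)
      then show ?thesis by (rule polys_C1) (rule exI)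
    qed
    then obtain H where "\<And>j. C1_on (interior K) (\<lambda>x. G x $ j) (H j)" by metis
    then show ?thesis by (rule divg_rot_eq_0[OF K C1_on_subset[OF G(2) interior_subset]])
  qed
  from C L D show thesis by (rule that)
qed

end

section \<open>Commutation\<close>

lemma edge_integral_diff:
  assumes "continuous_on (closed_segment a b) f" "continuous_on (closed_segment a b) g"
  shows "edge_integral a b (\<lambda>x. f x - g x) = edge_integral a b f - edge_integral a b g"
proof -
  have i: "(\<lambda>s. h (linepath a b s)) integrable_on {0..1}"
    if "continuous_on (closed_segment a b) h" for h :: "real^2 \<Rightarrow> real"
    by (intro integrable_continuous_real continuous_on_compose2[OF that continuous_on_linepath])
      (auto simp: linepath_in_path)
  show ?thesis
    unfolding edge_integral_def
    by (simp add: integral_diff[OF i[OF assms(1)] i[OF assms(2)]] right_diff_distrib)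
qed

text \<open>Integration by parts in arc length: the length factor of \<open>edge_integral\<close>
  turns the unit tangent into the parameter velocity \<open>b - a\<close>.\<close>

lemma edge_integral_tangential:
  assumes q: "C1_on K q g" and h: "C1_on K h H" and ab: "closed_segment a b \<subseteq> K" "a \<noteq> b"
  shows "edge_integral a b (\<lambda>x. (g x \<bullet> sgn (b - a)) * h x)
    = q b * h b - q a * h a - edge_integral a b (\<lambda>x. q x * (H x \<bullet> sgn (b - a)))"
proof -
  let ?l = "linepath a b"
  have n0: "norm (b - a) \<noteq> 0" using ab(2) by simp
  have qc: "continuous_on K q" "continuous_on K h" using q h by (auto intro: C1_on_continuous)
  have C: "C1_on K (\<lambda>x. q x * h x) (\<lambda>x. h x *\<^sub>R g x + q x *\<^sub>R H x)"
    unfolding C1_on_def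
  proof (intro conjI ballI)
    show "continuous_on K (\<lambda>x. h x *\<^sub>R g x + q x *\<^sub>R H x)"
      using q h qc unfolding C1_on_def by (intro continuous_on_add continuous_on_scaleR) simp_all
    fix x assume "x \<in> K"
    then have "(q has_derivative (\<lambda>h. g x \<bullet> h)) (at x within K)" "(h has_derivative (\<lambda>h. H x \<bullet> h)) (at x within K)"
      using q h by (simp_all add: C1_on_def)
    from has_derivative_mult[OF this]
    show "((\<lambda>x. q x * h x) has_derivative (\<lambda>k. (h x *\<^sub>R g x + q x *\<^sub>R H x) \<bullet> k)) (at x within K)"
      by (simp add: inner_add_left mult.commute add.commute)
  qed
  have c: "continuous_on {0..1} (\<lambda>s. q (?l s))" "continuous_on {0..1} (\<lambda>s. h (?l s))"
    "continuous_on {0..1} (\<lambda>s. g (?l s))" "continuous_on {0..1} (\<lambda>s. H (?l s))"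
    using C1_on_linepath(1,2)[OF q ab(1)] C1_on_linepath(1,2)[OF h ab(1)] by simp_all
  have i1: "(\<lambda>s. (g (?l s) \<bullet> (b - a)) * h (?l s)) integrable_on {0..1}"
    and i2: "(\<lambda>s. q (?l s) * (H (?l s) \<bullet> (b - a))) integrable_on {0..1}"
    by (intro integrable_continuous_real continuous_on_mult continuous_on_inner continuous_on_const c)+
  have "(h y *\<^sub>R g y + q y *\<^sub>R H y) \<bullet> (b - a) = (g y \<bullet> (b - a)) * h y + q y * (H y \<bullet> (b - a))" for y
    by (simp add: inner_add_left mult.commute)
  with integral_linepath_C1[OF C ab(1)]
  have "((\<lambda>s. (g (?l s) \<bullet> (b - a)) * h (?l s) + q (?l s) * (H (?l s) \<bullet> (b - a))) has_integral q b * h b - q a * h a) {0..1}"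
    by simp
  then have S: "integral {0..1} (\<lambda>s. (g (?l s) \<bullet> (b - a)) * h (?l s)) + integral {0..1} (\<lambda>s. q (?l s) * (H (?l s) \<bullet> (b - a)))
      = q b * h b - q a * h a"
    unfolding integral_add[OF i1 i2, symmetric] by (rule integral_unique)
  have sg: "v \<bullet> (b - a) = norm (b - a) * (v \<bullet> sgn (b - a))" for v
    using n0 by (simp add: sgn_div_norm)
  have e1: "edge_integral a b (\<lambda>x. (g x \<bullet> sgn (b - a)) * h x) = integral {0..1} (\<lambda>s. (g (?l s) \<bullet> (b - a)) * h (?l s))"
    unfolding edge_integral_def integral_mult_right[symmetric] sg by (simp only: mult.assoc)
  have e2: "edge_integral a b (\<lambda>x. q x * (H x \<bullet> sgn (b - a))) = integral {0..1} (\<lambda>s. q (?l s) * (H (?l s) \<bullet> (b - a)))"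
    unfolding edge_integral_def integral_mult_right[symmetric] sg by (simp only: mult.left_commute)
  show ?thesis unfolding e1 e2 using S by simp
qed

context powell_sabin_split
begin

section \<open>Linearity of the degrees of freedom on the discrete space\<close>

lemma half_edge_subset:
  assumes "i \<in> I" "(a, b) \<in> half_edges z i"
  shows "closed_segment a b \<subseteq> T"
  using assms(2) edge_subset_T[OF assms(1)] edge_halves[OF assms(1)] by (auto simp: half_edges_def)

text \<open>\<open>jump\<close> is built from \<open>Lim\<close>, which is additive only when the
  limits exist; the polynomial pieces provide them.\<close>

lemma V2_jump_diff:
  assumes "p \<in> V2 z k" "q \<in> V2 z k" "i \<in> I"
  shows "jump z (\<lambda>x. p x - q x) i = jump z p i - jump z q i"
proof -
  obtain p1 p2 where p: "p1 \<in> polys k" "p2 \<in> polys k"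
    "\<And>x. x \<in> interior (subtri1 z i) \<Longrightarrow> p x = p1 x" "\<And>x. x \<in> interior (subtri2 z i) \<Longrightarrow> p x = p2 x"
    "jump z p i = (p1 (m i) - p2 (m i)) *\<^sub>R outer_normal (z 0) (m i) (z (nxt i))"
    using V2_jump[OF assms(1,3)] by blast
  obtain q1 q2 where q: "q1 \<in> polys k" "q2 \<in> polys k"
    "\<And>x. x \<in> interior (subtri1 z i) \<Longrightarrow> q x = q1 x" "\<And>x. x \<in> interior (subtri2 z i) \<Longrightarrow> q x = q2 x"
    "jump z q i = (q1 (m i) - q2 (m i)) *\<^sub>R outer_normal (z 0) (m i) (z (nxt i))"
    using V2_jump[OF assms(2,3)] by blast
  have "jump z (\<lambda>x. p x - q x) i = ((p1 (m i) - q1 (m i)) - (p2 (m i) - q2 (m i))) *\<^sub>R outer_normal (z 0) (m i) (z (nxt i))"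
    by (rule jump_eq[OF assms(3)])
      (simp_all add: p(3,4) q(3,4) continuous_on_diff polys_continuous[OF p(1)] polys_continuous[OF p(2)]
        polys_continuous[OF q(1)] polys_continuous[OF q(2)])
  then show ?thesis by (simp add: p(5) q(5) algebra_simps)
qed

lemma jump_cong:
  assumes i: "i \<in> I" and eq: "\<And>K x. K \<in> ps_split z \<Longrightarrow> x \<in> interior K \<Longrightarrow> p x = q x"
    and q: "q \<in> V2 z k"
  shows "jump z p i = jump z q i"
proof -
  obtain q1 q2 where q: "q1 \<in> polys k" "q2 \<in> polys k"
    "\<And>x. x \<in> interior (subtri1 z i) \<Longrightarrow> q x = q1 x" "\<And>x. x \<in> interior (subtri2 z i) \<Longrightarrow> q x = q2 x"
    "jump z q i = (q1 (m i) - q2 (m i)) *\<^sub>R outer_normal (z 0) (m i) (z (nxt i))"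
    using V2_jump[OF q i] by blast
  have "jump z p i = (q1 (m i) - q2 (m i)) *\<^sub>R outer_normal (z 0) (m i) (z (nxt i))"
    by (rule jump_eq[OF i polys_continuous[OF q(1)] _ polys_continuous[OF q(2)]])
      (simp_all add: eq[OF subtri_mem(1)[OF i]] eq[OF subtri_mem(2)[OF i]] q(3,4))
  then show ?thesis by (simp add: q(5))
qed

lemma integral_T_cong:
  fixes f g :: "real^2 \<Rightarrow> real"
  assumes "\<And>K x. K \<in> ps_split z \<Longrightarrow> x \<in> interior K \<Longrightarrow> f x = g x"
  shows "integral T f = integral T g"
  by (rule integral_spike[OF negligible_interfaces]) (use assms in auto)

text \<open>Confined to open triangles, since on an interface the partial derivatives need not exist
  and \<open>pd\<close> is then unspecified.\<close>

lemma divg_L1_diff: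
  assumes "u \<in> L1 z k" "v \<in> L1 z k" "K \<in> ps_split z" "x \<in> interior K"
  shows "divg T (\<lambda>x. u x - v x) x = divg T u x - divg T v x"
proof -
  obtain G where G: "\<And>j. C1_on K (\<lambda>x. u x $ j) (G j)"
    using L1_pw_C1[OF assms(1)] assms(3) unfolding pw_C1_def by blast
  obtain H where H: "\<And>j. C1_on K (\<lambda>x. v x $ j) (H j)"
    using L1_pw_C1[OF assms(2)] assms(3) unfolding pw_C1_def by blast
  have "C1_on K (\<lambda>x. (u x - v x) $ j) (\<lambda>x. G j x - H j x)" for j
    unfolding C1_on_def
  proof (intro conjI ballI)
    show "continuous_on K (\<lambda>x. G j x - H j x)"
      using G[of j] H[of j] unfolding C1_on_def by (intro continuous_on_diff) simp_all
    fix x assume "x \<in> K"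
    then show "((\<lambda>x. (u x - v x) $ j) has_derivative (\<lambda>h. (G j x - H j x) \<bullet> h)) (at x within K)"
      unfolding inner_diff_left vector_minus_component using G[of j] H[of j] unfolding C1_on_def
      by (intro has_derivative_diff) simp_all
  qed
  from divg_interior[OF assms(3) this assms(4)] divg_interior[OF assms(3) G assms(4)] divg_interior[OF assms(3) H assms(4)]
  show ?thesis by simp
qed

lemma pw_cont_inner:
  fixes u v :: "real^2 \<Rightarrow> real^2"
  assumes "\<And>j. pw_cont (\<lambda>x. u x $ j)" "\<And>j. pw_cont (\<lambda>x. v x $ j)"
  shows "pw_cont (\<lambda>x. u x \<bullet> v x)"
  unfolding inner2 by (intro pw_cont_add pw_cont_mult assms)

lemma L1_pw_cont: "v \<in> L1 z k \<Longrightarrow> pw_cont (\<lambda>x. v x $ j)"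
  by (rule V2_pw_cont[of _ k]) (simp add: L1_def L0_def)

lemma dofs_L_edge:
  assumes "i \<in> I" "(a, b) \<in> half_edges z i" "w \<in> polys_vec (k - 2)"
  shows "(\<lambda>v. edge_integral a b (\<lambda>x. v x \<bullet> w x)) \<in> dofs_L z k"
  unfolding dofs_L_def using assms by blast

lemma dofs_L_cases [consumes 1]:
  assumes "\<phi> \<in> dofs_L z k"
  obtains i j where "i \<in> I" "\<phi> = (\<lambda>v. v (z i) $ j)"
    | i where "i \<in> I" "k = 1" "\<phi> = (\<lambda>v. edge_integral (z (nxt i)) (z (prv i)) (\<lambda>x. v x \<bullet> nrm z i))"
    | i j where "i \<in> I" "\<phi> = (\<lambda>v. jump z (divg T v) i $ j)"
    | i where "i \<in> I" "k \<ge> 2" "\<phi> = (\<lambda>v. v (m i) \<bullet> nrm z i)"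
    | i a b w where "i \<in> I" "(a, b) \<in> half_edges z i" "w \<in> polys_vec (k - 2)"
        "\<phi> = (\<lambda>v. edge_integral a b (\<lambda>x. v x \<bullet> w x))"
    | w where "w \<in> S0_bdry z (k + 1)" "\<phi> = (\<lambda>v. integral T (\<lambda>x. v x \<bullet> rot T w x))"
    | w where "w \<in> V2_ring z (k - 1)" "\<phi> = (\<lambda>v. integral T (\<lambda>x. divg T v x * w x))"
proof -
  have mem_if: "x \<in> (if P then A else {}) \<longleftrightarrow> P \<and> x \<in> A" for P x and A :: "'x set" by simp
  show thesis
    using assms unfolding dofs_L_def Un_iff mem_if mem_Collect_eq
    by (elim disjE exE conjE) (rule that; assumption)+
qed

text \<open>The functionals are not additive on arbitrary fields, since integrals and limits take
  default values where they do not exist. On \<open>L1\<close> every integrand is piecewise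
  continuous and every trace exists.\<close>

lemma dofs_L_diff:
  assumes u: "u \<in> L1 z k" and v: "v \<in> L1 z k" and \<phi>: "\<phi> \<in> dofs_L z k"
  shows "\<phi> (\<lambda>x. u x - v x) = \<phi> u - \<phi> v"
proof -
  have cu: "continuous_on S u" "continuous_on S v" if "S \<subseteq> T" for S
    using continuous_on_subset[OF L1_continuous[OF u] that] continuous_on_subset[OF L1_continuous[OF v] that] .
  from \<phi> show ?thesis
  proof (cases rule: dofs_L_cases)
    case (2 i)
    show ?thesis unfolding 2(3) inner_diff_left
      by (intro edge_integral_diff continuous_on_inner continuous_on_const cu edge_subset_T 2(1))
  next
    case (3 i j)
    have d: "divg T u \<in> V2 z (k - 1)" "divg T v \<in> V2 z (k - 1)" using u v by (simp_all add: L1_divg_V2)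
    have "jump z (divg T (\<lambda>x. u x - v x)) i = jump z (\<lambda>x. divg T u x - divg T v x) i"
      by (rule jump_cong[OF 3(1) divg_L1_diff[OF u v] V2_diff[OF d]])
    then show ?thesis unfolding 3(2) V2_jump_diff[OF d 3(1)] by simp
  next
    case (5 i a b w)
    have "continuous_on S w" for S using 5(3) by (rule polys_vec_continuous)
    then show ?thesis unfolding 5(4) inner_diff_left
      by (intro edge_integral_diff continuous_on_inner cu half_edge_subset[OF 5(1,2)])
  next
    case (6 w)
    have "w \<in> S0 z (k + 1)" using 6(1) by (simp add: S0_bdry_def)
    then have "rot T w \<in> L1 z (k + 1 - 1)" by (rule S0_structure)
    then have w: "pw_cont (\<lambda>x. rot T w x $ j)" for j by (rule L1_pw_cont)
    show ?thesis unfolding 6(2) inner_diff_left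
      by (intro integral_diff pw_cont_integrable(2) pw_cont_inner w L1_pw_cont[OF u] L1_pw_cont[OF v])
  next
    case (7 w)
    have w: "pw_cont w" using 7(1) by (intro V2_pw_cont[of w "k - 1"]) (simp add: V2_ring_def)
    have d: "pw_cont (divg T u)" "pw_cont (divg T v)" using u v by (simp_all add: pw_C1_divg L1_pw_C1)
    have "integral T (\<lambda>x. divg T (\<lambda>x. u x - v x) x * w x) = integral T (\<lambda>x. divg T u x * w x - divg T v x * w x)"
      by (rule integral_T_cong) (simp add: divg_L1_diff[OF u v] left_diff_distrib)
    also have "\<dots> = integral T (\<lambda>x. divg T u x * w x) - integral T (\<lambda>x. divg T v x * w x)"
      by (intro integral_diff pw_cont_integrable(2) pw_cont_mult d w)
    finally show ?thesis unfolding 7(2) .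
  qed (simp_all add: inner_diff_left)
qed

section \<open>Degrees of freedom of \<open>rot q\<close> in terms of those of
  \<open>q\<close>\<close>

lemma rot90_scaleR: "rot90 (c *\<^sub>R x) = c *\<^sub>R rot90 x"
  by (simp add: rot90_def vec_eq_iff forall_2)

lemma rot90_inner: "rot90 x \<bullet> rot90 y = x \<bullet> y"
  by (simp add: rot90_def inner2)

lemma tng_eq: "tng z i = (1 / norm (z (prv i) - z (nxt i))) *\<^sub>R (z (prv i) - z (nxt i))"
  by (simp add: tng_def sgn_div_norm divide_inverse)

text \<open>The normal is the quarter turn of the tangent and quarter turns preserve inner products:
  the normal component of \<open>rot q\<close> is the tangential derivative of
  \<open>q\<close>.\<close>

lemma rot90_inner_nrm:
  assumes "i \<in> I"
  shows "rot90 x \<bullet> nrm z i = x \<bullet> tng z i"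
  unfolding nrm_eq(1)[OF assms] tng_eq by (simp add: rot90_inner)

text \<open>Expansion in the orthonormal frame of the edge. With \<open>x\<close> a gradient, it
  splits an edge moment of \<open>rot q\<close> into a moment of the tangential and one of the
  normal derivative.\<close>

lemma rot90_inner_decompose:
  assumes "i \<in> I"
  shows "rot90 x \<bullet> w = (x \<bullet> tng z i) * (w \<bullet> nrm z i) - (x \<bullet> nrm z i) * (w \<bullet> tng z i)"
proof -
  define t where "t = tng z i"
  have n: "nrm z i = rot90 t"
    unfolding nrm_eq(1)[OF assms] t_def tng_eq rot90_scaleR ..
  have "norm t = 1" using nrm_eq(2)[OF assms] by (simp add: t_def tng_def norm_sgn)
  then have "t \<bullet> t = 1" by (simp add: norm_eq_1)
  then have t: "t $ 1 * t $ 1 + t $ 2 * t $ 2 = 1" by (simp add: inner2)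
  have "rot90 x \<bullet> w = (rot90 x \<bullet> w) * (t $ 1 * t $ 1 + t $ 2 * t $ 2)" unfolding t by simp
  also have "\<dots> = (x \<bullet> t) * (w \<bullet> rot90 t) - (x \<bullet> rot90 t) * (w \<bullet> t)"
    by (simp add: rot90_def inner2 algebra_simps)
  finally show ?thesis unfolding n t_def .
qed

lemma half_edge_sgn:
  assumes "i \<in> I" "(a, b) \<in> half_edges z i"
  shows "sgn (b - a) = tng z i"
proof -
  obtain c where "c > 0" "b - a = c *\<^sub>R (z (prv i) - z (nxt i))" using half_edge_dir[OF assms] .
  then show ?thesis by (simp add: tng_def sgn_scaleR)
qed

lemma dofs_S_edge:
  assumes "i \<in> I" "(a, b) \<in> half_edges z i" "p \<in> polys (r - 4)"
  shows "(\<lambda>q. edge_integral a b (\<lambda>x. q x * p x)) \<in> dofs_S z r"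
  unfolding dofs_S_def using assms by blast

text \<open>Each vector-valued functional of a \<open>rot\<close> is a combination of scalar ones of
  its potential. The discrete \<open>q\<close> and the smooth \<open>p\<close> enter alike, through
  continuous differentiability and a divergence-free \<open>rot\<close>.\<close>

lemma rot_dofs:
  assumes r: "r \<ge> 2" and q: "C1_on T q g" and p: "C1_on T p g'"
    and dofs: "\<And>\<phi>. \<phi> \<in> dofs_S z r \<Longrightarrow> \<phi> q = \<phi> p"
    and dq: "\<And>K x. K \<in> ps_split z \<Longrightarrow> x \<in> interior K \<Longrightarrow> divg T (rot T q) x = 0"
    and dp: "\<And>K x. K \<in> ps_split z \<Longrightarrow> x \<in> interior K \<Longrightarrow> divg T (rot T p) x = 0"
    and \<phi>: "\<phi> \<in> dofs_L z (r - 1)"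
  shows "\<phi> (rot T q) = \<phi> (rot T p)"
proof -
  have rot: "rot T q x = rot90 (g x)" "rot T p x = rot90 (g' x)" if "x \<in> T" for x
    using rot_C1[OF q that] rot_C1[OF p that] .
  have grad: "grad T q x = g x" "grad T p x = g' x" if "x \<in> T" for x
    using q p that by (auto simp: C1_on_def intro!: grad_eq(1)[OF that])
  have zT: "z i \<in> T" if "i \<in> I" for i using that by (auto simp: tri_def intro: hull_inc)
  have mT: "m i \<in> T" if "i \<in> I" for i
    using edge_subset_T[OF that] open_closed_segment[OF m_segment[OF that]] by blast
  have np: "nxt i \<in> I" "prv i \<in> I" if "i \<in> I" for i using that by auto
  have qz: "q (z i) = p (z i)" if "i \<in> I" for i
  proof -
    have "(\<lambda>q. q (z i)) \<in> dofs_S z r" using that unfolding dofs_S_def by blast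
    from dofs[OF this] show ?thesis .
  qed
  have gz: "g (z i) = g' (z i)" if i: "i \<in> I" for i
  proof -
    have "g (z i) $ j = g' (z i) $ j" for j
    proof -
      have "(\<lambda>q. grad T q (z i) $ j) \<in> dofs_S z r" using i unfolding dofs_S_def by blast
      from dofs[OF this] show ?thesis by (simp add: grad[OF zT[OF i]])
    qed
    then show ?thesis by (simp add: vec_eq_iff)
  qed
  have qm: "q (m i) = p (m i)" "g (m i) \<bullet> tng z i = g' (m i) \<bullet> tng z i" if i: "i \<in> I" and r3: "r \<ge> 3" for i
  proof -
    have "(\<lambda>q. q (m i)) \<in> dofs_S z r" "(\<lambda>q. grad T q (m i) \<bullet> tng z i) \<in> dofs_S z r"
      using i r3 unfolding dofs_S_def by auto
    from dofs[OF this(1)] dofs[OF this(2)]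
    show "q (m i) = p (m i)" "g (m i) \<bullet> tng z i = g' (m i) \<bullet> tng z i" by (simp_all add: grad[OF mT[OF i]])
  qed
  from \<phi> show ?thesis
  proof (cases rule: dofs_L_cases)
    case (1 i j)
    then show ?thesis using rot zT gz by simp
  next
    case (2 i)
    let ?a = "z (nxt i)" and ?b = "z (prv i)"
    have ne: "?a \<noteq> ?b" using nrm_eq(2)[OF 2(1)] by auto
    \<comment> \<open>With the constant weight \<open>1\<close>, integration by parts leaves the
      difference of the end values, which are vertex degrees of freedom.\<close>
    have one: "C1_on T (\<lambda>_. 1) (\<lambda>_. 0)" by (simp add: C1_on_def)
    have e: "edge_integral ?a ?b (\<lambda>x. rot T f x \<bullet> nrm z i) = f ?b - f ?a"
      if f: "C1_on T f G" for f G
    proof -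
      have "edge_integral ?a ?b (\<lambda>x. rot T f x \<bullet> nrm z i) = edge_integral ?a ?b (\<lambda>x. (G x \<bullet> sgn (?b - ?a)) * 1)"
      proof (rule edge_integral_cong)
        fix x assume "x \<in> closed_segment ?a ?b"
        then have "x \<in> T" using edge_subset_T[OF 2(1)] by blast
        then show "rot T f x \<bullet> nrm z i = (G x \<bullet> sgn (?b - ?a)) * 1"
          by (simp add: rot_C1[OF f] rot90_inner_nrm[OF 2(1)] tng_def)
      qed
      also have "\<dots> = f ?b * 1 - f ?a * 1 - edge_integral ?a ?b (\<lambda>x. f x * (0 \<bullet> sgn (?b - ?a)))"
        by (rule edge_integral_tangential[OF f one edge_subset_T[OF 2(1)] ne])
      also have "\<dots> = f ?b - f ?a" by (simp add: edge_integral_def)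
      finally show ?thesis .
    qed
    show ?thesis unfolding 2(3) e[OF q] e[OF p] using qz np[OF 2(1)] by simp
  next
    case (3 i j)
    have 0: "(\<lambda>_. 0) \<in> V2 z 0" unfolding V2_def by (auto intro: bexI[OF _ polys_zero])
    have "jump z (divg T (rot T q)) i = jump z (\<lambda>_. 0) i" "jump z (divg T (rot T p)) i = jump z (\<lambda>_. 0) i"
      by (rule jump_cong[OF 3(1) _ 0]; simp add: dq dp)+
    then show ?thesis unfolding 3(2) by simp
  next
    case (4 i)
    \<comment> \<open>The condition \<open>k \<ge> 2\<close> with \<open>k = r - 1\<close> is
      exactly the range in which the tangential derivative at \<open>z (3 + i)\<close> belongs to
      the scalar family.\<close>
    then have "r \<ge> 3" by simp
    with 4 show ?thesis using rot[OF mT[OF 4(1)]] qm(2)[OF 4(1)] by (simp add: rot90_inner_nrm[OF 4(1)])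
  next
    case (5 i a b w)
    note ab = half_edge_subset[OF 5(1,2)] half_edge_ne[OF 5(1,2)]
    have w: "w \<in> polys_vec (r - 3)" using 5(3) by simp
    show ?thesis
    proof (cases "r \<ge> 3")
      case False
      \<comment> \<open>For \<open>r = 2\<close> the weights have degree bound \<open>-1\<close> and
        are zero.\<close>
      have "w x $ j = 0" for x j
        using w False by (intro polys_neg_degree[of "\<lambda>x. w x $ j" "r - 3"]) (simp_all add: polys_vec_def)
      then have "w x = 0" for x by (simp add: vec_eq_iff)
      then show ?thesis unfolding 5(4) by simp
    next
      case True
      define h where "h = (\<lambda>x. w x \<bullet> nrm z i)"
      define s where "s = (\<lambda>x. w x \<bullet> tng z i)"
      have h: "h \<in> polys (r - 3)" and s: "s \<in> polys (r - 3)"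
        unfolding h_def s_def using w by (simp_all add: polys_vec_inner)
      obtain H where H: "H \<in> polys_vec (r - 3 - 1)" "\<And>S. C1_on S h H" using polys_C1[OF h] by blast
      \<comment> \<open>Differentiating the weight once lands in degree \<open>r - 4\<close>, the
        degree of the moments of \<open>q\<close> itself; the moments of the normal derivative keep
        degree \<open>r - 3\<close>.\<close>
      have t: "(\<lambda>x. H x \<bullet> tng z i) \<in> polys (r - 4)" using polys_vec_inner[OF H(1)] by simp
      have ch: "continuous_on S h" "continuous_on S s" for S using h s by (auto intro: polys_continuous)
      have e: "edge_integral a b (\<lambda>x. rot T f x \<bullet> w x) = f b * h b - f a * h a
          - edge_integral a b (\<lambda>x. f x * (H x \<bullet> tng z i)) - edge_integral a b (\<lambda>x. (grad T f x \<bullet> nrm z i) * s x)"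
        if f: "C1_on T f G" for f G
      proof -
        have G: "continuous_on (closed_segment a b) G"
          using f ab(1) unfolding C1_on_def by (blast intro: continuous_on_subset)
        have gr: "rot T f x = rot90 (G x)" "grad T f x = G x" if "x \<in> closed_segment a b" for x
        proof -
          have x: "x \<in> T" using that ab(1) by blast
          show "rot T f x = rot90 (G x)" by (rule rot_C1[OF f x])
          show "grad T f x = G x" using f x by (intro grad_eq(1)[OF x]) (simp add: C1_on_def)
        qed
        have "edge_integral a b (\<lambda>x. rot T f x \<bullet> w x)
          = edge_integral a b (\<lambda>x. (G x \<bullet> tng z i) * h x - (G x \<bullet> nrm z i) * s x)"
          by (rule edge_integral_cong) (simp add: gr rot90_inner_decompose[OF 5(1)] h_def s_def)
        also have "\<dots> = edge_integral a b (\<lambda>x. (G x \<bullet> tng z i) * h x) - edge_integral a b (\<lambda>x. (G x \<bullet> nrm z i) * s x)"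
          by (intro edge_integral_diff continuous_on_mult continuous_on_inner continuous_on_const G ch)
        also have "edge_integral a b (\<lambda>x. (G x \<bullet> nrm z i) * s x) = edge_integral a b (\<lambda>x. (grad T f x \<bullet> nrm z i) * s x)"
          by (rule edge_integral_cong) (simp add: gr)
        also have "edge_integral a b (\<lambda>x. (G x \<bullet> tng z i) * h x)
          = f b * h b - f a * h a - edge_integral a b (\<lambda>x. f x * (H x \<bullet> tng z i))"
          using edge_integral_tangential[OF f H(2) ab] by (simp only: half_edge_sgn[OF 5(1,2)])
        finally show ?thesis .
      qed
      have "(\<lambda>q. edge_integral a b (\<lambda>x. (grad T q x \<bullet> nrm z i) * s x)) \<in> dofs_S z r"
        unfolding dofs_S_def using 5(1,2) s by blast
      note d1 = dofs[OF this]
      have d2: "edge_integral a b (\<lambda>x. q x * (H x \<bullet> tng z i)) = edge_integral a b (\<lambda>x. p x * (H x \<bullet> tng z i))"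
        using dofs[OF dofs_S_edge[OF 5(1,2) t]] .
      have "a \<in> {z (nxt i), m i}" "b \<in> {m i, z (prv i)}" using 5(2) by (auto simp: half_edges_def)
      then have "q a = p a" "q b = p b" using qz np[OF 5(1)] qm(1)[OF 5(1) True] by auto
      then show ?thesis unfolding 5(4) e[OF q] e[OF p] d1 d2 by simp
    qed
  next
    case (6 w)
    have "(\<lambda>q. integral T (\<lambda>x. rot T q x \<bullet> rot T w x)) \<in> dofs_S z r"
      unfolding dofs_S_def using 6(1) by auto
    from dofs[OF this] show ?thesis unfolding 6(2) .
  next
    case (7 w)
    have "integral T (\<lambda>x. divg T (rot T q) x * w x) = integral T (\<lambda>x. divg T (rot T p) x * w x)"
      by (rule integral_T_cong) (simp add: dq dp)
    then show ?thesis unfolding 7(2) .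
  qed
qed

text \<open>Holds at every point of \<open>T\<close>: the difference lies in \<open>L1\<close>, so
  unisolvence forces it to vanish pointwise.\<close>

lemma rot_commutes:
  assumes r: "r \<ge> 2"
    and P0: "induced_projection (dofs_S z r) (Cinf T) (S0 z r) Pi0"
    and P1: "induced_projection (dofs_L z (r - 1)) (Cinf_vec T) (L1 z (r - 1)) Pi1"
    and p: "p \<in> Cinf T" and x: "x \<in> T"
  shows "rot T (Pi0 p) x = Pi1 (rot T p) x"
proof -
  define q where "q = Pi0 p"
  have q: "q \<in> S0 z r" "\<And>\<phi>. \<phi> \<in> dofs_S z r \<Longrightarrow> \<phi> q = \<phi> p"
    using P0 p unfolding induced_projection_def q_def by blast+
  define u where "u = Pi1 (rot T p)"
  have u: "u \<in> L1 z (r - 1)" "\<And>\<phi>. \<phi> \<in> dofs_L z (r - 1) \<Longrightarrow> \<phi> u = \<phi> (rot T p)"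
    using P1 Cinf_rot[OF p] unfolding induced_projection_def u_def by blast+
  obtain g where g: "C1_on T q g" "rot T q \<in> L1 z (r - 1)"
    "\<And>K x. K \<in> ps_split z \<Longrightarrow> x \<in> interior K \<Longrightarrow> divg T (rot T q) x = 0"
    using S0_structure[OF q(1)] by blast
  obtain g' where g': "C1_on T p g'" by (rule CinfE[OF p])
  have "\<phi> (\<lambda>x. rot T q x - u x) = 0" if "\<phi> \<in> dofs_L z (r - 1)" for \<phi>
    using dofs_L_diff[OF g(2) u(1) that] u(2)[OF that]
      rot_dofs[OF r g(1) g' q(2) g(3) Cinf_divg_rot[OF p] that] by simp
  then have "rot T q x - u x = 0"
    by (intro L1_unisolvent[OF L1_diff[OF g(2) u(1)] _ _ x]) (use r in auto)
  then show ?thesis by (simp add: q_def u_def)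
qed

text \<open>The mean of the divergence is not listed in (B). It is recovered from the boundary
  fluxes, which the edge functionals fix.\<close>

lemma divg_commutes:
  assumes r: "r \<ge> 2"
    and P1: "induced_projection (dofs_L z (r - 1)) (Cinf_vec T) (L1 z (r - 1)) Pi1"
    and P2: "induced_projection (dofs_V z (r - 2)) (Cinf T) (V2 z (r - 2)) Pi2"
    and v: "v \<in> Cinf_vec T"
  shows "AE x in lebesgue_on T. divg T (Pi1 v) x = Pi2 (divg T v) x"
proof -
  define u where "u = Pi1 v"
  have u: "u \<in> L1 z (r - 1)" "\<And>\<phi>. \<phi> \<in> dofs_L z (r - 1) \<Longrightarrow> \<phi> u = \<phi> v"
    using P1 v unfolding induced_projection_def u_def by blast+
  define Q where "Q = Pi2 (divg T v)"
  have Q: "Q \<in> V2 z (r - 2)" "\<And>\<phi>. \<phi> \<in> dofs_V z (r - 2) \<Longrightarrow> \<phi> Q = \<phi> (divg T v)"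
    using P2 Cinf_divg[OF v] unfolding induced_projection_def Q_def by blast+
  have du: "divg T u \<in> V2 z (r - 2)" using L1_divg_V2[OF u(1)] by simp
  have cv: "continuous_on T v"
    by (rule continuous_on_vec2, rule Cinf_continuous) (use v in \<open>simp add: Cinf_vec_def\<close>)
  have edges: "edge_integral (z (nxt i)) (m i) (\<lambda>x. u x \<bullet> nrm z i) + edge_integral (m i) (z (prv i)) (\<lambda>x. u x \<bullet> nrm z i)
      = edge_integral (z (nxt i)) (m i) (\<lambda>x. v x \<bullet> nrm z i) + edge_integral (m i) (z (prv i)) (\<lambda>x. v x \<bullet> nrm z i)"
    if i: "i \<in> I" for i
  proof (cases "r = 2")
    case True
    have "(\<lambda>v. edge_integral (z (nxt i)) (z (prv i)) (\<lambda>x. v x \<bullet> nrm z i)) \<in> dofs_L z (r - 1)"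
      unfolding dofs_L_def using i True by auto
    note d = u(2)[OF this]
    have s: "edge_integral (z (nxt i)) (z (prv i)) (\<lambda>x. f x \<bullet> nrm z i)
      = edge_integral (z (nxt i)) (m i) (\<lambda>x. f x \<bullet> nrm z i) + edge_integral (m i) (z (prv i)) (\<lambda>x. f x \<bullet> nrm z i)"
      if "continuous_on T f" for f
      using continuous_on_subset[OF that edge_subset_T[OF i]]
      by (intro edge_integral_split m_segment[OF i] continuous_on_inner continuous_on_const)
    show ?thesis using d unfolding s[OF cv] s[OF L1_continuous[OF u(1)]] .
  next
    case False
    \<comment> \<open>From \<open>r = 3\<close> on, constants are admissible weights, so the
      constant field \<open>nrm z i\<close> reads off the flux through each half; for
      \<open>r = 2\<close> only the flux through the whole edge is given, which suffices for the
      sum.\<close>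
    have n: "(\<lambda>_. nrm z i) \<in> polys_vec (r - 1 - 2)"
      using False r by (simp add: polys_vec_def polys_const)
    have "(\<lambda>v. edge_integral a b (\<lambda>x. v x \<bullet> nrm z i)) \<in> dofs_L z (r - 1)" if "(a, b) \<in> half_edges z i" for a b
      by (rule dofs_L_edge[OF i that n])
    from u(2)[OF this] show ?thesis by (simp add: half_edges_def)
  qed
  have int: "integral T (divg T u) = integral T (divg T v)"
    unfolding divergence_T_edges[OF L1_pw_C1[OF u(1)]] divergence_T_edges[OF Cinf_vec_pw_C1[OF v]]
    by (rule sum.cong[OF refl edges])
  have "integral T \<in> dofs_V z (r - 2)" unfolding dofs_V_def by blast
  note intQ = Q(2)[OF this]
  have pc: "pw_cont (divg T u)" "pw_cont Q" using du Q(1) by (auto intro: V2_pw_cont)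
  \<comment> \<open>\<open>divg T v\<close> is the common reference: (B) for \<open>u\<close> and
    (C) for \<open>Q\<close> give the same jumps and the same moments against
    \<open>V2_ring z (r - 2)\<close>, as \<open>k - 1 = r - 2\<close>.\<close>
  have "negligible {x \<in> T. divg T u x - Q x \<noteq> 0}"
  proof (rule V2_eq_0[OF V2_diff[OF du Q(1)]])
    fix i assume i: "i \<in> I"
    have "jump z (divg T u) i $ j = jump z (divg T v) i $ j" for j
    proof -
      have "(\<lambda>v. jump z (divg T v) i $ j) \<in> dofs_L z (r - 1)" unfolding dofs_L_def using i by blast
      from u(2)[OF this] show ?thesis .
    qed
    moreover have "jump z Q i $ j = jump z (divg T v) i $ j" for j
    proof -
      have "(\<lambda>q. jump z q i $ j) \<in> dofs_V z (r - 2)" unfolding dofs_V_def using i by blast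
      from Q(2)[OF this] show ?thesis .
    qed
    ultimately show "jump z (\<lambda>x. divg T u x - Q x) i = 0"
      unfolding V2_jump_diff[OF du Q(1) i] by (simp add: vec_eq_iff)
  next
    show "integral T (\<lambda>x. divg T u x - Q x) = 0"
      using integral_diff[OF pw_cont_integrable(2)[OF pc(1)] pw_cont_integrable(2)[OF pc(2)]] int intQ by simp
  next
    fix w assume w: "w \<in> V2_ring z (r - 2)"
    then have "(\<lambda>v. integral T (\<lambda>x. divg T v x * w x)) \<in> dofs_L z (r - 1)"
      unfolding dofs_L_def by auto
    from u(2)[OF this] have 1: "integral T (\<lambda>x. divg T u x * w x) = integral T (\<lambda>x. divg T v x * w x)" .
    have "(\<lambda>q. integral T (\<lambda>x. q x * w x)) \<in> dofs_V z (r - 2)"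
      unfolding dofs_V_def using w by blast
    from Q(2)[OF this] have 2: "integral T (\<lambda>x. Q x * w x) = integral T (\<lambda>x. divg T v x * w x)" .
    have pw: "pw_cont w" using w by (intro V2_pw_cont[of w "r - 2"]) (simp add: V2_ring_def)
    have "integral T (\<lambda>x. (divg T u x - Q x) * w x) = integral T (\<lambda>x. divg T u x * w x) - integral T (\<lambda>x. Q x * w x)"
      unfolding left_diff_distrib by (intro integral_diff pw_cont_integrable(2) pw_cont_mult pc pw)
    then show "integral T (\<lambda>x. (divg T u x - Q x) * w x) = 0" using 1 2 by simp
  qed
  then show ?thesis
    unfolding AE_lebesgue_on_iff_negligible[OF T_lebesgue] u_def[symmetric] Q_def[symmetric] by simp
qed

end

theorem theorem4p9:
  fixes z :: "nat \<Rightarrow> real^2" and r :: int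
    and Pi0 Pi2 :: "(real^2 \<Rightarrow> real) \<Rightarrow> (real^2 \<Rightarrow> real)"
    and Pi1 :: "(real^2 \<Rightarrow> real^2) \<Rightarrow> (real^2 \<Rightarrow> real^2)"
  assumes "powell_sabin z"
    and "r \<ge> 2"
    and "induced_projection (dofs_S z r) (Cinf (tri z)) (S0 z r) Pi0"
    and "induced_projection (dofs_L z (r - 1)) (Cinf_vec (tri z)) (L1 z (r - 1)) Pi1"
    and "induced_projection (dofs_V z (r - 2)) (Cinf (tri z)) (V2 z (r - 2)) Pi2"
  shows "(\<forall>v\<in>Cinf_vec (tri z).
            AE x in lebesgue_on (tri z). divg (tri z) (Pi1 v) x = Pi2 (divg (tri z) v) x) \<and>
         (\<forall>p\<in>Cinf (tri z). \<forall>x\<in>tri z. rot (tri z) (Pi0 p) x = Pi1 (rot (tri z) p) x)"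
proof -
  interpret powell_sabin_split z by (rule powell_sabin_split.intro[OF assms(1)])
  show ?thesis
    using divg_commutes[OF assms(2,4,5)] rot_commutes[OF assms(2,3,4)] by blast
qed

end
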